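(* Let $n\geq3$, let $D=\{x_1,\dots,x_n\}\subset\mathbb{C}\mathbb{P}^1$ be a set of $n$ ordered distinct points, and let $\Theta:\mathcal{H}_0^n\to\mathcal{H}_0^n$ be the involution $(E,\Phi)\mapsto(E^*,\Phi^t)$. The fixed-point set of $\Theta$ is $$\mathcal{H}_{0,n}^{\mathbb{R}}:=\bigcup_{\substack{1\in S\subset\{1,\dots,n\}\\2\le|S|\le n-2}}\mathcal{Z}_S,$$ where $\mathcal{Z}_S\subset\mathcal{H}_0^n$ is formed by the quasi-parabolic $SL(2,\mathbb{R})$-Higgs bundles $(E,\Phi)\in\mathcal{H}_0^n$ such that (i) the quasi-parabolic vector bundle $E$ admits a direct sum decomposition $E=L_0\oplus L_1$, where $L_0$ and $L_1$ are trivial line bundles over $\mathbb{C}\mathbb{P}^1$, and the quasi-parabolic structure at $D$ is given by $E_x=E_{x,1}\supset E_{x,2}\supset\{0\}$ with $E_{x,2}=(L_0)_x$ for $x\in\{x_i\in D:i\in S\}$ and $E_{x,2}=(L_1)_x$ for the other $x\in D$; (ii) the Higgs field is of the form $$\Phi=\begin{pmatrix}0&\alpha\\\beta&0\end{pmatrix}:E\to E\otimes K_{\mathbb{C}\mathbb{P}^1}(D)$$ with respect to this decomposition, with $\beta=0$ on the fibers over $x_i\in D$ with $i\in S$ and $\alpha=0$ on the fibers over $x_i$ with $i\in S^c$ (i.e. over $x_i$ it is upper or lower triangular according to whether $i\in S$ or $i\in S^c$). Moreover, each $\mathcal{Z}_S$ is a non-compact manifold of (real) dimension $2(n-3)$,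 and $\mathcal{H}_{0,n}^{\mathbb{R}}$ has $2^{n-1}-(n+1)$ connected components.
   Context: A rank-$2$ quasi-parabolic bundle over $\Sigma=\mathbb{C}\mathbb{P}^1$ at $D$ is a rank-$2$ holomorphic vector bundle $E$ with complete flags $E_x=E_{x,1}\supsetneq E_{x,2}\supsetneq\{0\}$, $\dim E_{x,2}=1$, for each $x\in D$. A quasi-parabolic Higgs bundle is a pair $(E,\Phi)$ with $\Phi\in H^0(\Sigma,SQParEnd(E)\otimes K_\Sigma(D))$, i.e. $\Phi$ is a meromorphic $End(E)$-valued one-form with at most simple poles along $D$ whose residues satisfy $(\mathrm{Res}_x\Phi)(E_{x,1})\subset E_{x,2}$ and $(\mathrm{Res}_x\Phi)(E_{x,2})=0$ for $x\in D$. It is an $SL(2,\mathbb{C})$-Higgs bundle if $\det E$ is trivial and $\Phi$ is traceless. For a line subbundle $L\subset E$ put $S_L=\{x\in D:L_x\cap E_{x,2}\ne\{0\}\}$; the quasi-parabolic slopes are $\text{q-par}\,\mu(E)=\frac12\deg E+\frac12|D|$ and $\text{q-par}\,\mu(L)=\deg L+\frac12|S_L|$. The Higgs bundle $(E,\Phi)$ is stable if $\mathrm{Res}_x\Phi\neq0$ for each $x\in D$ and $\text{q-par}\,\mu(E)>\text{q-par}\,\mu(L)$ for every line subbundle $L$ preserved by $\Phi$. Isomorphisms are bundle isomorphisms preserving flags and intertwining Higgs fields. $\mathcal{H}_0^n$ is the set of isomorphism classes of stable rank-$2$ quasi-parabolic $SL(2,\mathbb{C})$-Higgs bundles over $\mathbb{C}\mathbb{P}^1$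 at $D$ with $E$ holomorphically trivial. Complex structure on $\mathcal{H}_0^n$: for $E=\mathbb{C}\mathbb{P}^1\times\mathbb{C}^2$ the data are lines $X_i=E_{x_i,2}\in\mathbb{C}\mathbb{P}^1$ and residues $N_i=\mathrm{Res}_{x_i}\Phi$ with $\sum_iN_i=0$ (the residues determine $\Phi$). Given a disjoint decomposition $\{1,\dots,n\}=A\cup B$, $j\in A$, $k\in B$, consider classes that have a representative with $X_i=[1:w_i]$ for $i\in A$, $X_i=[z_i:1]$ for $i\in B$, $w_j=0$, $z_k=0$, and $N_i=\lambda_i\begin{pmatrix}-w_i&1\\-w_i^2&w_i\end{pmatrix}$ for $i\in A$, $N_i=\lambda_i\begin{pmatrix}-z_i&z_i^2\\-1&z_i\end{pmatrix}$ for $i\in B$, $\lambda_i\in\mathbb{C}^*$, $\lambda_j=1$. Such a representative is unique, and the parameters are subject only to $\sum_iN_i=0$; this condition is used to eliminate $\lambda_k$ and the two parameters attached to one further index $i_0$, the remaining $w_i,z_i,\lambda_i$ being local holomorphic coordinates. These coordinates, for all $(A,B,j,k)$, define the complex manifold structure (of real dimension $4(n-3)$) on $\mathcal{H}_0^n$. Dual: $E^*$ is the dual bundle with the dual flags $E_x^*\supset E_{x,2}^0\supset\{0\}$, where $E_{x,2}^0=\{f\in E_x^*:f(E_{x,2})=0\}$, and $\Phi^t$ is the transpose of $\Phi$. A rank-$2$ quasi-parabolic $SL(2,\mathbb{R})$-Higgs bundle over $\Sigma$ at $D$ is a rank-$2$ quasi-parabolic Higgs bundle $(E,\Phi)$ with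 $E=L\oplus L^{-1}$ for some line bundle $L$, with $E_{x,2}=L_x$ for $x$ in some subset $S_L\subset D$ and $E_{x,2}=L_x^{-1}$ for $x\in D\setminus S_L$, and $\Phi=\begin{pmatrix}0&\alpha\\\beta&0\end{pmatrix}$ with $\beta=0$ on the fibers over $S_L$ and $\alpha=0$ on those over $D\setminus S_L$. Here $\alpha,\beta$ are sections of line bundles twisted by $K_\Sigma(D)$, and vanishing on the fiber over $x\in D$ means that the residue at $x$ vanishes. $S^c$ denotes the complement of $S$ in $\{1,\dots,n\}$. *)

theory Defs
  imports "HOL-Complex_Analysis.Complex_Analysis"
begin

section \<open>The Riemann sphere\<close>

datatype cp1 = Aff complex | Infty

text \<open>\<open>loc p\<close> is the local coordinate centred at \<open>p\<close>, read as a parametrization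
  \<open>t \<mapsto> loc p t\<close> with \<open>loc p 0 = p\<close>: it is \<open>z = a + t\<close> at a finite point \<open>a\<close> and \<open>z = 1/t\<close>
  at infinity.\<close>

fun loc :: "cp1 \<Rightarrow> complex \<Rightarrow> cp1" where
  "loc (Aff a) t = Aff (a + t)"
| "loc Infty t = (if t = 0 then Infty else Aff (1 / t))"

instantiation cp1 :: topological_space
begin

definition open_cp1 :: "cp1 set \<Rightarrow> bool" where
  "open_cp1 U \<longleftrightarrow> (\<forall>p\<in>U. \<forall>\<^sub>F t in nhds 0. loc p t \<in> U)"

instance
proof
  show "open (UNIV :: cp1 set)"
    by (simp add: open_cp1_def)
next
  fix S T :: "cp1 set"
  assume "open S" "open T"
  then show "open (S \<inter> T)"
    by (auto simp: open_cp1_def intro: eventually_conj)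
next
  fix K :: "cp1 set set"
  assume K: "\<forall>S\<in>K. open S"
  show "open (\<Union>K)"
    unfolding open_cp1_def
  proof
    fix p assume "p \<in> \<Union>K"
    then obtain S where S: "S \<in> K" "p \<in> S" by blast
    with K have "\<forall>\<^sub>F t in nhds 0. loc p t \<in> S"
      by (simp add: open_cp1_def)
    then show "\<forall>\<^sub>F t in nhds 0. loc p t \<in> \<Union>K"
      by (rule eventually_mono) (use S in blast)
  qed
qed

end

text \<open>Holomorphy on an open set of the sphere is complex differentiability in the local coordinate
  at every point of the set.\<close>

definition hol_on :: "(cp1 \<Rightarrow> complex) \<Rightarrow> cp1 set \<Rightarrow> bool" where
  "hol_on f U \<longleftrightarrow> (\<forall>p\<in>U. (\<lambda>t. f (loc p t)) field_differentiable at 0)"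

text \<open>A one-form is stored as a function \<open>a :: cp1 \<Rightarrow> complex\<close>: its value at \<open>p\<close> is the coefficient
  of \<open>dz\<close> when \<open>p\<close> is finite, and of \<open>d(1/z)\<close> when \<open>p\<close> is infinity. \<open>form_coeff a p t\<close> is its
  coefficient in the local coordinate \<open>t\<close> centred at \<open>p\<close>; at infinity \<open>z = 1/t\<close> and
  \<open>dz = - dt / t^2\<close>.\<close>

fun form_coeff :: "(cp1 \<Rightarrow> complex) \<Rightarrow> cp1 \<Rightarrow> complex \<Rightarrow> complex" where
  "form_coeff a (Aff z) t = a (Aff (z + t))"
| "form_coeff a Infty t = (if t = 0 then a Infty else - a (Aff (1 / t)) / t ^ 2)"

text \<open>Sections over \<open>V\<close> of \<open>K(D)\<close>: one-forms holomorphic off \<open>D\<close> with at most simple poles at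
  the points of \<open>D\<close>. The stored values at points of \<open>D\<close> are irrelevant.\<close>

definition log_form_on :: "cp1 set \<Rightarrow> cp1 set \<Rightarrow> (cp1 \<Rightarrow> complex) \<Rightarrow> bool" where
  "log_form_on D V a \<longleftrightarrow>
     (\<forall>p\<in>V - D. form_coeff a p field_differentiable at 0) \<and>
     (\<forall>p\<in>V \<inter> D. \<exists>c. ((\<lambda>t. t * form_coeff a p t) \<longlongrightarrow> c) (at 0))"


section \<open>Holomorphic vector bundles over the sphere\<close>

text \<open>Each fibre is identified, as a vector space, with the standard one (choose a basis of every
  fibre, with no continuity whatsoever); the holomorphic structure is then carried by an atlas of
  local holomorphic frames \<open>(V, f)\<close>, where the columns of \<open>f p\<close> are the frame at \<open>p\<close>. Every
  holomorphic bundle of rank \<open>CARD('r)\<close> is isomorphic to one of this kind.\<close>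

type_synonym 'r hbundle = "(cp1 set \<times> (cp1 \<Rightarrow> complex ^ 'r ^ 'r)) set"

definition hol_section ::
    "'r::finite hbundle \<Rightarrow> cp1 set \<Rightarrow> (cp1 \<Rightarrow> complex ^ 'r) \<Rightarrow> bool" where
  "hol_section E U s \<longleftrightarrow>
     (\<forall>(V, f)\<in>E. \<forall>a. hol_on (\<lambda>p. (matrix_inv (f p) *v s p) $ a) (U \<inter> V))"

definition hol_frame ::
    "'r::finite hbundle \<Rightarrow> cp1 set \<Rightarrow> (cp1 \<Rightarrow> complex ^ 'r ^ 'r) \<Rightarrow> bool" where
  "hol_frame E U g \<longleftrightarrow>
     (\<forall>p\<in>U. invertible (g p)) \<and> (\<forall>a. hol_section E U (\<lambda>p. column a (g p)))"

definition hol_bundle :: "'r::finite hbundle \<Rightarrow> bool" where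
  "hol_bundle E \<longleftrightarrow> (\<forall>(V, f)\<in>E. open V \<and> hol_frame E V f) \<and> (\<Union>(V, f)\<in>E. V) = UNIV"

definition trivial_bundle :: "'r::finite hbundle \<Rightarrow> bool" where
  "trivial_bundle E \<longleftrightarrow> (\<exists>g. hol_frame E UNIV g)"

definition product_bundle :: "'r::finite hbundle" where
  "product_bundle = {(UNIV, \<lambda>_. mat 1)}"

definition det_bundle :: "'r::finite hbundle \<Rightarrow> 1 hbundle" where
  "det_bundle E = (\<lambda>(V, f). (V, \<lambda>p. mat (det (f p)))) ` E"

text \<open>The fibres of the dual bundle are identified with the standard space through dual bases.\<close>

definition dual_bundle :: "'r::finite hbundle \<Rightarrow> 'r hbundle" where
  "dual_bundle E = (\<lambda>(V, f). (V, \<lambda>p. transpose (matrix_inv (f p)))) ` E"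

definition is_line :: "(complex ^ 'r::finite) set \<Rightarrow> bool" where
  "is_line X \<longleftrightarrow> vec.subspace X \<and> vec.dim X = 1"

text \<open>A family of lines \<open>L p\<close> in the fibres; \<open>s\<close> is a nowhere vanishing holomorphic section of it
  over \<open>V\<close>.\<close>

definition generates ::
    "'r::finite hbundle \<Rightarrow> cp1 set \<Rightarrow> (cp1 \<Rightarrow> complex ^ 'r) \<Rightarrow> (cp1 \<Rightarrow> (complex ^ 'r) set) \<Rightarrow> bool" where
  "generates E V s L \<longleftrightarrow> hol_section E V s \<and> (\<forall>p\<in>V. s p \<noteq> 0 \<and> L p = vec.span {s p})"

definition line_subbundle :: "'r::finite hbundle \<Rightarrow> (cp1 \<Rightarrow> (complex ^ 'r) set) \<Rightarrow> bool" where
  "line_subbundle E L \<longleftrightarrow> (\<forall>p. \<exists>V s. open V \<and> p \<in> V \<and> generates E V s L)"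

definition trivial_line_subbundle ::
    "'r::finite hbundle \<Rightarrow> (cp1 \<Rightarrow> (complex ^ 'r) set) \<Rightarrow> bool" where
  "trivial_line_subbundle E L \<longleftrightarrow> (\<exists>s. generates E UNIV s L)"

text \<open>\<open>M\<close> is isomorphic to the inverse of \<open>L\<close>: there is a holomorphic perfect pairing of
  \<open>L\<close> and \<open>M\<close>.\<close>

definition inverse_line_subbundle ::
    "'r::finite hbundle \<Rightarrow> (cp1 \<Rightarrow> (complex ^ 'r) set) \<Rightarrow> (cp1 \<Rightarrow> (complex ^ 'r) set) \<Rightarrow> bool" where
  "inverse_line_subbundle E L M \<longleftrightarrow>
     (\<exists>e. (\<forall>p a b. \<forall>u\<in>L p. \<forall>v\<in>M p. e p (a *s u) (b *s v) = a * b * e p u v) \<and>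
          (\<forall>V s t. open V \<and> generates E V s L \<and> generates E V t M \<longrightarrow>
             hol_on (\<lambda>p. e p (s p) (t p)) V \<and> (\<forall>p\<in>V. e p (s p) (t p) \<noteq> 0)))"

text \<open>Degree of a line subbundle: the sum of the orders of a meromorphic section that does not
  vanish identically. The finite set \<open>F\<close> contains the zeros and poles of the section; the order at
  \<open>p\<close> is that of its ratio to a local generator. Stated as a relation; the degree exists and does
  not depend on the section.\<close>

definition section_order ::
    "'r::finite hbundle \<Rightarrow> (cp1 \<Rightarrow> (complex ^ 'r) set) \<Rightarrow> (cp1 \<Rightarrow> complex ^ 'r) \<Rightarrow> cp1 \<Rightarrow> int \<Rightarrow> bool" where
  "section_order E L s p k \<longleftrightarrow>
     (\<exists>V t m. open V \<and> p \<in> V \<and> generates E V t L \<and> (\<forall>q\<in>V - {p}. s q = m q *s t q) \<and>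
        (\<lambda>z. m (loc p z)) meromorphic_on {0} \<and> zorder (\<lambda>z. m (loc p z)) 0 = k)"

definition line_degree ::
    "'r::finite hbundle \<Rightarrow> (cp1 \<Rightarrow> (complex ^ 'r) set) \<Rightarrow> int \<Rightarrow> bool" where
  "line_degree E L d \<longleftrightarrow>
     (\<exists>F s k. finite F \<and> hol_section E (- F) s \<and> (\<forall>p\<in>- F. s p \<in> L p \<and> s p \<noteq> 0) \<and>
        (\<forall>p\<in>F. section_order E L s p (k p)) \<and> d = (\<Sum>p\<in>F. k p))"

definition bundle_degree :: "'r::finite hbundle \<Rightarrow> int \<Rightarrow> bool" where
  "bundle_degree E d \<longleftrightarrow> line_degree (det_bundle E) (\<lambda>_. UNIV) d"


section \<open>Quasi-parabolic Higgs bundles\<close>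

text \<open>The marked points are \<open>x i\<close> for \<open>i\<close> in a finite index type \<open>'n\<close>, so \<open>n = CARD('n)\<close> and
  \<open>D = range x\<close>. \<open>flag P i\<close> is the line \<open>E_{x_i,2}\<close>. \<open>higgs P p\<close> is the endomorphism coefficient
  of the Higgs field at \<open>p\<close>, stored with the convention for one-forms above; its values on \<open>D\<close>
  are irrelevant.\<close>

record 'n qp_higgs =
  bun :: "2 hbundle"
  flag :: "'n \<Rightarrow> (complex ^ 2) set"
  higgs :: "cp1 \<Rightarrow> complex ^ 2 ^ 2"

definition frame_entry ::
    "(cp1 \<Rightarrow> complex ^ 2 ^ 2) \<Rightarrow> (cp1 \<Rightarrow> complex ^ 2 ^ 2) \<Rightarrow> 2 \<Rightarrow> 2 \<Rightarrow> cp1 \<Rightarrow> complex" where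
  "frame_entry f \<Phi> a b p = (matrix_inv (f p) ** \<Phi> p ** f p) $ a $ b"

text \<open>The residue of the Higgs field at \<open>x i\<close> as an endomorphism of the fibre; it does not depend
  on the holomorphic frame \<open>f\<close> used to compute it.\<close>

definition res :: "('n \<Rightarrow> cp1) \<Rightarrow> 'n qp_higgs \<Rightarrow> 'n \<Rightarrow> complex ^ 2 ^ 2" where
  "res x P i =
     (let f = (SOME f. \<exists>V. (V, f) \<in> bun P \<and> x i \<in> V)
      in f (x i) ** (\<chi> a b. residue (form_coeff (frame_entry f (higgs P) a b) (x i)) 0)
           ** matrix_inv (f (x i)))"

definition quasi_parabolic_higgs :: "('n::finite \<Rightarrow> cp1) \<Rightarrow> 'n qp_higgs \<Rightarrow> bool" where
  "quasi_parabolic_higgs x P \<longleftrightarrow>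
     hol_bundle (bun P) \<and>
     (\<forall>i. is_line (flag P i)) \<and>
     (\<forall>(V, f)\<in>bun P. \<forall>a b. log_form_on (range x) V (frame_entry f (higgs P) a b)) \<and>
     (\<forall>i. (\<forall>v. res x P i *v v \<in> flag P i) \<and> (\<forall>v\<in>flag P i. res x P i *v v = 0))"

definition sl2c_higgs :: "('n::finite \<Rightarrow> cp1) \<Rightarrow> 'n qp_higgs \<Rightarrow> bool" where
  "sl2c_higgs x P \<longleftrightarrow>
     quasi_parabolic_higgs x P \<and> trivial_bundle (det_bundle (bun P)) \<and>
     (\<forall>p. p \<notin> range x \<longrightarrow> trace (higgs P p) = 0)"

definition qp_slope_bundle :: "('n::finite) qp_higgs \<Rightarrow> int \<Rightarrow> real" where
  "qp_slope_bundle P e = real_of_int e / 2 + real CARD('n) / 2"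

definition qp_slope_line ::
    "('n::finite \<Rightarrow> cp1) \<Rightarrow> 'n qp_higgs \<Rightarrow> (cp1 \<Rightarrow> (complex ^ 2) set) \<Rightarrow> int \<Rightarrow> real" where
  "qp_slope_line x P L d =
     real_of_int d + real (card {i. L (x i) \<inter> flag P i \<noteq> {0}}) / 2"

definition preserved :: "('n::finite \<Rightarrow> cp1) \<Rightarrow> 'n qp_higgs \<Rightarrow> (cp1 \<Rightarrow> (complex ^ 2) set) \<Rightarrow> bool" where
  "preserved x P L \<longleftrightarrow> (\<forall>p. p \<notin> range x \<longrightarrow> (\<forall>v\<in>L p. higgs P p *v v \<in> L p))"

definition stable :: "('n::finite \<Rightarrow> cp1) \<Rightarrow> 'n qp_higgs \<Rightarrow> bool" where
  "stable x P \<longleftrightarrow>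
     (\<forall>i. res x P i \<noteq> 0) \<and>
     (\<forall>L d e. line_subbundle (bun P) L \<and> preserved x P L \<and>
        line_degree (bun P) L d \<and> bundle_degree (bun P) e \<longrightarrow>
        qp_slope_bundle P e > qp_slope_line x P L d)"

definition qp_isomorphic :: "('n::finite \<Rightarrow> cp1) \<Rightarrow> 'n qp_higgs \<Rightarrow> 'n qp_higgs \<Rightarrow> bool" where
  "qp_isomorphic x P Q \<longleftrightarrow>
     (\<exists>h. (\<forall>p. invertible (h p)) \<and>
          (\<forall>(V, f)\<in>bun P. hol_frame (bun Q) V (\<lambda>p. h p ** f p)) \<and>
          (\<forall>i. (\<lambda>v. h (x i) *v v) ` flag P i = flag Q i) \<and>
          (\<forall>p. p \<notin> range x \<longrightarrow> h p ** higgs P p = higgs Q p ** h p))"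


section \<open>The moduli space and the involution\<close>

definition H0_objects :: "('n::finite \<Rightarrow> cp1) \<Rightarrow> 'n qp_higgs set" where
  "H0_objects x = {P. sl2c_higgs x P \<and> stable x P \<and> trivial_bundle (bun P)}"

definition H0_iso :: "('n::finite \<Rightarrow> cp1) \<Rightarrow> ('n qp_higgs \<times> 'n qp_higgs) set" where
  "H0_iso x = {(P, Q). P \<in> H0_objects x \<and> Q \<in> H0_objects x \<and> qp_isomorphic x P Q}"

definition H0 :: "('n::finite \<Rightarrow> cp1) \<Rightarrow> 'n qp_higgs set set" where
  "H0 x = H0_objects x // H0_iso x"

definition dual_higgs :: "'n qp_higgs \<Rightarrow> 'n qp_higgs" where
  "dual_higgs P =
     \<lparr> bun = dual_bundle (bun P),
       flag = (\<lambda>i. {g. \<forall>v\<in>flag P i. (\<Sum>a\<in>UNIV. g $ a * v $ a) = 0}),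
       higgs = (\<lambda>p. transpose (higgs P p)) \<rparr>"

definition Theta :: "('n::finite \<Rightarrow> cp1) \<Rightarrow> 'n qp_higgs set \<Rightarrow> 'n qp_higgs set" where
  "Theta x C = H0_iso x `` (dual_higgs ` C)"


section \<open>Manifold structure of the moduli space\<close>

text \<open>A parameter \<open>q = (u, l)\<close> collects \<open>u i = w_i\<close> for \<open>i\<close> in \<open>A\<close>, \<open>u i = z_i\<close> for \<open>i\<close> in
  the complement \<open>B\<close> of \<open>A\<close>, and \<open>l i = \<lambda>_i\<close>.\<close>

definition param_line :: "'n set \<Rightarrow> 'n \<Rightarrow> complex \<Rightarrow> (complex ^ 2) set" where
  "param_line A i u = vec.span {if i \<in> A then vector [1, u] else vector [u, 1]}"

definition param_residue :: "'n set \<Rightarrow> 'n \<Rightarrow> complex \<Rightarrow> complex \<Rightarrow> complex ^ 2 ^ 2" where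
  "param_residue A i u l =
     (if i \<in> A then vector [vector [- l * u, l], vector [- l * u ^ 2, l * u]]
      else vector [vector [- l * u, l * u ^ 2], vector [- l, l * u]])"

definition has_params ::
    "('n::finite \<Rightarrow> cp1) \<Rightarrow> 'n set \<Rightarrow> 'n \<Rightarrow> 'n \<Rightarrow> 'n qp_higgs set \<Rightarrow>
     (complex ^ 'n) \<times> (complex ^ 'n) \<Rightarrow> bool" where
  "has_params x A j k C = (\<lambda>(u, l).
     u $ j = 0 \<and> u $ k = 0 \<and> l $ j = 1 \<and> (\<forall>i. l $ i \<noteq> 0) \<and>
     (\<exists>P\<in>C. bun P = product_bundle \<and>
        (\<forall>i. flag P i = param_line A i (u $ i)) \<and>
        (\<forall>i. res x P i = param_residue A i (u $ i) (l $ i))))"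

text \<open>Charts are indexed by \<open>(A, j, k, i0)\<close>. The residue condition reads
  \<open>l k = - (\<Sum>A. l u^2) - (\<Sum>B - {k}. l)\<close>, \<open>(\<Sum>A. l u) + (\<Sum>B. l u) = 0\<close>,
  \<open>(\<Sum>A. l) + (\<Sum>B. l u^2) = 0\<close>. The last two equations can be solved for \<open>u i0\<close> and
  \<open>l i0\<close> always if \<open>i0\<close> is in \<open>A\<close>, but for \<open>i0\<close> in \<open>B\<close> only where \<open>u i0\<close> does not vanish (elsewhere
  their derivative with respect to \<open>(u i0, l i0)\<close> is singular); this determines the chart domain.
  The coordinates are the entries of \<open>u\<close> and \<open>l\<close> at the indices other than \<open>j\<close>, \<open>k\<close>, \<open>i0\<close>; the
  remaining entries are set to 0.\<close>

definition chart_index :: "('n set \<times> 'n \<times> 'n \<times> 'n) set" where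
  "chart_index = {(A, j, k, i0). j \<in> A \<and> k \<notin> A \<and> i0 \<noteq> j \<and> i0 \<noteq> k}"

fun chart_dom ::
    "('n::finite \<Rightarrow> cp1) \<Rightarrow> 'n set \<times> 'n \<times> 'n \<times> 'n \<Rightarrow> 'n qp_higgs set set" where
  "chart_dom x (A, j, k, i0) =
     {C \<in> H0 x. \<exists>u l. has_params x A j k C (u, l) \<and> (i0 \<in> A \<or> u $ i0 \<noteq> 0)}"

fun coord_space :: "'n set \<times> 'n \<times> 'n \<times> 'n \<Rightarrow> ((complex ^ 'n::finite) \<times> (complex ^ 'n)) set" where
  "coord_space (A, j, k, i0) = {(u, l). \<forall>i\<in>{j, k, i0}. u $ i = 0 \<and> l $ i = 0}"

fun chart_map ::
    "('n::finite \<Rightarrow> cp1) \<Rightarrow> 'n set \<times> 'n \<times> 'n \<times> 'n \<Rightarrow> 'n qp_higgs set \<Rightarrow>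
     (complex ^ 'n) \<times> (complex ^ 'n)" where
  "chart_map x (A, j, k, i0) C =
     (let (u, l) = (THE q. has_params x A j k C q)
      in (\<chi> i. if i \<in> {j, k, i0} then 0 else u $ i, \<chi> i. if i \<in> {j, k, i0} then 0 else l $ i))"

definition H0_topology :: "('n::finite \<Rightarrow> cp1) \<Rightarrow> 'n qp_higgs set topology" where
  "H0_topology x = topology (\<lambda>U. U \<subseteq> H0 x \<and>
     (\<forall>c\<in>chart_index. openin (top_of_set (coord_space c)) (chart_map x c ` (U \<inter> chart_dom x c))))"

primrec Ck_on :: "nat \<Rightarrow> ('a::euclidean_space \<Rightarrow> 'b::euclidean_space) \<Rightarrow> 'a set \<Rightarrow> bool" where
  "Ck_on 0 f U = continuous_on U f"
| "Ck_on (Suc k) f U =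
     (\<exists>f'. (\<forall>y\<in>U. (f has_derivative f' y) (at y)) \<and> (\<forall>v. Ck_on k (\<lambda>y. f' y v) U))"

text \<open>Embedded smooth submanifolds of real dimension \<open>d\<close> of a Euclidean space, by local
  straightening diffeomorphisms.\<close>

definition euclidean_submanifold :: "nat \<Rightarrow> 'a::euclidean_space set \<Rightarrow> bool" where
  "euclidean_submanifold d M \<longleftrightarrow>
     (\<forall>y\<in>M. \<exists>U V (h :: 'a \<Rightarrow> 'a) g W. open U \<and> y \<in> U \<and> open V \<and> homeomorphism U V h g \<and>
        (\<forall>k. Ck_on k h U \<and> Ck_on k g V) \<and>
        subspace W \<and> dim W = d \<and> h ` (U \<inter> M) = V \<inter> W)"

text \<open>A subset of the moduli space is a manifold of real dimension \<open>d\<close> if it is an embedded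
  smooth submanifold, i.e. is one in every chart, and is Hausdorff and second countable. (A subset of
  the linear subspace \<open>coord_space c\<close> is a submanifold of it iff it is one of the ambient
  space.)\<close>

definition is_submanifold ::
    "('n::finite \<Rightarrow> cp1) \<Rightarrow> nat \<Rightarrow> 'n qp_higgs set set \<Rightarrow> bool" where
  "is_submanifold x d Z \<longleftrightarrow>
     Z \<subseteq> H0 x \<and>
     Hausdorff_space (subtopology (H0_topology x) Z) \<and>
     second_countable (subtopology (H0_topology x) Z) \<and>
     (\<forall>c\<in>chart_index. euclidean_submanifold d (chart_map x c ` (Z \<inter> chart_dom x c)))"


section \<open>\<open>SL(2,\<real>)\<close>-Higgs bundles\<close>

text \<open>\<open>E = L \<oplus> M\<close>, the flag at \<open>x i\<close> is the fibre of \<open>L\<close> for \<open>i\<close> in \<open>S\<close> and of \<open>M\<close> otherwise,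
  and the Higgs field is off-diagonal, with \<open>\<beta> : L \<rightarrow> M\<close> vanishing over \<open>x i\<close> for \<open>i\<close> in \<open>S\<close>
  and \<open>\<alpha> : M \<rightarrow> L\<close> vanishing over the others.\<close>

definition off_diagonal_splitting ::
    "('n::finite \<Rightarrow> cp1) \<Rightarrow> 'n set \<Rightarrow> (cp1 \<Rightarrow> (complex ^ 2) set) \<Rightarrow> (cp1 \<Rightarrow> (complex ^ 2) set) \<Rightarrow>
     'n qp_higgs \<Rightarrow> bool" where
  "off_diagonal_splitting x S L M P \<longleftrightarrow>
     line_subbundle (bun P) L \<and> line_subbundle (bun P) M \<and>
     (\<forall>p. L p \<inter> M p = {0} \<and> (\<forall>v. \<exists>u\<in>L p. \<exists>w\<in>M p. v = u + w)) \<and>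
     (\<forall>i. flag P i = (if i \<in> S then L (x i) else M (x i))) \<and>
     (\<forall>p. p \<notin> range x \<longrightarrow>
        (\<forall>v\<in>L p. higgs P p *v v \<in> M p) \<and> (\<forall>v\<in>M p. higgs P p *v v \<in> L p)) \<and>
     (\<forall>i\<in>S. \<forall>v\<in>L (x i). res x P i *v v = 0) \<and>
     (\<forall>i\<in>- S. \<forall>v\<in>M (x i). res x P i *v v = 0)"

definition sl2r_higgs :: "('n::finite \<Rightarrow> cp1) \<Rightarrow> 'n qp_higgs \<Rightarrow> bool" where
  "sl2r_higgs x P \<longleftrightarrow>
     quasi_parabolic_higgs x P \<and>
     (\<exists>S L M. inverse_line_subbundle (bun P) L M \<and> off_diagonal_splitting x S L M P)"

definition Z :: "('n::finite \<Rightarrow> cp1) \<Rightarrow> 'n set \<Rightarrow> 'n qp_higgs set set" where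
  "Z x S = {C \<in> H0 x. \<exists>P\<in>C. sl2r_higgs x P \<and>
     (\<exists>L0 L1. trivial_line_subbundle (bun P) L0 \<and> trivial_line_subbundle (bun P) L1 \<and>
        off_diagonal_splitting x S L0 L1 P)}"

text \<open>\<open>i1\<close> is the index written 1.\<close>

definition admissible :: "'n::finite \<Rightarrow> 'n set set" where
  "admissible i1 = {S. i1 \<in> S \<and> 2 \<le> card S \<and> card S \<le> CARD('n) - 2}"

definition H0_real :: "('n::finite \<Rightarrow> cp1) \<Rightarrow> 'n \<Rightarrow> 'n qp_higgs set set" where
  "H0_real x i1 = (\<Union>S\<in>admissible i1. Z x S)"

end

theory Submission
  imports Defs
begin

text \<open>The bundle of a point of the moduli space is trivial, so in a global frame its Higgs field is a
  matrix of one-forms on the sphere with simple poles at the marked points. By Liouville's theorem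
  these forms are partial fractions, determined by residues \<open>N i\<close> whose sum is zero
  (\<open>log_form_partial_fractions\<close>). The \<open>N i\<close> are nonzero nilpotent \<open>2 \<times> 2\<close> matrices, and the flag
  at \<open>x i\<close> is the image of \<open>N i\<close>. A line subbundle of a trivial bundle has degree at most 0, with
  equality only for constant lines, so stability means that no residue vanishes and that the flags
  are not all equal (\<open>H0_object_in_frame\<close>, \<open>H0_objectI\<close>). An isomorphism of bundles is a constant
  change of basis, again by Liouville. The moduli space is therefore the set of such systems of
  residues up to simultaneous conjugation (\<open>H0_iso_iff_conjugate\<close>), and \<open>Theta\<close> is transposition
  (\<open>Theta_residue_class\<close>).

  A fixed point comes with an invertible \<open>c\<close> such that \<open>c N_i = N_i^T c\<close> for all \<open>i\<close>. For a rotation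
  \<open>K\<close> by a right angle and trace-free \<open>N\<close> one has \<open>K N^T = - N K\<close>, so \<open>d = K c\<close> anticommutes with all
  residues. Then \<open>d\<close> preserves every flag line. Two distinct flags diagonalize \<open>d\<close>, and
  anticommutation makes its two eigenvalues opposite. So each flag is one of two eigenlines,
  which split the bundle, and each residue is strictly triangular in the eigenbasis
  (\<open>self_transpose_imp_split\<close>). The residues over \<open>S\<close> and those over its complement sum to zero
  separately, which is impossible for a single nonzero number; hence \<open>2 \<le> |S| \<le> n - 2\<close>. Exchanging
  the two lines replaces \<open>S\<close> by its complement, so \<open>1 \<in> S\<close> can be assumed.

  The topology of the moduli space is the finest one for which the inverse charts are continuous,
  so a function on it is continuous once it is so in every chart. This applies to the conjugation
  invariants \<open>tr (N_i N_j)\<close> (\<open>continuous_map_class_traces\<close>). On \<open>Z x S\<close> they determine the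
  parameters of the Higgs field, and \<open>Z x S\<close> turns out to be homeomorphic to the set of
  \<open>\<lambda> \<in> \<complex>^n\<close> with nonzero entries, \<open>\<lambda>_1 = 1\<close>, and sum zero over \<open>S\<close> and over its complement
  (\<open>Z_homeomorphic\<close>). This set is unbounded, and it is connected because a complex line meets the
  excluded hyperplanes in finitely many points. In a chart, \<open>Z x S\<close> is either empty or an open part
  of the linear subspace \<open>u = 0\<close> (\<open>chart_image_Z\<close>, \<open>forget_normalized_split\<close>). The vanishing
  pattern of the traces shows that the sets \<open>Z x S\<close> are open in their union, so they are its
  connected components (\<open>components_H0_real\<close>), and it remains to count the sets \<open>S\<close>
  (\<open>card_admissible\<close>).\<close>

text \<open>The symbol \<open>$\<close> denotes the entries of vectors only; its second meaning, the coefficients of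
  power series, would make every formula with several entries ambiguous.\<close>

no_notation fps_nth (infixl "$" 75)

section \<open>Functions and forms near a point of the sphere\<close>

text \<open>Holomorphy on a set is pointwise. The neighbourhood on which two functions are compared changes
  from point to point below, so holomorphy at one point is the convenient notion.\<close>

definition hol_at :: "(cp1 \<Rightarrow> complex) \<Rightarrow> cp1 \<Rightarrow> bool" where
  "hol_at f p \<longleftrightarrow> (\<lambda>t. f (loc p t)) field_differentiable at 0"

lemma hol_on_iff: "hol_on f U \<longleftrightarrow> (\<forall>p\<in>U. hol_at f p)"
  by (simp add: hol_on_def hol_at_def)

lemma eventually_at_nonzeroI: "(\<And>t. t \<noteq> 0 \<Longrightarrow> P t) \<Longrightarrow> \<forall>\<^sub>F t in at (0::complex). P t"
  by (simp add: eventually_at_filter)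

lemma loc_0 [simp]: "loc p 0 = p"
  by (cases p) auto

lemma loc_inj: "loc p s = loc p t \<Longrightarrow> s = t"
  by (cases p) (auto split: if_splits)

lemma eventually_loc: "open V \<Longrightarrow> p \<in> V \<Longrightarrow> \<forall>\<^sub>F t in nhds 0. loc p t \<in> V"
  by (simp add: open_cp1_def)

lemma eventually_loc_at: "open V \<Longrightarrow> p \<in> V \<Longrightarrow> \<forall>\<^sub>F t in at 0. loc p t \<in> V"
  using eventually_loc eventually_nhds_conv_at by blast

lemma eventually_loc_notin:
  assumes "finite F"
  shows "\<forall>\<^sub>F t in at 0. loc p t \<notin> F"
proof -
  have "finite (loc p -` F)"
    using assms by (intro finite_vimageI) (auto simp: inj_on_def dest: loc_inj)
  then have "open (- (loc p -` F - {0}))"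
    by (intro open_Compl finite_imp_closed) auto
  then have "\<forall>\<^sub>F t in at 0. t \<in> - (loc p -` F - {0}) - {0}"
    by (rule eventually_at_in_open) auto
  then show ?thesis
    by eventually_elim auto
qed

lemma field_differentiable_cong_nhds:
  assumes "\<forall>\<^sub>F t in nhds a. f t = g t"
  shows "f field_differentiable at a \<longleftrightarrow> g field_differentiable at a"
  unfolding field_differentiable_def using DERIV_cong_ev[OF refl assms refl] by blast

lemma hol_at_cong:
  assumes "open W" "p \<in> W" "\<And>q. q \<in> W \<Longrightarrow> f q = g q"
  shows "hol_at f p \<longleftrightarrow> hol_at g p"
  unfolding hol_at_def
  by (rule field_differentiable_cong_nhds, rule eventually_mono[OF eventually_loc[OF assms(1,2)]])
    (rule assms(3))

lemma hol_at_const [simp]: "hol_at (\<lambda>_. c) p"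
  by (simp add: hol_at_def)

lemma hol_at_add: "hol_at f p \<Longrightarrow> hol_at g p \<Longrightarrow> hol_at (\<lambda>q. f q + g q) p"
  by (simp add: hol_at_def field_differentiable_add)

lemma hol_at_mult: "hol_at f p \<Longrightarrow> hol_at g p \<Longrightarrow> hol_at (\<lambda>q. f q * g q) p"
  by (simp add: hol_at_def field_differentiable_mult)

lemma hol_at_divide: "hol_at f p \<Longrightarrow> hol_at g p \<Longrightarrow> g p \<noteq> 0 \<Longrightarrow> hol_at (\<lambda>q. f q / g q) p"
  by (simp add: hol_at_def field_differentiable_divide)

lemma hol_at_sum: "(\<And>i. i \<in> I \<Longrightarrow> hol_at (f i) p) \<Longrightarrow> hol_at (\<lambda>q. \<Sum>i\<in>I. f i q) p"
  by (induction I rule: infinite_finite_induct) (auto intro: hol_at_add)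

lemma hol_at_prod: "(\<And>i. i \<in> I \<Longrightarrow> hol_at (f i) p) \<Longrightarrow> hol_at (\<lambda>q. \<Prod>i\<in>I. f i q) p"
  by (induction I rule: infinite_finite_induct) (auto intro: hol_at_mult)

lemma hol_at_tendsto:
  assumes "hol_at f p"
  shows "((\<lambda>t. f (loc p t)) \<longlongrightarrow> f p) (at 0)"
  using field_differentiable_imp_continuous_at[OF assms[unfolded hol_at_def]]
  by (simp add: continuous_at)

lemma field_differentiable_shift:
  "(\<lambda>t. f (a + t)) field_differentiable at b \<longleftrightarrow> f field_differentiable at (a + b :: complex)"
  unfolding field_differentiable_def using DERIV_shift[of f _ b a] by (simp add: add.commute)

lemma hol_at_Aff: "hol_at f (Aff z) \<longleftrightarrow> (\<lambda>z. f (Aff z)) field_differentiable at z"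
  unfolding hol_at_def using field_differentiable_shift[of "\<lambda>z. f (Aff z)" z 0] by simp

lemma field_differentiable_inverse_chart:
  assumes "f field_differentiable at (1 / t)" "t \<noteq> (0::complex)"
  shows "(\<lambda>t. f (1 / t)) field_differentiable at t"
proof -
  have "(\<lambda>t. 1 / t) field_differentiable at t"
    using assms(2) by (intro field_differentiable_divide) auto
  from field_differentiable_compose[OF this assms(1)] show ?thesis
    by (simp add: o_def)
qed

text \<open>Moving the centre of a finite coordinate is a translation; for the coordinate at infinity it
  is the substitution \<open>z = 1/t\<close>, which is biholomorphic away from \<open>t = 0\<close>.\<close>

lemma form_coeff_nearby:
  assumes "form_coeff a (loc p t) field_differentiable at 0"
  shows "form_coeff a p field_differentiable at t"
proof (cases p)
  case (Aff z)
  have eq: "form_coeff a (Aff w) = (\<lambda>t. a (Aff (w + t)))" for w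
    by auto
  from assms show ?thesis
    using field_differentiable_shift[of "\<lambda>z. a (Aff z)" z t]
      field_differentiable_shift[of "\<lambda>w. a (Aff w)" "z + t" 0] by (simp add: Aff eq)
next
  case Infty
  show ?thesis
  proof (cases "t = 0")
    case True
    with assms show ?thesis by simp
  next
    case False
    have eq: "form_coeff a (Aff w) = (\<lambda>t. a (Aff (w + t)))" for w
      by auto
    from assms Infty False have "(\<lambda>z. a (Aff z)) field_differentiable at (1 / t)"
      using field_differentiable_shift[of "\<lambda>z. a (Aff z)" "1 / t" 0] by (simp add: eq)
    from field_differentiable_inverse_chart[OF this False]
    have "(\<lambda>t. - a (Aff (1 / t)) / t ^ 2) field_differentiable at t"
      using False by (intro field_differentiable_divide field_differentiable_minus
        field_differentiable_power field_differentiable_ident) auto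
    moreover have "\<forall>\<^sub>F s in nhds t. s \<noteq> 0"
      using False by (rule t1_space_nhds)
    then have "\<forall>\<^sub>F s in nhds t. - a (Aff (1 / s)) / s ^ 2 = form_coeff a p s"
      by eventually_elim (simp add: Infty)
    ultimately show ?thesis
      by (rule field_differentiable_cong_nhds[THEN iffD1, rotated])
  qed
qed

lemma form_coeff_sum: "form_coeff (\<lambda>p. \<Sum>i\<in>I. a i p) p t = (\<Sum>i\<in>I. form_coeff (a i) p t)"
  by (cases p) (auto simp: sum_negf sum_divide_distrib)

lemma log_form_on_eventually:
  assumes "log_form_on D V a" "open V" "finite D" "p \<in> V"
  shows "\<forall>\<^sub>F t in at 0. form_coeff a p field_differentiable at t"
  using eventually_loc_at[OF assms(2,4)] eventually_loc_notin[OF assms(3), of p]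
proof eventually_elim
  case (elim t)
  with assms(1) have "form_coeff a (loc p t) field_differentiable at 0"
    by (simp add: log_form_on_def)
  then show ?case by (rule form_coeff_nearby)
qed

lemma residue_form_coeff:
  assumes "log_form_on D V a" "open V" "finite D" "p \<in> V"
    and lim: "((\<lambda>t. t * form_coeff a p t) \<longlongrightarrow> c) (at 0)"
  shows "residue (form_coeff a p) 0 = c"
proof -
  obtain S where S: "open S" "0 \<in> S" "\<And>t. t \<in> S - {0} \<Longrightarrow> form_coeff a p field_differentiable at t"
    using log_form_on_eventually[OF assms(1-4)] unfolding eventually_at_topological by blast
  show ?thesis
  proof (rule residue_simple'[OF S(1,2)])
    show "form_coeff a p holomorphic_on S - {0}"
      using S(3) by (auto simp: holomorphic_on_def intro: field_differentiable_at_within)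
  qed (use lim in \<open>simp add: mult.commute\<close>)
qed

section \<open>Liouville's theorem with prescribed zeros and poles\<close>

text \<open>The punctures are removable, so \<open>f\<close> extends to an entire function with a limit at infinity. The
  behaviour at infinity is expressed in the coordinate \<open>t = 1/z\<close>.\<close>

lemma liouville_punctured:
  assumes "finite F" "f holomorphic_on - F"
    and "\<And>p. p \<in> F \<Longrightarrow> ((\<lambda>z. (z - p) * f z) \<longlongrightarrow> 0) (at p)"
    and inf: "((\<lambda>t. f (1 / t)) \<longlongrightarrow> l) (at 0)"
    and "z \<notin> F"
  shows "f z = l"
proof -
  have "\<exists>g. g holomorphic_on UNIV \<and> (\<forall>z\<in>-F. g z = f z)"
    using assms(1-3)
  proof (induction arbitrary: f rule: finite_induct)
    case empty
    then show ?case by auto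
  next
    case (insert z0 X)
    have "z0 \<in> interior (- X)"
      using insert.hyps by (simp add: finite_imp_closed open_Compl interior_open)
    moreover have "f holomorphic_on - X - {z0}"
      using insert.prems(1) by (rule holomorphic_on_subset) auto
    ultimately obtain g where g: "g holomorphic_on - X" "\<And>z. z \<in> - X - {z0} \<Longrightarrow> g z = f z"
      using holomorphic_on_extend_lim[of f "- X" z0] insert.prems(2) by auto
    have "((\<lambda>z. (z - p) * g z) \<longlongrightarrow> 0) (at p)" if "p \<in> X" for p
    proof -
      have "open (- (insert z0 X - {p}))"
        by (intro open_Compl finite_imp_closed) (use insert.hyps in auto)
      then have "\<forall>\<^sub>F z in at p. z \<in> - (insert z0 X - {p}) - {p}"
        by (rule eventually_at_in_open) auto
      then have "\<forall>\<^sub>F z in at p. (z - p) * f z = (z - p) * g z"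
        by eventually_elim (use g(2) in auto)
      then show ?thesis
        using insert.prems(2)[of p] that by (auto intro: Lim_transform_eventually)
    qed
    with insert.IH[OF g(1)] obtain h where "h holomorphic_on UNIV" "\<forall>z\<in>-X. h z = g z"
      by blast
    with g(2) show ?case
      by (intro exI[of _ h]) auto
  qed
  then obtain g where g: "g holomorphic_on UNIV" "\<And>z. z \<notin> F \<Longrightarrow> g z = f z"
    by auto
  have "((\<lambda>t. g (1 / t)) \<longlongrightarrow> l) (at 0)"
  proof (rule Lim_transform_eventually[OF inf])
    show "\<forall>\<^sub>F t in at 0. f (1 / t) = g (1 / t)"
      using eventually_loc_notin[OF finite_imageI[OF assms(1)], of Infty Aff] eventually_neq_at_within[of 0 0 UNIV]
      by eventually_elim (use g(2) in \<open>auto simp: image_iff\<close>)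
  qed
  then have "(g \<longlongrightarrow> l) at_infinity"
    by (simp add: lim_at_infinity_0 o_def divide_inverse)
  from Liouville_weak[OF g(1) this] g(2)[OF assms(5)] show ?thesis
    by simp
qed

lemma hol_on_UNIV_const:
  assumes "hol_on f UNIV"
  shows "f p = f Infty"
proof -
  have "f (Aff z) = f Infty" for z
  proof (rule liouville_punctured[of "{}" "\<lambda>z. f (Aff z)"])
    have "(\<lambda>z. f (Aff z)) field_differentiable at w" for w
      using assms by (simp add: hol_on_iff flip: hol_at_Aff)
    then show "(\<lambda>z. f (Aff z)) holomorphic_on - {}"
      by (simp add: holomorphic_on_def)
    have "((\<lambda>t. f (loc Infty t)) \<longlongrightarrow> f Infty) (at 0)"
      using assms by (intro hol_at_tendsto) (simp add: hol_on_iff)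
    then show "((\<lambda>t. f (Aff (1 / t))) \<longlongrightarrow> f Infty) (at 0)"
      by (rule Lim_transform_eventually) (rule eventually_at_nonzeroI, simp)
  qed auto
  then show ?thesis by (cases p) auto
qed

lemma finite_Aff: "finite F \<Longrightarrow> finite {w. Aff w \<in> F}"
  using finite_vimageI[of F Aff] by (simp add: vimage_def inj_on_def)

text \<open>A form of the fact that the orders of a meromorphic function on the sphere sum to zero. If \<open>m\<close>
  has order at least \<open>k p\<close> at each \<open>p\<close> in \<open>F\<close>, then dividing it by the rational function with orders
  \<open>k p\<close> at the finite points removes all finite singularities and leaves a function whose order at
  infinity is at least the sum of all \<open>k p\<close>. If this sum is not negative, the quotient is constant, and
  it is zero if the sum is positive.\<close>

lemma meromorphic_order_sum_nonneg:
  fixes m :: "cp1 \<Rightarrow> complex" and k :: "cp1 \<Rightarrow> int"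
  assumes F: "finite F" and m: "hol_on m (- F)"
    and lim: "\<And>p. p \<in> F \<Longrightarrow> \<exists>c. ((\<lambda>t. m (loc p t) * t powi (- k p)) \<longlongrightarrow> c) (at 0)"
    and K: "0 \<le> (\<Sum>p\<in>F. k p)"
  obtains c where "\<And>z. Aff z \<notin> F \<Longrightarrow> m (Aff z) = c * (\<Prod>w | Aff w \<in> F. (z - w) powi k (Aff w))"
    and "0 < (\<Sum>p\<in>F. k p) \<Longrightarrow> c = 0"
proof -
  define G where "G = {w. Aff w \<in> F}"
  define R where "R = (\<lambda>z. \<Prod>w\<in>G. (z - w) powi k (Aff w))"
  define ki where "ki = (if Infty \<in> F then k Infty else 0)"
  have G: "finite G" unfolding G_def using F by (rule finite_Aff)
  have R0: "R z \<noteq> 0" if "z \<notin> G" for z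
    using that G by (auto simp: R_def)
  have sumF: "(\<Sum>p\<in>F. k p) = ki + (\<Sum>w\<in>G. k (Aff w))"
  proof -
    have "F = (Aff ` G) \<union> (F \<inter> {Infty})"
      unfolding G_def by (auto intro: cp1.exhaust)
    then have "sum k F = sum k (Aff ` G \<union> (F \<inter> {Infty}))" by simp
    also have "\<dots> = sum k (Aff ` G) + sum k (F \<inter> {Infty})"
      using G F by (intro sum.union_disjoint) auto
    also have "sum k (Aff ` G) = (\<Sum>w\<in>G. k (Aff w))"
      by (subst sum.reindex) (auto simp: inj_on_def)
    finally show ?thesis by (auto simp: ki_def)
  qed
  define f where "f = (\<lambda>z. m (Aff z) / R z)"
  have "f holomorphic_on - G"
    unfolding f_def R_def
  proof (intro holomorphic_on_divide holomorphic_on_prod holomorphic_on_power_int holomorphic_intros)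
    have "(\<lambda>z. m (Aff z)) field_differentiable at w" if "w \<notin> G" for w
      using m that by (simp add: hol_on_iff G_def flip: hol_at_Aff)
    then show "(\<lambda>z. m (Aff z)) holomorphic_on - G"
      by (simp add: holomorphic_on_def field_differentiable_at_within)
  qed (use R0 in \<open>auto simp: R_def\<close>)
  moreover have "((\<lambda>z. (z - w) * f z) \<longlongrightarrow> 0) (at w)" if w: "w \<in> G" for w
  proof -
    obtain c where c: "((\<lambda>t. m (loc (Aff w) t) * t powi (- k (Aff w))) \<longlongrightarrow> c) (at 0)"
      using lim[of "Aff w"] w by (auto simp: G_def)
    define R' where "R' = (\<lambda>z. \<Prod>v\<in>G-{w}. (z - v) powi k (Aff v))"
    have R': "((\<lambda>t. R' (w + t)) \<longlongrightarrow> R' (w + 0)) (at 0)"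
      unfolding R'_def by (intro tendsto_prod tendsto_power_int tendsto_intros) auto
    have R'0: "R' (w + 0) \<noteq> 0"
      using G by (auto simp: R'_def)
    have "((\<lambda>t. t * ((m (loc (Aff w) t) * t powi (- k (Aff w))) / R' (w + t))) \<longlongrightarrow> 0 * (c / R' (w + 0))) (at 0)"
      by (intro tendsto_intros c R' R'0)
    then have "((\<lambda>t. t * ((m (loc (Aff w) t) * t powi (- k (Aff w))) / R' (w + t))) \<longlongrightarrow> 0) (at 0)"
      by simp
    then have "((\<lambda>t. (w + t - w) * f (w + t)) \<longlongrightarrow> 0) (at 0)"
    proof (rule Lim_transform_eventually)
      show "\<forall>\<^sub>F t in at 0. t * ((m (loc (Aff w) t) * t powi (- k (Aff w))) / R' (w + t))
              = (w + t - w) * f (w + t)"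
      proof (rule eventually_at_nonzeroI)
        fix t :: complex assume "t \<noteq> 0"
        have "R (w + t) = t powi k (Aff w) * R' (w + t)"
          unfolding R_def R'_def using G w by (subst prod.remove[of G w]) auto
        then show "t * ((m (loc (Aff w) t) * t powi (- k (Aff w))) / R' (w + t)) = (w + t - w) * f (w + t)"
          by (simp add: f_def power_int_minus field_simps)
      qed
    qed
    then show ?thesis
      using LIM_offset_zero_iff[of w "\<lambda>z. (z - w) * f z"] by simp
  qed
  moreover obtain c where c: "((\<lambda>t. m (Aff (1 / t)) * t powi (- ki)) \<longlongrightarrow> c) (at 0)"
  proof -
    have "\<exists>c. ((\<lambda>t. m (loc Infty t) * t powi (- ki)) \<longlongrightarrow> c) (at 0)"
      using lim[of Infty] hol_at_tendsto[of m Infty] m by (auto simp: ki_def hol_on_iff)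
    then obtain c where "((\<lambda>t. m (loc Infty t) * t powi (- ki)) \<longlongrightarrow> c) (at 0)" ..
    then have "((\<lambda>t. m (Aff (1 / t)) * t powi (- ki)) \<longlongrightarrow> c) (at 0)"
      by (rule Lim_transform_eventually) (rule eventually_at_nonzeroI, simp)
    then show thesis by (rule that)
  qed
  define K where "K = (\<Sum>p\<in>F. k p)"
  have Kt: "((\<lambda>t::complex. t powi K) \<longlongrightarrow> (if K = 0 then 1 else 0)) (at 0)"
  proof (cases "K = 0")
    case False
    have "((\<lambda>t::complex. t ^ nat K) \<longlongrightarrow> 0 ^ nat K) (at 0)"
      by (intro tendsto_intros)
    with False K show ?thesis
      by (simp add: K_def[symmetric] power_int_def zero_power)
  qed auto
  define l where "l = c * (if K = 0 then 1 else 0)"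
  have "((\<lambda>t. f (1 / t)) \<longlongrightarrow> l) (at 0)"
  proof -
    have "((\<lambda>t. (m (Aff (1 / t)) * t powi (- ki)) * t powi K / (\<Prod>w\<in>G. (1 - w * t) powi k (Aff w)))
        \<longlongrightarrow> c * (if K = 0 then 1 else 0) / (\<Prod>w\<in>G. (1 - w * 0) powi k (Aff w))) (at 0)"
      by (intro tendsto_intros c Kt tendsto_prod tendsto_power_int) auto
    then have "((\<lambda>t. (m (Aff (1 / t)) * t powi (- ki)) * t powi K / (\<Prod>w\<in>G. (1 - w * t) powi k (Aff w)))
        \<longlongrightarrow> l) (at 0)"
      by (simp add: l_def)
    then show ?thesis
    proof (rule Lim_transform_eventually)
      show "\<forall>\<^sub>F t in at 0. (m (Aff (1 / t)) * t powi (- ki)) * t powi K / (\<Prod>w\<in>G. (1 - w * t) powi k (Aff w)) = f (1 / t)"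
      proof (rule eventually_at_nonzeroI)
        fix t :: complex assume t: "t \<noteq> 0"
        have "(\<Prod>w\<in>G. (1 - w * t) powi k (Aff w)) = (\<Prod>w\<in>G. (1 / t - w) powi k (Aff w) * t powi k (Aff w))"
        proof (intro prod.cong refl)
          fix w
          have "1 - w * t = (1 / t - w) * t" using t by (simp add: field_simps)
          then show "(1 - w * t) powi k (Aff w) = (1 / t - w) powi k (Aff w) * t powi k (Aff w)"
            by (simp only: power_int_mult_distrib)
        qed
        also have "\<dots> = R (1 / t) * t powi (\<Sum>w\<in>G. k (Aff w))"
        proof -
          have "(\<Prod>w\<in>X. t powi k (Aff w)) = t powi (\<Sum>w\<in>X. k (Aff w))" if "finite X" for X
            using that t by induction (auto simp: power_int_add)
          from this[OF G] show ?thesis by (simp add: R_def prod.distrib)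
        qed
        finally show "(m (Aff (1 / t)) * t powi (- ki)) * t powi K / (\<Prod>w\<in>G. (1 - w * t) powi k (Aff w)) = f (1 / t)"
          using t unfolding K_def sumF f_def by (simp add: power_int_add power_int_minus field_simps)
      qed
    qed
  qed
  ultimately have "f z = l" if "z \<notin> G" for z
    using liouville_punctured[OF G] that by blast
  then have "m (Aff z) = l * R z" if "Aff z \<notin> F" for z
    using that R0[of z] by (fastforce simp: f_def G_def)
  then show thesis
    by (intro that[of l]) (simp_all add: R_def G_def l_def K_def)
qed


section \<open>Logarithmic forms on the sphere\<close>

text \<open>The form with residue \<open>c i\<close> at each finite \<open>x i\<close>, given by its partial fractions. A marked
  point at infinity does not contribute to the coefficient of \<open>dz\<close>: the residue there is minus the sum
  of the others. The value at infinity is the coefficient of \<open>d(1/z)\<close> when there is no pole there.\<close>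

fun log_form :: "('n::finite \<Rightarrow> cp1) \<Rightarrow> ('n \<Rightarrow> complex) \<Rightarrow> cp1 \<Rightarrow> complex" where
  "log_form x c (Aff z) = (\<Sum>i\<in>UNIV. case x i of Aff w \<Rightarrow> c i / (z - w) | Infty \<Rightarrow> 0)"
| "log_form x c Infty = - (\<Sum>i\<in>UNIV. case x i of Aff w \<Rightarrow> c i * w | Infty \<Rightarrow> 0)"

lemma tendsto_pole_term:
  fixes c :: complex
  shows "((\<lambda>t. t * (c / (w + t - v))) \<longlongrightarrow> (if v = w then c else 0)) (at 0)"
proof (cases "v = w")
  case True
  have "((\<lambda>_. c) \<longlongrightarrow> c) (at (0::complex))" by simp
  then have "((\<lambda>t. t * (c / (w + t - v))) \<longlongrightarrow> c) (at 0)"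
    by (rule Lim_transform_eventually) (rule eventually_at_nonzeroI, simp add: True)
  with True show ?thesis by simp
next
  case False
  have "((\<lambda>t. t * (c / (w + t - v))) \<longlongrightarrow> 0 * (c / (w + 0 - v))) (at 0)"
    using False by (intro tendsto_intros) auto
  with False show ?thesis by simp
qed

lemma log_form_residue_Aff:
  assumes "inj x" "x i = Aff w"
  shows "((\<lambda>t. t * form_coeff (log_form x c) (Aff w) t) \<longlongrightarrow> c i) (at 0)"
proof -
  have "((\<lambda>t. \<Sum>j\<in>UNIV. t * (case x j of Aff v \<Rightarrow> c j / (w + t - v) | Infty \<Rightarrow> 0))
      \<longlongrightarrow> (\<Sum>j\<in>UNIV. if j = i then c j else 0)) (at 0)"
  proof (rule tendsto_sum)
    fix j
    show "((\<lambda>t. t * (case x j of Aff v \<Rightarrow> c j / (w + t - v) | Infty \<Rightarrow> 0))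
        \<longlongrightarrow> (if j = i then c j else 0)) (at 0)"
    proof (cases "x j")
      case (Aff v)
      have "j = i \<longleftrightarrow> v = w"
        using inj_eq[OF assms(1), of j i] assms(2) Aff by auto
      with tendsto_pole_term[of "c j" w v] Aff show ?thesis by simp
    next
      case Infty
      with assms show ?thesis by auto
    qed
  qed
  then show ?thesis
    by (simp add: sum_distrib_left)
qed

lemma log_form_regular_Aff:
  assumes "Aff w \<notin> range x"
  shows "form_coeff (log_form x c) (Aff w) field_differentiable at 0"
proof -
  have "(\<lambda>t. \<Sum>j\<in>UNIV. case x j of Aff v \<Rightarrow> c j / (w + t - v) | Infty \<Rightarrow> 0) field_differentiable at 0"
  proof (rule field_differentiable_sum)
    fix j
    show "(\<lambda>t. case x j of Aff v \<Rightarrow> c j / (w + t - v) | Infty \<Rightarrow> 0) field_differentiable at 0"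
    proof (cases "x j")
      case (Aff v)
      with assms have "w - v \<noteq> 0" by (metis rangeI right_minus_eq)
      with Aff show ?thesis
        by (auto intro!: derivative_intros)
    qed auto
  qed
  moreover have "form_coeff (log_form x c) (Aff w)
      = (\<lambda>t. \<Sum>j\<in>UNIV. case x j of Aff v \<Rightarrow> c j / (w + t - v) | Infty \<Rightarrow> 0)"
    by (rule ext) simp
  ultimately show ?thesis by simp
qed

text \<open>In the coordinate \<open>t = 1/z\<close> one has \<open>dz / (z - w) = - dt / (t (1 - w t))\<close>.\<close>

lemma log_form_Infty_residue:
  "((\<lambda>t. t * form_coeff (log_form x c) Infty t) \<longlongrightarrow>
     - (\<Sum>i\<in>UNIV. case x i of Aff w \<Rightarrow> c i | Infty \<Rightarrow> 0)) (at 0)"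
proof -
  have "((\<lambda>t. - (\<Sum>i\<in>UNIV. case x i of Aff w \<Rightarrow> c i / (1 - w * t) | Infty \<Rightarrow> 0)) \<longlongrightarrow>
      - (\<Sum>i\<in>UNIV. case x i of Aff w \<Rightarrow> c i | Infty \<Rightarrow> 0)) (at 0)"
  proof (intro tendsto_minus tendsto_sum)
    fix i
    have "((\<lambda>t. c i / (1 - w * t)) \<longlongrightarrow> c i / (1 - w * 0)) (at 0)" for w
      by (intro tendsto_intros) auto
    then show "((\<lambda>t. case x i of Aff w \<Rightarrow> c i / (1 - w * t) | Infty \<Rightarrow> 0) \<longlongrightarrow>
        (case x i of Aff w \<Rightarrow> c i | Infty \<Rightarrow> 0)) (at 0)"
      by (cases "x i") auto
  qed
  then show ?thesis
  proof (rule Lim_transform_eventually)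
    show "\<forall>\<^sub>F t in at 0. - (\<Sum>i\<in>UNIV. case x i of Aff w \<Rightarrow> c i / (1 - w * t) | Infty \<Rightarrow> 0)
        = t * form_coeff (log_form x c) Infty t"
    proof (rule eventually_at_nonzeroI)
      fix t :: complex assume t: "t \<noteq> 0"
      have "(case x i of Aff w \<Rightarrow> c i / (1 - w * t) | Infty \<Rightarrow> 0)
          = (case x i of Aff w \<Rightarrow> c i / (1 / t - w) | Infty \<Rightarrow> 0) / t" for i
      proof -
        have "1 / t - w = (1 - w * t) / t" for w
          using t by (simp add: field_simps)
        with t show ?thesis by (cases "x i") auto
      qed
      with t show "- (\<Sum>i\<in>UNIV. case x i of Aff w \<Rightarrow> c i / (1 - w * t) | Infty \<Rightarrow> 0)
          = t * form_coeff (log_form x c) Infty t"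
        by (simp add: power2_eq_square flip: sum_divide_distrib)
    qed
  qed
qed

lemma sum_finite_poles:
  fixes c :: "'n::finite \<Rightarrow> complex"
  assumes "inj x"
  shows "(\<Sum>i\<in>UNIV. case x i of Aff w \<Rightarrow> c i | Infty \<Rightarrow> 0) =
    sum c UNIV - (if Infty \<in> range x then c (inv x Infty) else 0)"
proof (cases "Infty \<in> range x")
  case True
  then obtain i where "Infty = x i" by (rule rangeE)
  then have i: "x i = Infty" by simp
  have "(\<Sum>i\<in>UNIV. case x i of Aff w \<Rightarrow> c i | Infty \<Rightarrow> 0) = (\<Sum>j\<in>UNIV. c j - (if j = i then c j else 0))"
  proof (rule sum.cong[OF refl])
    fix j show "(case x j of Aff w \<Rightarrow> c j | Infty \<Rightarrow> 0) = c j - (if j = i then c j else 0)"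
      using i inj_eq[OF assms, of j i] by (cases "x j") auto
  qed
  also have "\<dots> = sum c UNIV - c i"
    by (simp add: sum_subtractf)
  finally show ?thesis
    using True i inv_f_f[OF assms, of i] by simp
next
  case False
  then have "x i \<noteq> Infty" for i by (metis rangeI)
  then have "(case x i of Aff w \<Rightarrow> c i | Infty \<Rightarrow> 0) = c i" for i
    by (cases "x i") auto
  with False show ?thesis by simp
qed

text \<open>Since \<open>1 / (t (1 - w t)) = 1 / t + w / (1 - w t)\<close>, the polar parts cancel when the residues sum
  to zero.\<close>

lemma log_form_regular_Infty:
  assumes "inj x" "sum c UNIV = 0" "Infty \<notin> range x"
  shows "form_coeff (log_form x c) Infty field_differentiable at 0"
proof -
  define g where "g t = - (\<Sum>i\<in>UNIV. case x i of Aff w \<Rightarrow> c i * w / (1 - w * t) | Infty \<Rightarrow> 0)" for t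
  have "g field_differentiable at 0"
    unfolding g_def[abs_def]
  proof (intro field_differentiable_minus field_differentiable_sum)
    fix i
    show "(\<lambda>t. case x i of Aff w \<Rightarrow> c i * w / (1 - w * t) | Infty \<Rightarrow> 0) field_differentiable at 0"
      by (cases "x i") (auto intro!: derivative_intros)
  qed
  moreover have "\<forall>\<^sub>F t in nhds 0. g t = form_coeff (log_form x c) Infty t"
  proof -
    have "\<forall>\<^sub>F t in nhds 0. \<forall>i\<in>UNIV. case x i of Aff w \<Rightarrow> 1 - w * t \<noteq> 0 | Infty \<Rightarrow> True"
    proof (intro eventually_ball_finite ballI finite)
      fix i
      show "\<forall>\<^sub>F t in nhds 0. case x i of Aff w \<Rightarrow> 1 - w * t \<noteq> 0 | Infty \<Rightarrow> True"
      proof (cases "x i")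
        case (Aff w)
        have "open {t. 1 - w * t \<noteq> 0}"
          by (intro open_Collect_neq continuous_intros)
        then have "\<forall>\<^sub>F t in nhds 0. t \<in> {t. 1 - w * t \<noteq> 0}"
          by (rule eventually_nhds_in_open) simp
        with Aff show ?thesis by simp
      qed simp
    qed
    then show ?thesis
    proof eventually_elim
      case (elim t)
      show ?case
      proof (cases "t = 0")
        case True
        then show ?thesis
          by (simp add: g_def cong: cp1.case_cong)
      next
        case False
        have summand: "(case x i of Aff w \<Rightarrow> c i * w / (1 - w * t) | Infty \<Rightarrow> 0)
            = (case x i of Aff w \<Rightarrow> c i / (1 / t - w) | Infty \<Rightarrow> 0) / t ^ 2
              - (case x i of Aff w \<Rightarrow> c i | Infty \<Rightarrow> 0) / t" for i
        proof (cases "x i")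
          case (Aff w)
          from elim have "case x i of Aff w \<Rightarrow> 1 - w * t \<noteq> 0 | Infty \<Rightarrow> True" by blast
          with Aff have "1 - w * t \<noteq> 0" by simp
          moreover from this False have "1 / t - w \<noteq> 0" by (simp add: field_simps)
          ultimately show ?thesis
            using False Aff by (simp add: divide_simps power2_eq_square) (simp add: algebra_simps)
        qed simp
        show ?thesis
          using False sum_finite_poles[OF assms(1), of c] assms(2,3)
          unfolding g_def summand by (simp add: sum_subtractf flip: sum_divide_distrib)
      qed
    qed
  qed
  ultimately show ?thesis
    by (rule field_differentiable_cong_nhds[THEN iffD1, rotated])
qed

lemma log_form_regular:
  assumes "inj x" "sum c UNIV = 0" "p \<notin> range x"
  shows "form_coeff (log_form x c) p field_differentiable at 0"
proof (cases p)
  case (Aff w)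
  with assms(3) log_form_regular_Aff[of w x c] show ?thesis by blast
next
  case Infty
  with assms log_form_regular_Infty[of x c] show ?thesis by blast
qed

lemma log_form_residue:
  assumes "inj x" "sum c UNIV = 0"
  shows "((\<lambda>t. t * form_coeff (log_form x c) (x i) t) \<longlongrightarrow> c i) (at 0)"
proof (cases "x i")
  case (Aff w)
  with log_form_residue_Aff[OF assms(1)] show ?thesis by simp
next
  case Infty
  then have "Infty \<in> range x" "inv x Infty = i"
    using inv_f_f[OF assms(1), of i] by (auto intro: range_eqI[OF sym])
  then show ?thesis
    using log_form_Infty_residue[of x c] sum_finite_poles[OF assms(1), of c] assms(2) Infty by simp
qed

lemma log_form_on_log_form:
  "inj x \<Longrightarrow> sum c UNIV = 0 \<Longrightarrow> log_form_on (range x) V (log_form x c)"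
  unfolding log_form_on_def using log_form_regular log_form_residue by blast

text \<open>The difference between a logarithmic form and its partial fractions is entire and tends to zero
  at infinity, because a simple pole in \<open>t = 1/z\<close> means that \<open>z a(z)\<close> stays bounded. Comparing the
  limits of \<open>z a(z)\<close> for both forms gives the residue theorem on the sphere.\<close>

theorem log_form_partial_fractions:
  fixes x :: "'n::finite \<Rightarrow> cp1"
  assumes x: "inj x" and a: "log_form_on (range x) UNIV a"
    and c: "\<And>i. ((\<lambda>t. t * form_coeff a (x i) t) \<longlongrightarrow> c i) (at 0)"
  shows "sum c UNIV = 0" and "p \<notin> range x \<Longrightarrow> a p = log_form x c p"
proof -
  define F where "F = {w. Aff w \<in> range x}"
  have F: "finite F" unfolding F_def by (intro finite_Aff) simp
  define ci where "ci = (if Infty \<in> range x then c (inv x Infty) else 0)"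
  have ainf: "((\<lambda>t. t * form_coeff a Infty t) \<longlongrightarrow> ci) (at 0)"
  proof (cases "Infty \<in> range x")
    case True
    then have "x (inv x Infty) = Infty" by (rule f_inv_into_f)
    with c[of "inv x Infty"] True show ?thesis by (simp add: ci_def)
  next
    case False
    with a have "form_coeff a Infty field_differentiable at 0"
      by (auto simp: log_form_on_def)
    from field_differentiable_imp_continuous_at[OF this]
    have "(form_coeff a Infty \<longlongrightarrow> form_coeff a Infty 0) (at 0)"
      by (simp add: continuous_at)
    then have "((\<lambda>t. t * form_coeff a Infty t) \<longlongrightarrow> 0 * form_coeff a Infty 0) (at 0)"
      by (intro tendsto_intros)
    with False show ?thesis by (simp add: ci_def)
  qed
  have decay: "((\<lambda>t. b (Aff (1 / t))) \<longlongrightarrow> 0) (at 0)"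
    if b: "((\<lambda>t. t * form_coeff b Infty t) \<longlongrightarrow> l) (at 0)" for b l
  proof -
    have "((\<lambda>t. - t * (t * form_coeff b Infty t)) \<longlongrightarrow> - 0 * l) (at 0)"
      by (intro tendsto_intros b)
    then have "((\<lambda>t. - t * (t * form_coeff b Infty t)) \<longlongrightarrow> 0) (at 0)"
      by simp
    then show ?thesis
      by (rule Lim_transform_eventually) (rule eventually_at_nonzeroI, simp add: power2_eq_square)
  qed
  have fin: "a (Aff z) = log_form x c (Aff z)" if z: "z \<notin> F" for z
  proof -
    have "a (Aff z) - log_form x c (Aff z) = 0 - 0"
    proof (rule liouville_punctured[OF F, where f = "\<lambda>z. a (Aff z) - log_form x c (Aff z)"])
      have "(\<lambda>z. a (Aff z) - log_form x c (Aff z)) field_differentiable at w" if "w \<notin> F" for w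
      proof -
        have "form_coeff a (Aff w) field_differentiable at 0"
             "form_coeff (log_form x c) (Aff w) field_differentiable at 0"
          using a that log_form_regular_Aff[of w x c] by (auto simp: log_form_on_def F_def)
        moreover have "form_coeff b (Aff w) = (\<lambda>t. b (Aff (w + t)))" for b
          by (rule ext) simp
        ultimately have "(\<lambda>t. a (Aff (w + t)) - log_form x c (Aff (w + t))) field_differentiable at 0"
          by (simp only: field_differentiable_diff)
        then show ?thesis
          using field_differentiable_shift[of "\<lambda>z. a (Aff z) - log_form x c (Aff z)" w 0] by simp
      qed
      then show "(\<lambda>z. a (Aff z) - log_form x c (Aff z)) holomorphic_on - F"
        by (simp add: holomorphic_on_def field_differentiable_at_within)
      show "((\<lambda>z. (z - w) * (a (Aff z) - log_form x c (Aff z))) \<longlongrightarrow> 0) (at w)" if "w \<in> F" for w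
      proof -
        obtain i where i: "x i = Aff w" using \<open>w \<in> F\<close> by (auto simp: F_def)
        have "((\<lambda>t. t * form_coeff a (Aff w) t - t * form_coeff (log_form x c) (Aff w) t) \<longlongrightarrow> c i - c i) (at 0)"
          using c[of i] i log_form_residue_Aff[OF x i, of c] by (intro tendsto_diff) auto
        then show ?thesis
          using LIM_offset_zero_iff[of w "\<lambda>z. (z - w) * (a (Aff z) - log_form x c (Aff z))"]
          by (simp add: right_diff_distrib del: log_form.simps)
      qed
      show "((\<lambda>t. a (Aff (1 / t)) - log_form x c (Aff (1 / t))) \<longlongrightarrow> 0 - 0) (at 0)"
        by (intro tendsto_diff decay[OF ainf] decay[OF log_form_Infty_residue])
    qed (rule z)
    then show ?thesis by simp
  qed
  have near: "\<forall>\<^sub>F t in at 0. form_coeff (log_form x c) Infty t = form_coeff a Infty t"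
  proof -
    have "finite (range x)" by simp
    from eventually_loc_notin[OF this, of Infty] eventually_neq_at_within[of 0 0 UNIV]
    show ?thesis
      by eventually_elim (simp add: fin F_def del: log_form.simps)
  qed
  have "((\<lambda>t. t * form_coeff a Infty t) \<longlongrightarrow>
      - (\<Sum>i\<in>UNIV. case x i of Aff w \<Rightarrow> c i | Infty \<Rightarrow> 0)) (at 0)"
    by (rule Lim_transform_eventually[OF log_form_Infty_residue])
       (use near in eventually_elim, simp)
  from tendsto_unique[OF _ this ainf] show sum0: "sum c UNIV = 0"
    by (simp add: sum_finite_poles[OF x] ci_def)
  show "a p = log_form x c p" if p: "p \<notin> range x"
  proof (cases p)
    case (Aff z)
    with p fin show ?thesis by (simp add: F_def)
  next
    case Infty
    have lim: "(form_coeff b Infty \<longlongrightarrow> b Infty) (at 0)" if "form_coeff b Infty field_differentiable at 0" for b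
      using field_differentiable_imp_continuous_at[OF that] by (simp add: continuous_at)
    have "form_coeff a Infty field_differentiable at 0"
      using a p Infty by (auto simp: log_form_on_def)
    from lim[OF this] have 1: "(form_coeff a Infty \<longlongrightarrow> a Infty) (at 0)" .
    have "form_coeff (log_form x c) Infty field_differentiable at 0"
      using log_form_regular[OF x sum0] p Infty by simp
    from Lim_transform_eventually[OF lim[OF this] near]
    have 2: "(form_coeff a Infty \<longlongrightarrow> log_form x c Infty) (at 0)" .
    from tendsto_unique[OF _ 1 2] Infty show ?thesis by simp
  qed
qed

section \<open>Holomorphic matrices and frames\<close>

lemma matrix_inv_both:
  assumes "invertible A"
  shows "A ** matrix_inv A = mat 1" "matrix_inv A ** A = mat 1"
  using someI_ex[OF assms[unfolded invertible_def]] unfolding matrix_inv_def by auto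

lemma matrix_inv_eqI:
  fixes A B :: "complex ^ 'r::finite ^ 'r"
  assumes "A ** B = mat 1"
  shows "matrix_inv A = B"
proof -
  have "invertible A"
    using assms by (auto simp: invertible_right_inverse)
  from matrix_inv_both(2)[OF this] have "matrix_inv A = matrix_inv A ** (A ** B)"
    by (simp add: assms)
  also have "\<dots> = B"
    using matrix_inv_both(2)[OF \<open>invertible A\<close>] by (simp add: matrix_mul_assoc)
  finally show ?thesis .
qed

lemma invertible_matrix_inv:
  assumes "invertible A"
  shows "invertible (matrix_inv A)"
  using matrix_inv_both[OF assms] by (auto simp: invertible_def)

lemma matrix_inv_inv:
  fixes A :: "complex ^ 'r::finite ^ 'r"
  assumes "invertible A"
  shows "matrix_inv (matrix_inv A) = A"
  by (rule matrix_inv_eqI) (rule matrix_inv_both(2)[OF assms])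

lemma matrix_cancel:
  assumes "invertible A"
  shows "A ** (matrix_inv A ** B) = B" "matrix_inv A ** (A ** B) = B"
    "A *v (matrix_inv A *v v) = v" "matrix_inv A *v (A *v v) = v"
  using matrix_inv_both[OF assms] by (simp_all add: matrix_mul_assoc matrix_vector_mul_assoc)

lemma matrix_inv_mult:
  fixes A B :: "complex ^ 'r::finite ^ 'r"
  assumes "invertible A" "invertible B"
  shows "matrix_inv (A ** B) = matrix_inv B ** matrix_inv A"
  by (rule matrix_inv_eqI)
     (simp add: matrix_mul_assoc[symmetric] matrix_cancel[OF assms(2)] matrix_inv_both[OF assms(1)])

lemma transpose_mat [simp]: "transpose (mat c) = mat c"
  by (auto simp: transpose_def mat_def vec_eq_iff)

lemma matrix_inv_transpose:
  fixes A :: "complex ^ 'r::finite ^ 'r"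
  assumes "invertible A"
  shows "matrix_inv (transpose A) = transpose (matrix_inv A)"
  by (rule matrix_inv_eqI)
     (simp add: matrix_inv_both[OF assms] flip: matrix_transpose_mul)

lemma invertible_transpose:
  fixes A :: "complex ^ 'r::finite ^ 'r"
  assumes "invertible A"
  shows "invertible (transpose A)"
  unfolding invertible_right_inverse
  by (rule exI[of _ "transpose (matrix_inv A)"])
     (simp add: matrix_inv_both[OF assms] flip: matrix_transpose_mul)

definition mat_hol :: "(cp1 \<Rightarrow> complex ^ 'r ^ 's) \<Rightarrow> cp1 \<Rightarrow> bool" where
  "mat_hol A p \<longleftrightarrow> (\<forall>a b. hol_at (\<lambda>q. A q $ a $ b) p)"

definition vec_hol :: "(cp1 \<Rightarrow> complex ^ 'r) \<Rightarrow> cp1 \<Rightarrow> bool" where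
  "vec_hol v p \<longleftrightarrow> (\<forall>a. hol_at (\<lambda>q. v q $ a) p)"

lemma mat_hol_const [simp]: "mat_hol (\<lambda>_. A) p"
  by (simp add: mat_hol_def)

lemma vec_hol_const [simp]: "vec_hol (\<lambda>_. v) p"
  by (simp add: vec_hol_def)

lemma mat_hol_mult: "mat_hol A p \<Longrightarrow> mat_hol B p \<Longrightarrow> mat_hol (\<lambda>q. A q ** B q) p"
  unfolding mat_hol_def by (auto simp: matrix_matrix_mult_def intro!: hol_at_sum hol_at_mult)

lemma vec_hol_mult: "mat_hol A p \<Longrightarrow> vec_hol v p \<Longrightarrow> vec_hol (\<lambda>q. A q *v v q) p"
  unfolding mat_hol_def vec_hol_def
  by (auto simp: matrix_vector_mult_def intro!: hol_at_sum hol_at_mult)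

lemma mat_hol_transpose: "mat_hol A p \<Longrightarrow> mat_hol (\<lambda>q. transpose (A q)) p"
  by (simp add: mat_hol_def transpose_def)

lemma mat_hol_cong:
  assumes "open W" "p \<in> W" "\<And>q. q \<in> W \<Longrightarrow> A q = B q"
  shows "mat_hol A p \<longleftrightarrow> mat_hol B p"
  unfolding mat_hol_def by (intro all_cong1 hol_at_cong[OF assms(1,2)]) (simp add: assms(3))

lemma vec_hol_cong:
  assumes "open W" "p \<in> W" "\<And>q. q \<in> W \<Longrightarrow> v q = w q"
  shows "vec_hol v p \<longleftrightarrow> vec_hol w p"
  unfolding vec_hol_def by (intro all_cong1 hol_at_cong[OF assms(1,2)]) (simp add: assms(3))

lemma hol_at_det: "mat_hol A p \<Longrightarrow> hol_at (\<lambda>q. det (A q)) p"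
  unfolding det_def mat_hol_def by (intro hol_at_sum hol_at_mult hol_at_prod) auto

text \<open>Cramer's rule, which makes the inverse of a holomorphic matrix holomorphic.\<close>

lemma matrix_inv_entry:
  fixes A :: "complex ^ 'r::finite ^ 'r"
  assumes "invertible A"
  shows "matrix_inv A $ k $ b =
    det (\<chi> i j. if j = k then axis b 1 $ i else A $ i $ j) / det A"
proof -
  have "det A \<noteq> 0" using assms by (simp add: invertible_det_nz)
  moreover have "A *v column b (matrix_inv A) = axis b 1"
    using matrix_inv_both(1)[OF assms]
    by (simp add: vec_eq_iff matrix_matrix_mult_def matrix_vector_mult_def column_def mat_def axis_def)
  ultimately have "column b (matrix_inv A) =
      (\<chi> k. det (\<chi> i j. if j = k then axis b 1 $ i else A $ i $ j) / det A)"
    by (simp add: cramer)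
  then show ?thesis
    by (simp add: vec_eq_iff column_def)
qed

lemma hol_at_if: "hol_at f p \<Longrightarrow> hol_at g p \<Longrightarrow> hol_at (\<lambda>q. if c then f q else g q) p"
  by (cases c) auto

lemma mat_hol_inv:
  fixes A :: "cp1 \<Rightarrow> complex ^ 'r::finite ^ 'r"
  assumes "mat_hol A p" "open W" "p \<in> W" "\<And>q. q \<in> W \<Longrightarrow> invertible (A q)"
  shows "mat_hol (\<lambda>q. matrix_inv (A q)) p"
  unfolding mat_hol_def
proof (intro allI)
  fix k b
  have "hol_at (\<lambda>q. det (\<chi> i j. if j = k then axis b 1 $ i else A q $ i $ j) / det (A q)) p"
    using assms(1,3,4)
    by (intro hol_at_divide hol_at_det) (auto simp: mat_hol_def invertible_det_nz intro!: hol_at_if)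
  then show "hol_at (\<lambda>q. matrix_inv (A q) $ k $ b) p"
    by (rule hol_at_cong[OF assms(2,3), THEN iffD2, rotated]) (rule matrix_inv_entry[OF assms(4)])
qed

lemma mat_hol_UNIV_const:
  assumes "\<And>p. mat_hol A p"
  shows "A p = A Infty"
  using assms hol_on_UNIV_const[of "\<lambda>q. A q $ a $ b" p for a b]
  by (simp add: mat_hol_def hol_on_iff vec_eq_iff)

lemma vec_hol_UNIV_const:
  assumes "\<And>p. vec_hol v p"
  shows "v p = v Infty"
  using assms hol_on_UNIV_const[of "\<lambda>q. v q $ a" p for a]
  by (simp add: vec_hol_def hol_on_iff vec_eq_iff)

lemma hol_section_iff:
  "hol_section E U s \<longleftrightarrow> (\<forall>(V, f)\<in>E. \<forall>p\<in>U \<inter> V. vec_hol (\<lambda>q. matrix_inv (f q) *v s q) p)"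
  unfolding hol_section_def hol_on_iff vec_hol_def by fast

lemma column_matrix_mult: "(A *v column b B) $ a = (A ** B) $ a $ b"
  by (simp add: matrix_matrix_mult_def matrix_vector_mult_def column_def)

lemma hol_frame_iff:
  "hol_frame E U g \<longleftrightarrow> (\<forall>p\<in>U. invertible (g p)) \<and>
     (\<forall>(V, f)\<in>E. \<forall>p\<in>U \<inter> V. mat_hol (\<lambda>q. matrix_inv (f q) ** g q) p)"
  unfolding hol_frame_def hol_section_def hol_on_iff mat_hol_def column_matrix_mult by fast

lemma bundle_chart:
  assumes "hol_bundle E"
  obtains V f where "(V, f) \<in> E" "p \<in> V" "open V" "hol_frame E V f"
proof -
  from assms have "p \<in> (\<Union>(V, f)\<in>E. V)" by (simp add: hol_bundle_def)
  then obtain V f where "(V, f) \<in> E" "p \<in> V" by blast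
  with assms that show thesis by (auto simp: hol_bundle_def)
qed

lemma hol_frame_coords:
  assumes "hol_frame E U g" "(V, f) \<in> E" "p \<in> U" "p \<in> V"
  shows "mat_hol (\<lambda>q. matrix_inv (f q) ** g q) p"
  using assms unfolding hol_frame_iff by blast

text \<open>The definition of a holomorphic section refers to the frames \<open>f\<close> of the atlas. Coordinates in
  another frame \<open>g\<close> differ from those by the matrix \<open>(f^-1 g)^-1\<close>, which is holomorphic as well.\<close>

lemma section_coords:
  assumes "hol_bundle E" "hol_frame E U g" "open U" "hol_section E W s" "p \<in> U" "p \<in> W"
  shows "vec_hol (\<lambda>q. matrix_inv (g q) *v s q) p"
proof -
  obtain V f where V: "(V, f) \<in> E" "p \<in> V" "open V" "hol_frame E V f"
    using bundle_chart[OF assms(1)] .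
  have o: "open (U \<inter> V)" "p \<in> U \<inter> V"
    using V assms by auto
  have inv: "invertible (f q)" "invertible (g q)" if "q \<in> U \<inter> V" for q
    using that V(4) assms(2) by (auto simp: hol_frame_def)
  have "mat_hol (\<lambda>q. matrix_inv (f q) ** g q) p"
    using assms V by (auto simp: hol_frame_iff)
  from mat_hol_inv[OF this o] have "mat_hol (\<lambda>q. matrix_inv (matrix_inv (f q) ** g q)) p"
    by (simp add: inv invertible_mult invertible_matrix_inv)
  moreover have "vec_hol (\<lambda>q. matrix_inv (f q) *v s q) p"
    using assms V by (auto simp: hol_section_iff)
  ultimately have "vec_hol (\<lambda>q. matrix_inv (matrix_inv (f q) ** g q) *v (matrix_inv (f q) *v s q)) p"
    by (rule vec_hol_mult)
  moreover have "matrix_inv (matrix_inv (f q) ** g q) *v (matrix_inv (f q) *v s q) = matrix_inv (g q) *v s q"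
    if "q \<in> U \<inter> V" for q
    using inv[OF that]
    by (simp add: matrix_inv_mult matrix_inv_inv invertible_matrix_inv matrix_cancel
        flip: matrix_vector_mul_assoc)
  ultimately show ?thesis
    by (rule vec_hol_cong[OF o, THEN iffD1, rotated])
qed

lemma frame_change:
  assumes "hol_bundle E" "hol_frame E U g" "open U" "hol_frame E W h" "p \<in> U" "p \<in> W"
  shows "mat_hol (\<lambda>q. matrix_inv (g q) ** h q) p"
proof -
  have "hol_section E W (\<lambda>q. column b (h q))" for b
    using assms(4) by (simp add: hol_frame_def)
  from section_coords[OF assms(1-3) this assms(5,6)] show ?thesis
    by (simp add: vec_hol_def mat_hol_def column_matrix_mult)
qed

lemma hol_section_from_coords:
  assumes "hol_bundle E" "hol_frame E U g" "open U" "W \<subseteq> U"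
    and "\<And>p. p \<in> W \<Longrightarrow> vec_hol c p"
  shows "hol_section E W (\<lambda>q. g q *v c q)"
  unfolding hol_section_iff
proof clarify
  fix V f p assume V: "(V, f) \<in> E" "p \<in> W" "p \<in> V"
  then have "mat_hol (\<lambda>q. matrix_inv (f q) ** g q) p"
    using assms(2,4) hol_frame_coords by blast
  from vec_hol_mult[OF this assms(5)[OF V(2)]]
  show "vec_hol (\<lambda>q. matrix_inv (f q) *v (g q *v c q)) p"
    by (simp add: matrix_vector_mul_assoc)
qed

lemma hol_frame_mult:
  assumes "hol_frame E U g" "W \<subseteq> U"
    and "\<And>p. p \<in> W \<Longrightarrow> mat_hol T p" "\<And>p. p \<in> W \<Longrightarrow> invertible (T p)"
  shows "hol_frame E W (\<lambda>q. g q ** T q)"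
  unfolding hol_frame_iff
proof (intro conjI ballI, goal_cases)
  case (1 p)
  with assms show ?case by (auto intro!: invertible_mult simp: hol_frame_def)
next
  case (2 Vf)
  show ?case
  proof (clarify, goal_cases)
    case (1 V f p)
    with 2 have "mat_hol (\<lambda>q. matrix_inv (f q) ** g q) p"
      using assms(1,2) hol_frame_coords by blast
    from mat_hol_mult[OF this assms(3)[OF 1(2)]] show ?case
      by (simp add: matrix_mul_assoc)
  qed
qed

section \<open>Change of frame for logarithmic endomorphism fields\<close>

lemma form_coeff_eq: "a (loc p t) = b (loc p t) \<Longrightarrow> form_coeff a p t = form_coeff b p t"
  by (cases p) auto

lemma form_coeff_conj: "form_coeff (\<lambda>p. h p * (a p * k p)) p t =
    h (loc p t) * (form_coeff a p t * k (loc p t))"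
  by (cases p) auto

lemma frame_entry_change:
  assumes "invertible (f q)" "invertible (g q)"
  shows "frame_entry f \<Phi> a b q = (\<Sum>c\<in>UNIV. \<Sum>d\<in>UNIV. (matrix_inv (f q) ** g q) $ a $ c *
      (frame_entry g \<Phi> c d q * (matrix_inv (g q) ** f q) $ d $ b))"
proof -
  have "matrix_inv (f q) ** \<Phi> q ** f q
      = (matrix_inv (f q) ** g q) ** ((matrix_inv (g q) ** \<Phi> q ** g q) ** (matrix_inv (g q) ** f q))"
    by (simp add: matrix_mul_assoc[symmetric] matrix_cancel assms)
  then have "frame_entry f \<Phi> a b q = ((matrix_inv (f q) ** g q) **
      ((matrix_inv (g q) ** \<Phi> q ** g q) ** (matrix_inv (g q) ** f q))) $ a $ b"
    by (simp add: frame_entry_def)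
  also have "\<dots> = (\<Sum>c\<in>UNIV. (matrix_inv (f q) ** g q) $ a $ c * (\<Sum>d\<in>UNIV.
      (matrix_inv (g q) ** \<Phi> q ** g q) $ c $ d * (matrix_inv (g q) ** f q) $ d $ b))"
    unfolding matrix_matrix_mult_def[of "matrix_inv (f q) ** g q"]
      matrix_matrix_mult_def[of "matrix_inv (g q) ** \<Phi> q ** g q"] by simp
  finally show ?thesis
    by (simp add: frame_entry_def sum_distrib_left)
qed

text \<open>Under a change of frame the matrix of a Higgs field is conjugated by the transition matrix. As
  this matrix is holomorphic, regularity does not depend on the frame, and a residue is conjugated by
  the value of the transition matrix at the pole.\<close>

lemma
  assumes E: "hol_bundle E" and g: "hol_frame E U g" "open U" and f: "hol_frame E V f" "open V"
    and p: "p \<in> U" "p \<in> V"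
  shows frame_entry_regular:
      "(\<And>c d. form_coeff (frame_entry g \<Phi> c d) p field_differentiable at 0) \<Longrightarrow>
       form_coeff (frame_entry f \<Phi> a b) p field_differentiable at 0"
    and frame_entry_residue:
      "(\<And>c d. ((\<lambda>t. t * form_coeff (frame_entry g \<Phi> c d) p t) \<longlongrightarrow> N $ c $ d) (at 0)) \<Longrightarrow>
       ((\<lambda>t. t * form_coeff (frame_entry f \<Phi> a b) p t) \<longlongrightarrow>
          (matrix_inv (f p) ** g p ** N ** (matrix_inv (g p) ** f p)) $ a $ b) (at 0)"
proof -
  let ?h = "\<lambda>c q. (matrix_inv (f q) ** g q) $ a $ c" and ?k = "\<lambda>d q. (matrix_inv (g q) ** f q) $ d $ b"
  have h: "hol_at (?h c) p" and k: "hol_at (?k d) p" for c d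
    using frame_change[OF E f g(1) p(2,1)] frame_change[OF E g f(1) p]
    by (simp_all add: mat_hol_def)
  have ev: "\<forall>\<^sub>F t in nhds 0. form_coeff (frame_entry f \<Phi> a b) p t =
      (\<Sum>c\<in>UNIV. \<Sum>d\<in>UNIV. ?h c (loc p t) * (form_coeff (frame_entry g \<Phi> c d) p t * ?k d (loc p t)))"
    using eventually_loc[OF g(2) p(1)] eventually_loc[OF f(2) p(2)]
  proof eventually_elim
    case (elim t)
    then have "form_coeff (frame_entry f \<Phi> a b) p t =
      form_coeff (\<lambda>q. \<Sum>c\<in>UNIV. \<Sum>d\<in>UNIV. ?h c q * (frame_entry g \<Phi> c d q * ?k d q)) p t"
      using f(1) g(1) by (intro form_coeff_eq frame_entry_change) (auto simp: hol_frame_def)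
    then show ?case
      by (simp only: form_coeff_sum form_coeff_conj)
  qed
  {
    assume a: "\<And>c d. form_coeff (frame_entry g \<Phi> c d) p field_differentiable at 0"
    have "(\<lambda>t. \<Sum>c\<in>UNIV. \<Sum>d\<in>UNIV. ?h c (loc p t) * (form_coeff (frame_entry g \<Phi> c d) p t * ?k d (loc p t)))
        field_differentiable at 0"
      using h k a unfolding hol_at_def
      by (intro field_differentiable_sum field_differentiable_mult) auto
    then show "form_coeff (frame_entry f \<Phi> a b) p field_differentiable at 0"
      using field_differentiable_cong_nhds[OF ev] by simp
  next
    assume a: "\<And>c d. ((\<lambda>t. t * form_coeff (frame_entry g \<Phi> c d) p t) \<longlongrightarrow> N $ c $ d) (at 0)"
    have "((\<lambda>t. \<Sum>c\<in>UNIV. \<Sum>d\<in>UNIV. ?h c (loc p t) * ((t * form_coeff (frame_entry g \<Phi> c d) p t) * ?k d (loc p t)))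
        \<longlongrightarrow> (\<Sum>c\<in>UNIV. \<Sum>d\<in>UNIV. ?h c p * (N $ c $ d * ?k d p))) (at 0)"
      by (intro tendsto_sum tendsto_mult hol_at_tendsto[OF h] hol_at_tendsto[OF k] a)
    then have "((\<lambda>t. t * form_coeff (frame_entry f \<Phi> a b) p t) \<longlongrightarrow>
        (\<Sum>c\<in>UNIV. \<Sum>d\<in>UNIV. ?h c p * (N $ c $ d * ?k d p))) (at 0)"
    proof (rule Lim_transform_eventually)
      show "\<forall>\<^sub>F t in at 0. (\<Sum>c\<in>UNIV. \<Sum>d\<in>UNIV. ?h c (loc p t) * ((t * form_coeff (frame_entry g \<Phi> c d) p t) * ?k d (loc p t)))
        = t * form_coeff (frame_entry f \<Phi> a b) p t"
      using ev[unfolded eventually_nhds_conv_at, THEN conjunct1]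
      by eventually_elim (simp add: sum_distrib_left mult_ac)
    qed
    moreover have "(\<Sum>c\<in>UNIV. \<Sum>d\<in>UNIV. ?h c p * (N $ c $ d * ?k d p)) =
        (matrix_inv (f p) ** g p ** N ** (matrix_inv (g p) ** f p)) $ a $ b"
    proof -
      have "(A ** N ** B) $ a $ b = (\<Sum>c\<in>UNIV. \<Sum>d\<in>UNIV. A $ a $ c * (N $ c $ d * B $ d $ b))" for A B
        unfolding matrix_mul_assoc[symmetric] by (simp add: matrix_matrix_mult_def sum_distrib_left)
      then show ?thesis by simp
    qed
    ultimately show "((\<lambda>t. t * form_coeff (frame_entry f \<Phi> a b) p t) \<longlongrightarrow>
          (matrix_inv (f p) ** g p ** N ** (matrix_inv (g p) ** f p)) $ a $ b) (at 0)"
      by simp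
  }
qed

lemma log_form_on_frame_change:
  assumes E: "hol_bundle E" and g: "hol_frame E U g" "open U" and f: "hol_frame E V f" "open V"
    and a: "\<And>c d. log_form_on D U (frame_entry g \<Phi> c d)"
  shows "log_form_on D (U \<inter> V) (frame_entry f \<Phi> a b)"
  unfolding log_form_on_def
proof (intro conjI ballI)
  fix p assume "p \<in> U \<inter> V - D"
  then show "form_coeff (frame_entry f \<Phi> a b) p field_differentiable at 0"
    using a by (intro frame_entry_regular[OF E g f]) (auto simp: log_form_on_def)
next
  fix p assume p: "p \<in> U \<inter> V \<inter> D"
  then have "\<exists>l. ((\<lambda>t. t * form_coeff (frame_entry g \<Phi> c d) p t) \<longlongrightarrow> l) (at 0)" for c d
    using a by (auto simp: log_form_on_def)
  then obtain N where "\<And>c d. ((\<lambda>t. t * form_coeff (frame_entry g \<Phi> c d) p t) \<longlongrightarrow> N c d) (at 0)"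
    by metis
  then show "\<exists>c. ((\<lambda>t. t * form_coeff (frame_entry f \<Phi> a b) p t) \<longlongrightarrow> c) (at 0)"
    using frame_entry_residue[OF E g f, of p \<Phi> "\<chi> c d. N c d" a b] p by auto
qed

text \<open>The residue is defined through an arbitrarily chosen frame of the atlas. The transition to the
  global frame cancels this choice.\<close>

lemma res_in_global_frame:
  fixes x :: "'n::finite \<Rightarrow> cp1"
  assumes E: "hol_bundle (bun P)" and g: "hol_frame (bun P) UNIV g"
    and a: "\<And>c d. log_form_on (range x) UNIV (frame_entry g (higgs P) c d)"
    and N: "\<And>c d. ((\<lambda>t. t * form_coeff (frame_entry g (higgs P) c d) (x i) t) \<longlongrightarrow> N $ c $ d) (at 0)"
  shows "res x P i = g (x i) ** N ** matrix_inv (g (x i))"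
proof -
  define f where "f = (SOME f. \<exists>V. (V, f) \<in> bun P \<and> x i \<in> V)"
  have "\<exists>f. \<exists>V. (V, f) \<in> bun P \<and> x i \<in> V"
    using bundle_chart[OF E, of "x i"] by metis
  from someI_ex[OF this] obtain V where V: "(V, f) \<in> bun P" "x i \<in> V"
    unfolding f_def by blast
  then have f: "hol_frame (bun P) V f" "open V"
    using E by (auto simp: hol_bundle_def)
  have inv: "invertible (f (x i))" "invertible (g (x i))"
    using f V g by (auto simp: hol_frame_def)
  have "residue (form_coeff (frame_entry f (higgs P) a b) (x i)) 0 =
      (matrix_inv (f (x i)) ** g (x i) ** N ** (matrix_inv (g (x i)) ** f (x i))) $ a $ b" for a b
  proof (rule residue_form_coeff)
    show "log_form_on (range x) V (frame_entry f (higgs P) a b)"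
      using log_form_on_frame_change[OF E g open_UNIV f a] by simp
  qed (use f V frame_entry_residue[OF E g open_UNIV f _ _ N] in auto)
  then have "res x P i = f (x i) ** (matrix_inv (f (x i)) ** g (x i) ** N ** (matrix_inv (g (x i)) ** f (x i)))
      ** matrix_inv (f (x i))"
    unfolding res_def Let_def f_def[symmetric] by simp
  then show ?thesis
    by (simp add: matrix_mul_assoc[symmetric] matrix_cancel inv matrix_inv_both)
qed

section \<open>Lines and nilpotent matrices in the plane\<close>

definition det2 :: "complex ^ 2 \<Rightarrow> complex ^ 2 \<Rightarrow> complex" where
  "det2 a b = a $ 1 * b $ 2 - a $ 2 * b $ 1"

lemma vec2_eq_iff: "(a :: complex ^ 2) = b \<longleftrightarrow> a $ 1 = b $ 1 \<and> a $ 2 = b $ 2"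
  by (simp add: vec_eq_iff forall_2)

lemma mat2_eq_iff: "(A :: complex ^ 2 ^ 2) = B \<longleftrightarrow>
    A $ 1 $ 1 = B $ 1 $ 1 \<and> A $ 1 $ 2 = B $ 1 $ 2 \<and> A $ 2 $ 1 = B $ 2 $ 1 \<and> A $ 2 $ 2 = B $ 2 $ 2"
  by (simp add: vec_eq_iff forall_2)

lemma mult_entry2: "(A ** B) $ a $ b = A $ a $ 1 * B $ 1 $ b + A $ a $ 2 * B $ 2 $ b"
  for A B :: "complex ^ 2 ^ 2"
  by (simp add: matrix_matrix_mult_def sum_2)

lemma vmult_entry2: "(A *v v) $ a = A $ a $ 1 * v $ 1 + A $ a $ 2 * v $ 2"
  for A :: "complex ^ 2 ^ 2"
  by (simp add: matrix_vector_mult_def sum_2)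

lemma in_span1: "v \<in> vec.span {w} \<longleftrightarrow> (\<exists>k. v = k *s w)"
  by (auto simp: vec.span_singleton)

lemma span1_scale: "k \<noteq> 0 \<Longrightarrow> vec.span {k *s w} = vec.span {w}" for w :: "complex ^ 'r"
proof (intro set_eqI iffI)
  fix v assume "k \<noteq> 0" "v \<in> vec.span {w}"
  then obtain l where "v = l *s w" by (auto simp: in_span1)
  with \<open>k \<noteq> 0\<close> have "v = (l / k) *s (k *s w)" by simp
  then show "v \<in> vec.span {k *s w}" unfolding in_span1 by blast
qed (auto simp: in_span1)

lemma span1_eqI: "v \<in> vec.span {w} \<Longrightarrow> v \<noteq> 0 \<Longrightarrow> vec.span {v} = vec.span {w}"
  for w :: "complex ^ 'r"
proof -
  assume "v \<in> vec.span {w}" "v \<noteq> 0"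
  then obtain k where "v = k *s w" "k \<noteq> 0" by (auto simp: in_span1)
  then show ?thesis by (simp add: span1_scale)
qed

lemma mult_smult: "A *v (k *s v) = k *s (A *v v)" for A :: "complex ^ 'r::finite ^ 's::finite"
  by (simp add: vec_eq_iff matrix_vector_mult_def sum_distrib_left mult_ac)

lemma image_span1: "(\<lambda>v. A *v v) ` vec.span {w} = vec.span {A *v w}"
  for A :: "complex ^ 'r::finite ^ 's::finite"
proof (intro set_eqI iffI)
  fix u assume "u \<in> vec.span {A *v w}"
  then obtain k where "u = A *v (k *s w)" by (auto simp: in_span1 mult_smult)
  then show "u \<in> (\<lambda>v. A *v v) ` vec.span {w}" by (auto simp: in_span1)
qed (auto simp: in_span1 mult_smult)

lemma det2_eq_0:
  assumes "b \<noteq> 0"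
  shows "det2 a b = 0 \<longleftrightarrow> a \<in> vec.span {b}"
proof
  assume d: "det2 a b = 0"
  show "a \<in> vec.span {b}"
  proof (cases "b $ 1 = 0")
    case True
    with assms have "b $ 2 \<noteq> 0" by (simp add: vec2_eq_iff)
    with True d have "a = (a $ 2 / b $ 2) *s b"
      by (simp add: det2_def vec2_eq_iff)
    then show ?thesis by (auto simp: in_span1)
  next
    case False
    with d have "a = (a $ 1 / b $ 1) *s b"
      by (simp add: det2_def vec2_eq_iff field_simps)
    then show ?thesis by (auto simp: in_span1)
  qed
qed (auto simp: in_span1 det2_def)

lemma det2_basis:
  assumes "det2 a b \<noteq> 0"
  shows "u = (det2 u b / det2 a b) *s a + (det2 a u / det2 a b) *s b"
proof -
  have "det2 a b * u $ 1 = det2 u b * a $ 1 + det2 a u * b $ 1"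
       "det2 a b * u $ 2 = det2 u b * a $ 2 + det2 a u * b $ 2"
    by (simp_all add: det2_def algebra_simps)
  with assms show ?thesis
    by (simp add: vec2_eq_iff add_divide_distrib[symmetric] eq_divide_eq mult.commute)
qed

lemma is_line_iff: "is_line X \<longleftrightarrow> (\<exists>w\<noteq>0. X = vec.span {w})"
proof
  assume X: "is_line X"
  obtain B where B: "B \<subseteq> X" "vec.independent B" "X \<subseteq> vec.span B" "card B = 1"
    using X vec.basis_exists[of X] unfolding is_line_def by metis
  then obtain w where "B = {w}" by (meson card_1_singletonE)
  with B X have "w \<noteq> 0" "X = vec.span {w}"
    using vec.dependent_zero[of B] vec.span_minimal[of B X] by (auto simp: is_line_def)
  then show "\<exists>w\<noteq>0. X = vec.span {w}" by blast
next
  assume "\<exists>w\<noteq>0. X = vec.span {w}"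
  then obtain w where w: "w \<noteq> 0" "X = vec.span {w}" by blast
  then have "vec.independent {w}" by simp
  from vec.dim_span_eq_card_independent[OF this] w show "is_line X"
    by (simp add: is_line_def vec.subspace_span)
qed

text \<open>A nilpotent matrix of size two is one with vanishing trace and determinant.\<close>

lemma nilpotent2_entries:
  fixes N :: "complex ^ 2 ^ 2"
  shows "N ** N = 0 \<longleftrightarrow> N $ 2 $ 2 = - N $ 1 $ 1 \<and> N $ 1 $ 1 * N $ 1 $ 1 + N $ 1 $ 2 * N $ 2 $ 1 = 0"
    (is "_ \<longleftrightarrow> ?d = - ?a \<and> ?a * ?a + ?b * ?c = 0")
proof
  assume "N ** N = 0"
  then have e: "?a * ?a + ?b * ?c = 0" "?b * (?a + ?d) = 0" "?c * (?a + ?d) = 0" "?d * ?d + ?b * ?c = 0"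
    by (simp_all add: mat2_eq_iff mult_entry2 algebra_simps)
  have "?a + ?d = 0"
  proof (rule ccontr)
    assume "?a + ?d \<noteq> 0"
    with e show False by auto
  qed
  with e show "?d = - ?a \<and> ?a * ?a + ?b * ?c = 0"
    by (simp add: eq_neg_iff_add_eq_0 add.commute)
qed (simp add: mat2_eq_iff mult_entry2 algebra_simps)

text \<open>If \<open>N v \<noteq> 0\<close>, then \<open>w = N v\<close> is in the kernel, and \<open>v, w\<close> is a basis.\<close>

lemma nilpotent2_kernel:
  fixes N :: "complex ^ 2 ^ 2"
  assumes "N ** N = 0" "N \<noteq> 0"
  obtains w where "w \<noteq> 0" "range ((*v) N) = vec.span {w}" "\<And>v. N *v v = 0 \<longleftrightarrow> v \<in> vec.span {w}"
proof -
  obtain v where v: "N *v v \<noteq> 0"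
    using assms(2) by (auto simp: matrix_eq[of N 0])
  define w where "w = N *v v"
  have Nw: "N *v w = 0"
    using assms(1) by (simp add: w_def matrix_vector_mul_assoc)
  have w0: "w \<noteq> 0" using v by (simp add: w_def)
  have "det2 v w \<noteq> 0"
  proof
    assume "det2 v w = 0"
    then obtain k where "v = k *s w"
      using det2_eq_0[OF w0] by (auto simp: in_span1)
    with Nw v show False by (simp add: mult_smult)
  qed
  then have N: "N *v u = (det2 u w / det2 v w) *s w" for u
    using arg_cong[OF det2_basis[of v w u], of "(*v) N"] Nw
    by (simp add: matrix_vector_right_distrib mult_smult w_def)
  have "range ((*v) N) = vec.span {w}"
  proof (intro set_eqI iffI)
    fix u assume "u \<in> range ((*v) N)"
    with N show "u \<in> vec.span {w}" by (auto simp: in_span1)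
  next
    fix u assume "u \<in> vec.span {w}"
    then obtain k where "u = k *s w" by (auto simp: in_span1)
    then have "u = N *v (k *s v)" by (simp add: mult_smult w_def)
    then show "u \<in> range ((*v) N)" by blast
  qed
  moreover have "N *v u = 0 \<longleftrightarrow> u \<in> vec.span {w}" for u
    using N[of u] det2_eq_0[OF w0, of u] w0 \<open>det2 v w \<noteq> 0\<close> by simp
  ultimately show thesis
    using that w0 by blast
qed

section \<open>Higgs fields on a framed bundle\<close>

lemma log_form_add: "log_form x (\<lambda>i. c i + d i) p = log_form x c p + log_form x d p"
proof (cases p)
  case (Aff z)
  have "(case x i of Aff w \<Rightarrow> (c i + d i) / (z - w) | Infty \<Rightarrow> 0) =
     (case x i of Aff w \<Rightarrow> c i / (z - w) | Infty \<Rightarrow> 0) + (case x i of Aff w \<Rightarrow> d i / (z - w) | Infty \<Rightarrow> 0)" for i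
    by (cases "x i") (auto simp: add_divide_distrib)
  with Aff show ?thesis by (simp add: sum.distrib)
next
  case Infty
  have "(case x i of Aff w \<Rightarrow> (c i + d i) * w | Infty \<Rightarrow> 0) =
     (case x i of Aff w \<Rightarrow> c i * w | Infty \<Rightarrow> 0) + (case x i of Aff w \<Rightarrow> d i * w | Infty \<Rightarrow> 0)" for i
    by (cases "x i") (auto simp: algebra_simps)
  with Infty show ?thesis by (simp add: sum.distrib)
qed

lemma log_form_cmult: "log_form x (\<lambda>i. k * c i) p = k * log_form x c p"
proof (cases p)
  case (Aff z)
  have "(case x i of Aff w \<Rightarrow> (k * c i) / (z - w) | Infty \<Rightarrow> 0) =
     k * (case x i of Aff w \<Rightarrow> c i / (z - w) | Infty \<Rightarrow> 0)" for i
    by (cases "x i") auto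
  with Aff show ?thesis by (simp add: sum_distrib_left)
next
  case Infty
  have "(case x i of Aff w \<Rightarrow> (k * c i) * w | Infty \<Rightarrow> 0) =
     k * (case x i of Aff w \<Rightarrow> c i * w | Infty \<Rightarrow> 0)" for i
    by (cases "x i") auto
  with Infty show ?thesis by (simp add: sum_distrib_left)
qed

lemma log_form_zero [simp]: "log_form x (\<lambda>_. 0) p = 0"
  using log_form_cmult[of x 0 "\<lambda>_. 0" p] by simp

text \<open>A residue is a limit of values at unmarked points.\<close>

lemma log_form_eq_0D:
  assumes x: "inj x" and "sum c UNIV = 0" and z: "\<And>p. p \<notin> range x \<Longrightarrow> log_form x c p = 0"
  shows "c i = 0"
proof -
  have "\<forall>\<^sub>F t in at 0. t * form_coeff (log_form x c) (x i) t = 0"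
    using eventually_loc_notin[of "range x" "x i"]
  proof (rule eventually_mono)
    fix t assume "loc (x i) t \<notin> range x"
    from z[OF this] have "form_coeff (log_form x c) (x i) t = form_coeff (\<lambda>_. 0) (x i) t"
      by (intro form_coeff_eq) simp
    also have "\<dots> = 0" by (cases "x i") auto
    finally show "t * form_coeff (log_form x c) (x i) t = 0" by simp
  qed simp
  from tendsto_unique[OF _ log_form_residue[OF x assms(2)] tendsto_eventually[OF this]]
  show ?thesis by simp
qed

definition log_matrix :: "('n::finite \<Rightarrow> cp1) \<Rightarrow> ('n \<Rightarrow> complex ^ 2 ^ 2) \<Rightarrow> cp1 \<Rightarrow> complex ^ 2 ^ 2" where
  "log_matrix x N p = (\<chi> a b. log_form x (\<lambda>i. N i $ a $ b) p)"

lemma log_matrix_left: "log_matrix x (\<lambda>i. A ** N i) p = A ** log_matrix x N p"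
  by (simp add: vec_eq_iff log_matrix_def mult_entry2 log_form_add log_form_cmult)

lemma log_matrix_right: "log_matrix x (\<lambda>i. N i ** A) p = log_matrix x N p ** A"
  by (simp add: vec_eq_iff log_matrix_def mult_entry2 log_form_add log_form_cmult mult.commute[of _ "A $ _ $ _"])

lemma log_matrix_vector: "(log_matrix x N p *v v) $ a = log_form x (\<lambda>i. (N i *v v) $ a) p"
  by (simp add: log_matrix_def vmult_entry2 log_form_add log_form_cmult mult.commute[of _ "v $ _"])

lemma sum_entry: "(\<Sum>i\<in>I. N i) $ a $ b = (\<Sum>i\<in>I. N i $ a $ b)"
  by simp

lemma log_matrix_eqD:
  assumes x: "inj x" and N: "(\<Sum>i\<in>UNIV. N i) = 0" "(\<Sum>i\<in>UNIV. M i) = 0"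
    and eq: "\<And>p. p \<notin> range x \<Longrightarrow> log_matrix x N p = log_matrix x M p"
  shows "N i = M i"
proof -
  have "N i $ a $ b + (-1) * M i $ a $ b = 0" for a b
  proof (rule log_form_eq_0D[OF x])
    have "(\<Sum>i\<in>UNIV. N i $ a $ b) = 0" "(\<Sum>i\<in>UNIV. M i $ a $ b) = 0"
      using N by (metis sum_entry zero_index)+
    then show "(\<Sum>i\<in>UNIV. N i $ a $ b + (-1) * M i $ a $ b) = 0"
      by (simp add: sum_subtractf)
    fix p assume "p \<notin> range x"
    from eq[OF this] show "log_form x (\<lambda>i. N i $ a $ b + (-1) * M i $ a $ b) p = 0"
      unfolding log_form_add log_form_cmult by (simp add: log_matrix_def vec_eq_iff)
  qed
  then show ?thesis by (simp add: vec_eq_iff)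
qed

text \<open>The Higgs bundle \<open>P\<close> read in a global frame \<open>g\<close>. The flags need no separate data, because the
  image of a nonzero nilpotent residue is the flag line.\<close>

definition in_frame :: "('n::finite \<Rightarrow> cp1) \<Rightarrow> 'n qp_higgs \<Rightarrow> (cp1 \<Rightarrow> complex ^ 2 ^ 2) \<Rightarrow>
    ('n \<Rightarrow> complex ^ 2 ^ 2) \<Rightarrow> bool" where
  "in_frame x P g N \<longleftrightarrow> hol_frame (bun P) UNIV g \<and>
     (\<forall>i. flag P i = range (\<lambda>v. g (x i) *v (N i *v v))) \<and>
     (\<forall>p. p \<notin> range x \<longrightarrow> higgs P p = g p ** log_matrix x N p ** matrix_inv (g p))"

text \<open>The systems of residues of stable Higgs bundles. Only the last condition involves the stability
  inequality: it says that the flags are not all contained in one constant line.\<close>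

definition stable_residues :: "('n::finite \<Rightarrow> complex ^ 2 ^ 2) \<Rightarrow> bool" where
  "stable_residues N \<longleftrightarrow> (\<forall>i. N i \<noteq> 0 \<and> N i ** N i = 0) \<and> (\<Sum>i\<in>UNIV. N i) = 0 \<and>
     (\<exists>i j. range ((*v) (N i)) \<noteq> range ((*v) (N j)))"

lemma log_form_on_cong:
  assumes D: "finite D" and eq: "\<And>p. p \<notin> D \<Longrightarrow> a p = b p" and b: "log_form_on D V b"
  shows "log_form_on D V a"
proof -
  have ev: "\<forall>\<^sub>F t in at 0. form_coeff a p t = form_coeff b p t" for p
    using eventually_loc_notin[OF D, of p] by (rule eventually_mono) (rule form_coeff_eq, rule eq)
  show ?thesis
    unfolding log_form_on_def
  proof (intro conjI ballI)
    fix p assume p: "p \<in> V - D"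
    then have "\<forall>\<^sub>F t in nhds 0. form_coeff a p t = form_coeff b p t"
      using ev[of p] form_coeff_eq[of a p 0 b] eq by (simp add: eventually_nhds_conv_at)
    from field_differentiable_cong_nhds[OF this] show "form_coeff a p field_differentiable at 0"
      using b p by (auto simp: log_form_on_def)
  next
    fix p assume p: "p \<in> V \<inter> D"
    then obtain c where c: "((\<lambda>t. t * form_coeff b p t) \<longlongrightarrow> c) (at 0)"
      using b by (auto simp: log_form_on_def)
    have "((\<lambda>t. t * form_coeff a p t) \<longlongrightarrow> c) (at 0)"
      by (rule Lim_transform_eventually[OF c]) (use ev[of p] in eventually_elim, simp)
    then show "\<exists>c. ((\<lambda>t. t * form_coeff a p t) \<longlongrightarrow> c) (at 0)" ..
  qed
qed

lemma
  fixes x :: "'n::finite \<Rightarrow> cp1"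
  assumes x: "inj x" and P: "in_frame x P g N" and N: "(\<Sum>i\<in>UNIV. N i) = 0"
  shows in_frame_log: "log_form_on (range x) UNIV (frame_entry g (higgs P) a b)"
    and in_frame_residue:
      "((\<lambda>t. t * form_coeff (frame_entry g (higgs P) a b) (x i) t) \<longlongrightarrow> N i $ a $ b) (at 0)"
    and in_frame_res: "hol_bundle (bun P) \<Longrightarrow> res x P i = g (x i) ** N i ** matrix_inv (g (x i))"
proof -
  have eq: "frame_entry g (higgs P) a b p = log_form x (\<lambda>i. N i $ a $ b) p" if "p \<notin> range x" for a b p
  proof -
    have inv: "invertible (g p)" using P by (auto simp: in_frame_def hol_frame_def)
    have "matrix_inv (g p) ** higgs P p ** g p = log_matrix x N p"
      using P that
      by (simp add: in_frame_def matrix_mul_assoc[symmetric] matrix_cancel inv matrix_inv_both)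
    then show ?thesis by (simp add: frame_entry_def log_matrix_def)
  qed
  have sum0: "(\<Sum>i\<in>UNIV. N i $ a $ b) = 0" for a b
    using N by (metis sum_entry zero_index)
  show log: "log_form_on (range x) UNIV (frame_entry g (higgs P) a b)" for a b
    by (rule log_form_on_cong[OF _ eq log_form_on_log_form[OF x sum0]]) auto
  have "\<forall>\<^sub>F t in at 0. t * form_coeff (log_form x (\<lambda>i. N i $ a $ b)) (x i) t
      = t * form_coeff (frame_entry g (higgs P) a b) (x i) t" for a b i
    using eventually_loc_notin[of "range x" "x i"]
  proof (rule eventually_mono)
    fix t assume "loc (x i) t \<notin> range x"
    from form_coeff_eq[of "frame_entry g (higgs P) a b" _ _ "log_form x (\<lambda>i. N i $ a $ b)", OF eq[OF this]]
    show "t * form_coeff (log_form x (\<lambda>i. N i $ a $ b)) (x i) t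
      = t * form_coeff (frame_entry g (higgs P) a b) (x i) t" by simp
  qed simp
  from Lim_transform_eventually[OF log_form_residue[OF x sum0] this]
  show lim: "((\<lambda>t. t * form_coeff (frame_entry g (higgs P) a b) (x i) t) \<longlongrightarrow> N i $ a $ b) (at 0)" for a b i .
  show "res x P i = g (x i) ** N i ** matrix_inv (g (x i))" if "hol_bundle (bun P)"
    using P by (intro res_in_global_frame[OF that _ log lim]) (auto simp: in_frame_def)
qed

section \<open>Degrees of line subbundles of a trivial bundle\<close>

text \<open>Near \<open>p\<close> the section \<open>s\<close> is \<open>z^k\<close> times an invertible function times a generator of \<open>L\<close>.
  Cancelling \<open>z^k\<close> leaves a nonzero limit, and this limit spans the fibre of \<open>L\<close> at \<open>p\<close>.\<close>

lemma section_order_coords: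
  fixes E :: "'r::finite hbundle"
  assumes E: "hol_bundle E" and g: "hol_frame E UNIV g" and so: "section_order E L s p k"
    and s0: "\<forall>\<^sub>F z in at 0. s (loc p z) \<noteq> 0"
  obtains c where "c \<noteq> 0" "L p = vec.span {g p *v c}"
    "\<And>a. ((\<lambda>z. (matrix_inv (g (loc p z)) *v s (loc p z)) $ a * z powi (- k)) \<longlongrightarrow> c $ a) (at 0)"
proof -
  obtain V t m where V: "open V" "p \<in> V" and t: "generates E V t L"
    and s: "\<And>q. q \<in> V - {p} \<Longrightarrow> s q = m q *s t q"
    and m: "(\<lambda>z. m (loc p z)) meromorphic_on {0}" and k: "zorder (\<lambda>z. m (loc p z)) 0 = k"
    using so by (auto simp: section_order_def)
  let ?m = "\<lambda>z. m (loc p z)"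
  have inv: "invertible (g q)" for q using g by (simp add: hol_frame_def)
  have evs: "\<forall>\<^sub>F z in at 0. s (loc p z) = ?m z *s t (loc p z)"
    using eventually_loc_at[OF V] eventually_loc_notin[of "{p}" p]
    by (rule eventually_elim2[rotated 0]) (use s in auto)
  have "\<forall>\<^sub>F z in at 0. ?m z \<noteq> 0"
    using evs s0 by eventually_elim auto
  then have "\<exists>\<^sub>F z in at 0. ?m z \<noteq> 0"
    by (rule eventually_frequently[rotated]) simp
  from zorder_exist[OF meromorphic_on_isolated_singularity[OF m] meromorphic_on_not_essential[OF m] this]
  obtain h r where h: "h 0 \<noteq> 0" "0 < r" "h holomorphic_on cball 0 r"
    and mh: "\<And>w. w \<in> cball 0 r - {0} \<Longrightarrow> ?m w = h w * w powi k"
    using k by auto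
  have "h field_differentiable at 0"
    using holomorphic_on_imp_differentiable_at[of h "ball 0 r" 0] h(2)
      holomorphic_on_subset[OF h(3) ball_subset_cball] by simp
  from field_differentiable_imp_continuous_at[OF this] have hlim: "(h \<longlongrightarrow> h 0) (at 0)"
    by (simp add: continuous_at)
  have mlim: "((\<lambda>z. ?m z * z powi (- k)) \<longlongrightarrow> h 0) (at 0)"
  proof (rule Lim_transform_eventually[OF hlim])
    have "\<forall>\<^sub>F w in at 0. w \<in> ball 0 r - {0}"
      using h(2) by (intro eventually_at_in_open) auto
    then show "\<forall>\<^sub>F w in at 0. h w = ?m w * w powi (- k)"
    proof (rule eventually_mono)
      fix w :: complex assume w: "w \<in> ball 0 r - {0}"
      with mh[of w] show "h w = ?m w * w powi (- k)"
        by (simp add: power_int_minus)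
    qed
  qed
  have sec: "hol_section E V t" and t0: "t p \<noteq> 0" and L: "L p = vec.span {t p}"
    using t V by (auto simp: generates_def)
  define \<tau> where "\<tau> = (\<lambda>q. matrix_inv (g q) *v t q)"
  have "vec_hol \<tau> p"
    unfolding \<tau>_def using section_coords[OF E g open_UNIV sec] V by simp
  then have \<tau>lim: "((\<lambda>z. \<tau> (loc p z) $ a) \<longlongrightarrow> \<tau> p $ a) (at 0)" for a
    using hol_at_tendsto[of "\<lambda>q. \<tau> q $ a" p] by (simp add: vec_hol_def)
  have g\<tau>: "g p *v \<tau> p = t p" by (simp add: \<tau>_def matrix_cancel inv)
  show thesis
  proof (rule that[of "h 0 *s \<tau> p"])
    show "h 0 *s \<tau> p \<noteq> 0"
      using h(1) g\<tau> t0 by auto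
    show "L p = vec.span {g p *v (h 0 *s \<tau> p)}"
      using h(1) by (simp add: mult_smult g\<tau> L span1_scale)
    fix a
    have "((\<lambda>z. ?m z * z powi (- k) * \<tau> (loc p z) $ a) \<longlongrightarrow> h 0 * \<tau> p $ a) (at 0)"
      by (intro tendsto_mult mlim \<tau>lim)
    then have "((\<lambda>z. (matrix_inv (g (loc p z)) *v s (loc p z)) $ a * z powi (- k)) \<longlongrightarrow> h 0 * \<tau> p $ a) (at 0)"
      by (rule Lim_transform_eventually)
        (use evs in eventually_elim, simp add: mult_smult \<tau>_def)
    then show "((\<lambda>z. (matrix_inv (g (loc p z)) *v s (loc p z)) $ a * z powi (- k)) \<longlongrightarrow> (h 0 *s \<tau> p) $ a) (at 0)"
      by simp
  qed
qed

lemma eventually_loc_nonzero: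
  assumes "finite F" "\<And>q. q \<notin> F \<Longrightarrow> s q \<noteq> 0"
  shows "\<forall>\<^sub>F z in at 0. s (loc p z) \<noteq> 0"
  using eventually_loc_notin[OF assms(1), of p] by (rule eventually_mono) (rule assms(2))

lemma obtain_affine_point:
  assumes "finite F"
  obtains z where "Aff z \<notin> F"
proof -
  have "\<exists>z. z \<notin> {z. Aff z \<in> F}"
    using finite_Aff[OF assms] by (rule ex_new_if_finite[OF infinite_UNIV_char_0])
  with that show thesis by auto
qed

lemma line_degreeE:
  assumes "line_degree E L d"
  obtains F s k where "finite F" "hol_section E (- F) s"
    "\<And>p. p \<notin> F \<Longrightarrow> s p \<in> L p \<and> s p \<noteq> 0"
    "\<And>p. p \<in> F \<Longrightarrow> section_order E L s p (k p)" "d = (\<Sum>p\<in>F. k p)"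
proof -
  obtain F s k where *: "finite F" "hol_section E (- F) s"
    "\<forall>p\<in>- F. s p \<in> L p \<and> s p \<noteq> 0" "\<forall>p\<in>F. section_order E L s p (k p)" "d = (\<Sum>p\<in>F. k p)"
    using assms unfolding line_degree_def by blast
  show thesis
    by (rule that[of F s k]) (use * in auto)
qed

text \<open>The components of a meromorphic section of \<open>L\<close> have order at least \<open>k p\<close> at each point \<open>p\<close>. If
  the degree is not negative, both are multiples of the same rational function, so the section has a
  constant direction \<open>c\<close>, and by continuity \<open>c\<close> spans \<open>L\<close> at the remaining points too. A positive
  degree would make the section vanish identically.\<close>

lemma line_degree_nonneg_constant:
  fixes E :: "2 hbundle"
  assumes E: "hol_bundle E" and g: "hol_frame E UNIV g" and L: "line_subbundle E L"
    and d: "line_degree E L d" "0 \<le> d"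
  obtains c where "d = 0" "c \<noteq> 0" "\<And>p. L p = vec.span {g p *v c}"
proof -
  obtain F s k where F: "finite F" and s: "hol_section E (- F) s"
    and sL: "\<And>p. p \<notin> F \<Longrightarrow> s p \<in> L p \<and> s p \<noteq> 0"
    and so: "\<And>p. p \<in> F \<Longrightarrow> section_order E L s p (k p)" and dk: "d = (\<Sum>p\<in>F. k p)"
    by (rule line_degreeE[OF d(1)]) (rule that)
  have inv: "invertible (g q)" for q using g by (simp add: hol_frame_def)
  define m where "m = (\<lambda>q. matrix_inv (g q) *v s q)"
  have gm: "g q *v m q = s q" for q by (simp add: m_def matrix_cancel inv)
  have mhol: "vec_hol m p" if "p \<notin> F" for p
    unfolding m_def using section_coords[OF E g open_UNIV s] that by simp
  have ex: "\<exists>c. c \<noteq> 0 \<and> L p = vec.span {g p *v c} \<and>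
      (\<forall>a. ((\<lambda>z. m (loc p z) $ a * z powi (- (if p \<in> F then k p else 0))) \<longlongrightarrow> c $ a) (at 0))" for p
  proof (cases "p \<in> F")
    case True
    have "\<forall>\<^sub>F z in at 0. s (loc p z) \<noteq> 0"
      using eventually_loc_nonzero[OF F] sL by blast
    then obtain c where "c \<noteq> 0" "L p = vec.span {g p *v c}"
      "\<And>a. ((\<lambda>z. (matrix_inv (g (loc p z)) *v s (loc p z)) $ a * z powi (- k p)) \<longlongrightarrow> c $ a) (at 0)"
      by (rule section_order_coords[OF E g so[OF True]]) blast
    with True show ?thesis
      by (intro exI[of _ c]) (simp add: m_def)
  next
    case False
    obtain V t where "p \<in> V" "generates E V t L"
      using L unfolding line_subbundle_def by blast
    then have "L p = vec.span {t p}" by (auto simp: generates_def)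
    then have "L p = vec.span {s p}"
      using sL[OF False] span1_eqI by blast
    moreover have "m p \<noteq> 0"
      using gm[of p] sL[OF False] by auto
    moreover have "((\<lambda>z. m (loc p z) $ a) \<longlongrightarrow> m p $ a) (at 0)" for a
      using mhol[OF False] hol_at_tendsto[of "\<lambda>q. m q $ a" p] by (simp add: vec_hol_def)
    ultimately show ?thesis
      using False gm[of p] by (intro exI[of _ "m p"]) simp
  qed
  define R where "R = (\<lambda>z. \<Prod>w | Aff w \<in> F. (z - w) powi k (Aff w))"
  have "\<exists>c. (\<forall>z. Aff z \<notin> F \<longrightarrow> m (Aff z) $ a = c * R z) \<and> (0 < d \<longrightarrow> c = 0)" for a
  proof -
    have 1: "hol_on (\<lambda>q. m q $ a) (- F)"
      using mhol by (simp add: hol_on_iff vec_hol_def)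
    have 2: "\<exists>c. ((\<lambda>t. m (loc p t) $ a * t powi (- k p)) \<longlongrightarrow> c) (at 0)" if "p \<in> F" for p
      using ex[of p] that by auto
    have 3: "0 \<le> sum k F" using d(2) dk by simp
    obtain c where "\<And>z. Aff z \<notin> F \<Longrightarrow> m (Aff z) $ a = c * R z" "0 < sum k F \<Longrightarrow> c = 0"
      using meromorphic_order_sum_nonneg[OF F 1 2 3] unfolding R_def by blast
    with dk show ?thesis by blast
  qed
  then have "\<exists>\<kappa>. \<forall>a. (\<forall>z. Aff z \<notin> F \<longrightarrow> m (Aff z) $ a = \<kappa> a * R z) \<and> (0 < d \<longrightarrow> \<kappa> a = 0)"
    by (intro choice allI)
  then obtain \<kappa> where \<kappa>: "\<And>a z. Aff z \<notin> F \<Longrightarrow> m (Aff z) $ a = \<kappa> a * R z" "\<And>a. 0 < d \<Longrightarrow> \<kappa> a = 0"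
    by auto
  define c where "c = (\<chi> a. \<kappa> a)"
  have mc: "m (Aff z) = R z *s c" if "Aff z \<notin> F" for z
    using \<kappa>(1)[OF that] by (simp add: vec_eq_iff c_def)
  obtain z0 where z0: "Aff z0 \<notin> F" using obtain_affine_point[OF F] .
  have c0: "c \<noteq> 0"
    using sL[OF z0] gm[of "Aff z0"] mc[OF z0] by auto
  have "d = 0"
  proof (rule ccontr)
    assume "d \<noteq> 0"
    with d(2) have "0 < d" by simp
    with c0 \<kappa>(2) show False by (simp add: c_def vec_eq_iff)
  qed
  moreover have "L p = vec.span {g p *v c}" for p
  proof -
    obtain c' where c': "c' \<noteq> 0" "L p = vec.span {g p *v c'}"
      and lim: "\<And>a. ((\<lambda>z. m (loc p z) $ a * z powi (- (if p \<in> F then k p else 0))) \<longlongrightarrow> c' $ a) (at 0)"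
      using ex[of p] by blast
    let ?n = "\<lambda>z a. m (loc p z) $ a * z powi (- (if p \<in> F then k p else 0))"
    have "((\<lambda>z. ?n z 1 * c $ 2 - ?n z 2 * c $ 1) \<longlongrightarrow> c' $ 1 * c $ 2 - c' $ 2 * c $ 1) (at 0)"
      by (intro tendsto_intros lim)
    moreover have "((\<lambda>z. ?n z 1 * c $ 2 - ?n z 2 * c $ 1) \<longlongrightarrow> 0) (at 0)"
    proof (intro tendsto_eventually, rule eventually_mono)
      show "\<forall>\<^sub>F z in at 0. loc p z \<notin> insert Infty F"
        using F by (intro eventually_loc_notin) simp
      fix z assume "loc p z \<notin> insert Infty F"
      then obtain w where "loc p z = Aff w" "Aff w \<notin> F" by (cases "loc p z") auto
      then show "?n z 1 * c $ 2 - ?n z 2 * c $ 1 = 0"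
        using mc by simp
    qed
    ultimately have "c' $ 1 * c $ 2 - c' $ 2 * c $ 1 = 0"
      by (rule tendsto_unique[rotated]) simp
    then have "det2 c' c = 0" by (simp add: det2_def)
    then have "c' \<in> vec.span {c}" using det2_eq_0[OF c0] by simp
    then have "vec.span {c'} = vec.span {c}" using c'(1) by (rule span1_eqI)
    with c'(2) image_span1[of "g p" c'] image_span1[of "g p" c] show ?thesis by simp
  qed
  ultimately show thesis
    using that c0 by blast
qed

text \<open>The reciprocal of the coefficient of a meromorphic section has the opposite orders, so it would
  vanish identically if the degree were negative.\<close>

lemma line_degree_rank1_nonneg:
  fixes E :: "1 hbundle"
  assumes E: "hol_bundle E" and g: "hol_frame E UNIV g" and d: "line_degree E L d"
  shows "0 \<le> d"
proof (rule ccontr)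
  assume neg: "\<not> 0 \<le> d"
  obtain F s k where F: "finite F" and s: "hol_section E (- F) s"
    and sL: "\<And>p. p \<notin> F \<Longrightarrow> s p \<in> L p \<and> s p \<noteq> 0"
    and so: "\<And>p. p \<in> F \<Longrightarrow> section_order E L s p (k p)" and dk: "d = (\<Sum>p\<in>F. k p)"
    by (rule line_degreeE[OF d]) (rule that)
  have inv: "invertible (g q)" for q using g by (simp add: hol_frame_def)
  define m where "m = (\<lambda>q. (matrix_inv (g q) *v s q) $ 1)"
  have m0: "m q \<noteq> 0" if "q \<notin> F" for q
  proof
    assume "m q = 0"
    then have "matrix_inv (g q) *v s q = 0" by (simp add: m_def vec_eq_iff forall_1)
    then have "s q = 0" using matrix_cancel(3)[OF inv, of q "s q"] by simp
    with sL[OF that] show False by simp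
  qed
  have mhol: "hol_at m p" if "p \<notin> F" for p
    using section_coords[OF E g open_UNIV s] that by (simp add: m_def vec_hol_def)
  have hol: "hol_on (\<lambda>q. 1 / m q) (- F)"
    using mhol m0 by (auto simp: hol_on_iff intro!: hol_at_divide)
  have lim: "\<exists>c. ((\<lambda>t. 1 / m (loc p t) * t powi (- (- k p))) \<longlongrightarrow> c) (at 0)" if p: "p \<in> F" for p
  proof -
    have "\<forall>\<^sub>F z in at 0. s (loc p z) \<noteq> 0"
      using eventually_loc_nonzero[OF F] sL by blast
    then obtain c where c: "c \<noteq> 0" "L p = vec.span {g p *v c}"
        "\<And>a. ((\<lambda>z. (matrix_inv (g (loc p z)) *v s (loc p z)) $ a * z powi (- k p)) \<longlongrightarrow> c $ a) (at 0)"
      by (rule section_order_coords[OF E g so[OF p]]) blast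
    have "c $ 1 \<noteq> 0" using c(1) by (simp add: vec_eq_iff forall_1)
    from tendsto_divide[OF tendsto_const c(3)[of 1] this, of 1]
    have "((\<lambda>t. 1 / (m (loc p t) * t powi (- k p))) \<longlongrightarrow> 1 / c $ 1) (at 0)"
      by (simp add: m_def)
    then show ?thesis
      by (intro exI[of _ "1 / c $ 1"]) (simp add: power_int_minus divide_inverse)
  qed
  have K: "(\<Sum>p\<in>F. - k p) = - d" by (simp add: dk sum_negf)
  obtain c where c: "\<And>z. Aff z \<notin> F \<Longrightarrow> 1 / m (Aff z) = c * (\<Prod>w | Aff w \<in> F. (z - w) powi (- k (Aff w)))"
    and c0: "0 < (\<Sum>p\<in>F. - k p) \<Longrightarrow> c = 0"
    using meromorphic_order_sum_nonneg[OF F hol lim] neg K by auto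
  obtain z where z: "Aff z \<notin> F" using obtain_affine_point[OF F] .
  from c[OF z] c0 neg K m0[OF z] show False by simp
qed

section \<open>Objects of the moduli space as systems of residues\<close>

lemma mat_mult: "mat a ** mat b = (mat (a * b) :: complex ^ 'r::finite ^ 'r)"
  by (simp add: vec_eq_iff matrix_matrix_mult_def mat_def if_distrib[of "\<lambda>x. x * _"] cong: if_cong)

lemma invertible_mat_scalar: "a \<noteq> 0 \<Longrightarrow> invertible (mat a :: complex ^ 'r::finite ^ 'r)"
  unfolding invertible_right_inverse by (rule exI[of _ "mat (1 / a)"]) (simp add: mat_mult)

lemma matrix_inv_mat: "a \<noteq> 0 \<Longrightarrow> matrix_inv (mat a :: complex ^ 'r::finite ^ 'r) = mat (1 / a)"
  by (rule matrix_inv_eqI) (simp add: mat_mult)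

lemma det_matrix_inv:
  fixes A :: "complex ^ 'r::finite ^ 'r"
  assumes "invertible A"
  shows "det (matrix_inv A) = 1 / det A"
proof -
  have "det A * det (matrix_inv A) = 1"
    by (simp add: matrix_inv_both[OF assms] flip: det_mul)
  moreover have "det A \<noteq> 0" using assms by (simp add: invertible_det_nz)
  ultimately show ?thesis by (simp add: eq_divide_eq mult.commute)
qed

text \<open>The transition functions of the determinant bundle are the determinants of the transition
  matrices.\<close>

lemma det_bundle_frame:
  fixes E :: "'r::finite hbundle"
  assumes E: "hol_bundle E" and g: "hol_frame E U g"
  shows "hol_frame (det_bundle E) U (\<lambda>p. mat (det (g p)))"
  unfolding hol_frame_iff
proof (intro conjI ballI, goal_cases)
  case (1 p)
  with g have "det (g p) \<noteq> 0" by (simp add: hol_frame_def invertible_det_nz)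
  then show ?case by (rule invertible_mat_scalar)
next
  case (2 VF)
  then obtain V f where VF: "VF = (V, \<lambda>p. mat (det (f p)))" and V: "(V, f) \<in> E"
    by (auto simp: det_bundle_def)
  have f: "open V" "hol_frame E V f" using E V by (auto simp: hol_bundle_def)
  have "mat_hol (\<lambda>q. matrix_inv (mat (det (f q))) ** mat (det (g q)) :: complex ^ 1 ^ 1) p"
    if p: "p \<in> U" "p \<in> V" for p
  proof (rule mat_hol_cong[OF f(1) p(2), THEN iffD2])
    have "hol_at (\<lambda>q. det (matrix_inv (f q) ** g q)) p"
      using hol_at_det[OF hol_frame_coords[OF g V p]] .
    then show "mat_hol (\<lambda>q. mat (det (matrix_inv (f q) ** g q)) :: complex ^ 1 ^ 1) p"
      by (simp add: mat_hol_def mat_def)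
    fix q assume "q \<in> V"
    then have inv: "invertible (f q)" using f(2) by (simp add: hol_frame_def)
    then show "matrix_inv (mat (det (f q))) ** mat (det (g q)) =
        (mat (det (matrix_inv (f q) ** g q)) :: complex ^ 1 ^ 1)"
      by (simp add: matrix_inv_mat invertible_det_nz[symmetric] mat_mult det_mul det_matrix_inv)
  qed
  with VF show ?case by simp
qed

lemma hol_bundle_det:
  assumes "hol_bundle E"
  shows "hol_bundle (det_bundle E)"
proof -
  have "\<forall>(V, F)\<in>det_bundle E. open V \<and> hol_frame (det_bundle E) V F"
    using assms det_bundle_frame[OF assms] by (auto simp: hol_bundle_def det_bundle_def)
  moreover have "(\<Union>(V, F)\<in>det_bundle E. V) = UNIV"
    using assms by (auto simp: hol_bundle_def det_bundle_def)
  ultimately show ?thesis by (simp add: hol_bundle_def)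
qed

lemma log_form_on_local:
  "(\<And>p. \<exists>V. p \<in> V \<and> log_form_on D V a) \<Longrightarrow> log_form_on D UNIV a"
  unfolding log_form_on_def by blast

lemma matrix_vector_sum: "(\<Sum>i\<in>I. N i) *v v = (\<Sum>i\<in>I. N i *v v)" for N :: "'i \<Rightarrow> complex ^ 'r::finite ^ 's::finite"
  by (induction I rule: infinite_finite_induct) (auto simp: matrix_vector_mult_add_rdistrib)

lemma det2_sum: "det2 (\<Sum>i\<in>I. f i) c = (\<Sum>i\<in>I. det2 (f i) c)"
  by (simp add: det2_def sum_distrib_right sum_subtractf)

text \<open>A constant line preserved by the Higgs field is preserved by its residues, since
  \<open>det2 (N_i c) c\<close> is the residue of a form that vanishes at all unmarked points. A nilpotent matrix
  kills every line that it preserves.\<close>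

lemma preserved_kernel:
  assumes x: "inj x" and P: "in_frame x P g N" and N: "(\<Sum>i\<in>UNIV. N i) = 0" "N i ** N i = 0"
    and L: "\<And>p. L p = vec.span {g p *v c}" "c \<noteq> 0" and pres: "preserved x P L"
  shows "N i *v c = 0"
proof -
  have inv: "invertible (g p)" for p using P by (auto simp: in_frame_def hol_frame_def)
  have "det2 (N i *v c) c = 0"
  proof (rule log_form_eq_0D[OF x])
    show "(\<Sum>i\<in>UNIV. det2 (N i *v c) c) = 0"
      unfolding det2_sum[symmetric] matrix_vector_sum[symmetric] N(1) by (simp add: det2_def)
    fix p assume p: "p \<notin> range x"
    have "higgs P p *v (g p *v c) \<in> L p"
      using pres p L(1) by (auto simp: preserved_def vec.span_base)
    then have "higgs P p *v (g p *v c) \<in> vec.span {g p *v c}" by (simp add: L(1))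
    moreover have "higgs P p *v (g p *v c) = g p *v (log_matrix x N p *v c)"
      using P p by (simp add: in_frame_def matrix_vector_mul_assoc[symmetric] matrix_cancel inv)
    ultimately obtain k where "g p *v (log_matrix x N p *v c) = g p *v (k *s c)"
      by (auto simp: in_span1 mult_smult)
    from arg_cong[OF this, of "(*v) (matrix_inv (g p))"] have "log_matrix x N p *v c = k *s c"
      by (simp add: matrix_cancel inv)
    then have "det2 (log_matrix x N p *v c) c = 0"
      by (simp add: det2_def)
    then have "(c $ 2 * log_form x (\<lambda>i. (N i *v c) $ 1) p) + (- c $ 1) * log_form x (\<lambda>i. (N i *v c) $ 2) p = 0"
      by (simp add: det2_def log_matrix_vector mult.commute)
    then have "log_form x (\<lambda>i. c $ 2 * (N i *v c) $ 1 + (- c $ 1) * (N i *v c) $ 2) p = 0"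
      unfolding log_form_add log_form_cmult .
    then show "log_form x (\<lambda>i. det2 (N i *v c) c) p = 0"
      by (simp add: det2_def mult.commute)
  qed
  then obtain k where k: "N i *v c = k *s c"
    using det2_eq_0[OF L(2)] by (auto simp: in_span1)
  have "N i *v (N i *v c) = 0"
    by (simp add: matrix_vector_mul_assoc N(2))
  then have "(k * k) *s c = 0"
    unfolding k mult_smult by simp
  with L(2) have "k = 0" by simp
  with k show ?thesis by simp
qed

lemma preserved_constant_line:
  assumes x: "inj x" and P: "in_frame x P g N"
    and ker: "\<And>i. N i *v c = 0" and L: "\<And>p. L p = vec.span {g p *v c}"
  shows "preserved x P L"
  unfolding preserved_def
proof (intro allI impI ballI)
  fix p v assume p: "p \<notin> range x" and "v \<in> L p"
  then obtain k where v: "v = k *s (g p *v c)" by (auto simp: L in_span1)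
  have inv: "invertible (g p)" using P by (auto simp: in_frame_def hol_frame_def)
  have "log_matrix x N p *v c = 0"
    by (simp add: vec_eq_iff log_matrix_vector ker)
  then have "higgs P p *v v = 0"
    using P p by (simp add: v mult_smult in_frame_def matrix_vector_mul_assoc[symmetric] matrix_cancel inv)
  then show "higgs P p *v v \<in> L p" by (simp add: L vec.span_zero)
qed

lemma constant_line_subbundle:
  assumes E: "hol_bundle E" and g: "hol_frame E UNIV g" and c: "c \<noteq> 0"
    and L: "\<And>p. L p = vec.span {g p *v c}"
  shows "generates E UNIV (\<lambda>p. g p *v c) L"
proof -
  have "g p *v c \<noteq> 0" for p
    using c g matrix_cancel(4)[of "g p" c] by (auto simp: hol_frame_def)
  moreover have "hol_section E UNIV (\<lambda>p. g p *v c)"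
    by (rule hol_section_from_coords[OF E g]) auto
  ultimately show ?thesis by (simp add: generates_def L)
qed

lemma generates_UNIV:
  assumes "generates E UNIV s L"
  shows "line_subbundle E L" "line_degree E L 0"
proof -
  show "line_subbundle E L"
    unfolding line_subbundle_def
    by (intro allI exI[of _ UNIV] exI[of _ s]) (simp add: assms)
  show "line_degree E L 0"
    unfolding line_degree_def
    by (rule exI[of _ "{}"], rule exI[of _ s])
       (use assms in \<open>auto simp: generates_def vec.span_base\<close>)
qed

text \<open>If all residues had the same image, this line would give a preserved line subbundle of degree 0
  that contains all flags. Its slope \<open>n/2\<close> would equal that of the bundle.\<close>

lemma stable_kernels_distinct:
  assumes x: "inj x" and E: "hol_bundle (bun P)" and tr: "trivial_bundle (det_bundle (bun P))"
    and st: "stable x P" and P: "in_frame x P g N"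
    and N: "\<And>i. N i \<noteq> 0" "\<And>i. N i ** N i = 0"
  shows "\<exists>i j. range ((*v) (N i)) \<noteq> range ((*v) (N j))"
proof (rule ccontr)
  assume "\<not> ?thesis"
  then have same: "range ((*v) (N i)) = range ((*v) (N j))" for i j by blast
  fix i0
  obtain c where c: "c \<noteq> 0" "range ((*v) (N i0)) = vec.span {c}"
    by (rule nilpotent2_kernel[OF N(2)[of i0] N(1)[of i0]]) (rule that)
  have ran: "range ((*v) (N i)) = vec.span {c}" for i
    using same c(2) by blast
  have ker: "N i *v c = 0" for i
  proof -
    have "c \<in> range ((*v) (N i))" by (simp add: ran vec.span_base)
    then obtain v where "c = N i *v v" by blast
    then show ?thesis by (simp add: matrix_vector_mul_assoc N(2))
  qed
  have g: "hol_frame (bun P) UNIV g" using P by (simp add: in_frame_def)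
  define L where "L = (\<lambda>p. vec.span {g p *v c})"
  have gen: "generates (bun P) UNIV (\<lambda>p. g p *v c) L"
    by (rule constant_line_subbundle[OF E g c(1)]) (simp add: L_def)
  have pres: "preserved x P L"
    by (rule preserved_constant_line[OF x P ker]) (simp add: L_def)
  obtain h where h: "hol_frame (det_bundle (bun P)) UNIV h"
    using tr by (auto simp: trivial_bundle_def)
  have "UNIV = vec.span {h p *v axis 1 1}" for p
  proof -
    have inv: "invertible (h p)" using h by (simp add: hol_frame_def)
    have "v \<in> vec.span {h p *v axis 1 1}" for v
    proof -
      have "matrix_inv (h p) *v v = ((matrix_inv (h p) *v v) $ 1) *s axis 1 1"
        by (simp add: vec_eq_iff axis_def forall_1)
      from arg_cong[OF this, of "(*v) (h p)"]
      have "v = ((matrix_inv (h p) *v v) $ 1) *s (h p *v axis 1 1)"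
        by (simp add: mult_smult matrix_cancel inv)
      then show ?thesis unfolding in_span1 by blast
    qed
    then show ?thesis by blast
  qed
  from constant_line_subbundle[OF hol_bundle_det[OF E] h _ this]
  have "bundle_degree (bun P) 0"
    unfolding bundle_degree_def by (rule generates_UNIV(2)[rotated]) (simp add: axis_eq_0_iff)
  then have "qp_slope_bundle P 0 > qp_slope_line x P L 0"
    using st generates_UNIV[OF gen] pres unfolding stable_def by blast
  moreover have "L (x i) \<inter> flag P i \<noteq> {0}" for i
  proof -
    have "flag P i = (\<lambda>v. g (x i) *v v) ` range ((*v) (N i))"
      using P by (auto simp: in_frame_def)
    then have "flag P i = L (x i)"
      by (simp add: ran image_span1 L_def)
    moreover have "g (x i) *v c \<noteq> 0" "g (x i) *v c \<in> L (x i)"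
      using gen by (auto simp: generates_def L_def vec.span_base)
    ultimately show ?thesis by blast
  qed
  ultimately show False
    by (simp add: qp_slope_bundle_def qp_slope_line_def)
qed

text \<open>The entries of the Higgs field in a global frame are logarithmic forms, hence partial fractions
  in its residues. The conditions on residues and flags make every residue square to zero and its image
  fill the flag line.\<close>

theorem H0_object_in_frame:
  fixes x :: "'n::finite \<Rightarrow> cp1"
  assumes x: "inj x" and P: "P \<in> H0_objects x"
  obtains g N where "in_frame x P g N" "stable_residues N"
proof -
  have E: "hol_bundle (bun P)" and q: "quasi_parabolic_higgs x P" and st: "stable x P"
    and tr: "trivial_bundle (det_bundle (bun P))"
    using P by (auto simp: H0_objects_def sl2c_higgs_def quasi_parabolic_higgs_def)
  obtain g where g: "hol_frame (bun P) UNIV g"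
    using P by (auto simp: H0_objects_def trivial_bundle_def)
  have inv: "invertible (g p)" for p using g by (simp add: hol_frame_def)
  have log: "log_form_on (range x) UNIV (frame_entry g (higgs P) a b)" for a b
  proof (rule log_form_on_local)
    fix p
    obtain V f where V: "(V, f) \<in> bun P" "p \<in> V" "open V" "hol_frame (bun P) V f"
      using bundle_chart[OF E] .
    have "log_form_on (range x) V (frame_entry f (higgs P) c d)" for c d
      using q V(1) by (auto simp: quasi_parabolic_higgs_def)
    from log_form_on_frame_change[OF E V(4,3) g open_UNIV this] V(2)
    show "\<exists>V. p \<in> V \<and> log_form_on (range x) V (frame_entry g (higgs P) a b)" by auto
  qed
  then have "\<exists>l. ((\<lambda>t. t * form_coeff (frame_entry g (higgs P) a b) (x i) t) \<longlongrightarrow> l) (at 0)" for i a b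
    by (auto simp: log_form_on_def)
  note lim_ex = this
  define n where "n = (\<lambda>i a b. SOME l. ((\<lambda>t. t * form_coeff (frame_entry g (higgs P) a b) (x i) t) \<longlongrightarrow> l) (at 0))"
  have n: "((\<lambda>t. t * form_coeff (frame_entry g (higgs P) a b) (x i) t) \<longlongrightarrow> n i a b) (at 0)" for i a b
    unfolding n_def by (rule someI_ex) (rule lim_ex)
  define N where "N = (\<lambda>i. \<chi> a b. n i a b)"
  have N: "((\<lambda>t. t * form_coeff (frame_entry g (higgs P) a b) (x i) t) \<longlongrightarrow> N i $ a $ b) (at 0)" for i a b
    using n by (simp add: N_def)
  have sumN: "(\<Sum>i\<in>UNIV. N i) = 0"
    using log_form_partial_fractions(1)[OF x log N] by (simp add: vec_eq_iff)
  have higgs: "higgs P p = g p ** log_matrix x N p ** matrix_inv (g p)" if "p \<notin> range x" for p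
  proof -
    have "matrix_inv (g p) ** higgs P p ** g p = log_matrix x N p"
      using log_form_partial_fractions(2)[OF x log N that]
      by (simp add: frame_entry_def log_matrix_def vec_eq_iff)
    from this[symmetric] show ?thesis
      by (simp add: matrix_mul_assoc[symmetric] matrix_cancel inv matrix_inv_both)
  qed
  have res: "res x P i = g (x i) ** N i ** matrix_inv (g (x i))" for i
    by (rule res_in_global_frame[OF E g log N])
  have res_v: "res x P i *v (g (x i) *v v) = g (x i) *v (N i *v v)" for i v
    by (simp add: res matrix_vector_mul_assoc[symmetric] matrix_cancel inv)
  have into: "res x P i *v v \<in> flag P i" and kills: "v \<in> flag P i \<Longrightarrow> res x P i *v v = 0"
    and line: "is_line (flag P i)" for i v
    using q by (auto simp: quasi_parabolic_higgs_def)
  have N0: "N i \<noteq> 0" for i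
    using st res[of i] by (auto simp: stable_def)
  have NN: "N i ** N i = 0" for i
  proof -
    have "(N i ** N i) *v v = 0" for v
    proof -
      have "g (x i) *v (N i *v (N i *v v)) = 0"
        using kills[OF into, of i "g (x i) *v v"] by (simp add: res_v)
      then show ?thesis
        using matrix_cancel(4)[OF inv, of "x i" "N i *v (N i *v v)"] by (simp add: matrix_vector_mul_assoc)
    qed
    then show ?thesis by (simp add: matrix_eq)
  qed
  have flag: "flag P i = range (\<lambda>v. g (x i) *v (N i *v v))" for i
  proof -
    obtain w where w: "w \<noteq> 0" "flag P i = vec.span {w}" using line by (auto simp: is_line_iff)
    obtain u where u: "u \<noteq> 0" "range ((*v) (N i)) = vec.span {u}"
      by (rule nilpotent2_kernel[OF NN[of i] N0[of i]]) (rule that)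
    have ran: "range (\<lambda>v. g (x i) *v (N i *v v)) = vec.span {g (x i) *v u}"
      using u(2) image_span1[of "g (x i)" u] by (simp add: image_image flip: u(2))
    have "g (x i) *v u \<noteq> 0"
      using u(1) matrix_cancel(4)[OF inv, of "x i" u] by auto
    moreover have "g (x i) *v u \<in> vec.span {w}"
    proof -
      have "g (x i) *v u \<in> range (\<lambda>v. g (x i) *v (N i *v v))" unfolding ran by (simp add: vec.span_base)
      then obtain v where "g (x i) *v u = res x P i *v (g (x i) *v v)" by (auto simp: res_v)
      then show ?thesis using into[of i "g (x i) *v v"] w(2) by simp
    qed
    ultimately have "vec.span {g (x i) *v u} = vec.span {w}"
      by (rule span1_eqI[rotated])
    with ran w(2) show ?thesis by simp
  qed
  have fr: "in_frame x P g N"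
    using g flag higgs by (simp add: in_frame_def)
  moreover have "stable_residues N"
    using N0 NN sumN stable_kernels_distinct[OF x E tr st fr N0 NN] by (simp add: stable_residues_def)
  ultimately show thesis by (rule that)
qed

text \<open>Stability holds for the following reason. A preserved line subbundle of nonnegative degree would be
  a constant line in the kernel of every residue, but these kernels are not all equal. One of degree at
  most \<open>-1\<close> has slope at most \<open>n/2 - 1\<close>.\<close>

theorem H0_objectI:
  fixes x :: "'n::finite \<Rightarrow> cp1"
  assumes x: "inj x" and E: "hol_bundle (bun P)" and P: "in_frame x P g N" and N: "stable_residues N"
  shows "P \<in> H0_objects x"
proof -
  have sumN: "(\<Sum>i\<in>UNIV. N i) = 0" and N0: "N i \<noteq> 0" and NN: "N i ** N i = 0" for i
    using N by (auto simp: stable_residues_def)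
  have g: "hol_frame (bun P) UNIV g" using P by (simp add: in_frame_def)
  have inv: "invertible (g p)" for p using g by (simp add: hol_frame_def)
  have res: "res x P i = g (x i) ** N i ** matrix_inv (g (x i))" for i
    by (rule in_frame_res[OF x P sumN E])
  have flag: "flag P i = range (\<lambda>v. g (x i) *v (N i *v v))" for i
    using P by (simp add: in_frame_def)
  have line: "is_line (flag P i)" for i
  proof -
    obtain u where u: "u \<noteq> 0" "range ((*v) (N i)) = vec.span {u}"
      by (rule nilpotent2_kernel[OF NN[of i] N0[of i]]) (rule that)
    have "flag P i = vec.span {g (x i) *v u}"
      using image_span1[of "g (x i)" u] flag by (simp add: image_image flip: u(2))
    moreover have "g (x i) *v u \<noteq> 0"
      using u(1) matrix_cancel(4)[OF inv, of "x i" u] by auto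
    ultimately show ?thesis unfolding is_line_iff by blast
  qed
  have into: "res x P i *v v \<in> flag P i" for i v
  proof -
    have "res x P i *v v = g (x i) *v (N i *v (matrix_inv (g (x i)) *v v))"
      by (simp add: res matrix_vector_mul_assoc matrix_mul_assoc)
    then show ?thesis by (auto simp: flag)
  qed
  have kills: "res x P i *v v = 0" if "v \<in> flag P i" for i v
  proof -
    from that obtain u where "v = g (x i) *v (N i *v u)" by (auto simp: flag)
    then have "res x P i *v v = g (x i) *v ((N i ** N i) *v u)"
      by (simp add: res matrix_vector_mul_assoc[symmetric] matrix_cancel inv)
    then show ?thesis by (simp add: NN)
  qed
  have log: "log_form_on (range x) V (frame_entry f (higgs P) a b)" if V: "(V, f) \<in> bun P" for V f a b
  proof -
    have "open V" "hol_frame (bun P) V f" using E V by (auto simp: hol_bundle_def)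
    from log_form_on_frame_change[OF E g open_UNIV this(2,1) in_frame_log[OF x P sumN]]
    show ?thesis by simp
  qed
  have trace: "trace (higgs P p) = 0" if "p \<notin> range x" for p
  proof -
    have "trace (higgs P p) = trace (g p ** (log_matrix x N p ** matrix_inv (g p)))"
      using P that by (simp add: in_frame_def matrix_mul_assoc)
    also have "\<dots> = trace (log_matrix x N p)"
      by (subst trace_mul_sym) (simp add: matrix_mul_assoc[symmetric] matrix_inv_both inv)
    also have "\<dots> = log_form x (\<lambda>i. N i $ 1 $ 1 + N i $ 2 $ 2) p"
      by (simp add: trace_def sum_2 log_matrix_def log_form_add)
    also have "\<dots> = 0"
      using NN by (simp add: nilpotent2_entries)
    finally show ?thesis .
  qed
  have st: "stable x P"
    unfolding stable_def
  proof (intro conjI allI impI)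
    fix i show "res x P i \<noteq> 0"
    proof
      assume "res x P i = 0"
      then have "matrix_inv (g (x i)) ** (res x P i ** g (x i)) = 0" by simp
      then show False using N0[of i]
        by (simp add: res matrix_mul_assoc[symmetric] matrix_cancel inv matrix_inv_both)
    qed
  next
    fix L d e
    assume *: "line_subbundle (bun P) L \<and> preserved x P L \<and> line_degree (bun P) L d \<and> bundle_degree (bun P) e"
    have e: "0 \<le> e"
      using line_degree_rank1_nonneg[OF hol_bundle_det[OF E] det_bundle_frame[OF E g]] *
      unfolding bundle_degree_def by blast
    have "\<not> 0 \<le> d"
    proof
      assume "0 \<le> d"
      then obtain c where c: "c \<noteq> 0" "\<And>p. L p = vec.span {g p *v c}"
        using line_degree_nonneg_constant[OF E g] * by blast
      have "range ((*v) (N i)) = vec.span {c}" for i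
      proof -
        have ker: "N i *v c = 0"
          by (rule preserved_kernel[OF x P sumN NN c(2,1)]) (use * in simp)
        obtain u where u: "u \<noteq> 0" "range ((*v) (N i)) = vec.span {u}" "\<And>v. N i *v v = 0 \<longleftrightarrow> v \<in> vec.span {u}"
          by (rule nilpotent2_kernel[OF NN[of i] N0[of i]]) (rule that)
        with ker have "c \<in> vec.span {u}" by blast
        from span1_eqI[OF this c(1)] u(2) show ?thesis by simp
      qed
      with N show False by (simp add: stable_residues_def)
    qed
    moreover have "card {i. L (x i) \<inter> flag P i \<noteq> {0}} \<le> CARD('n)"
      by (rule card_mono) auto
    ultimately show "qp_slope_line x P L d < qp_slope_bundle P e"
      using e by (simp add: qp_slope_line_def qp_slope_bundle_def)
  qed
  have "trivial_bundle (bun P)" "trivial_bundle (det_bundle (bun P))"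
    using g det_bundle_frame[OF E g] by (auto simp: trivial_bundle_def)
  with st trace log into kills line E show ?thesis
    by (auto simp: H0_objects_def sl2c_higgs_def quasi_parabolic_higgs_def)
qed

section \<open>Isomorphism classes are conjugacy classes of residues\<close>

definition conjugate :: "('n \<Rightarrow> complex ^ 2 ^ 2) \<Rightarrow> ('n \<Rightarrow> complex ^ 2 ^ 2) \<Rightarrow> bool" where
  "conjugate N M \<longleftrightarrow> (\<exists>c. invertible c \<and> (\<forall>i. c ** N i = M i ** c))"

lemma conjugate_refl: "conjugate N N"
  unfolding conjugate_def by (rule exI[of _ "mat 1"]) (simp add: invertible_mat_scalar)

lemma conjugate_sym:
  assumes "conjugate N M"
  shows "conjugate M N"
proof -
  obtain c where c: "invertible c" "\<And>i. c ** N i = M i ** c"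
    using assms by (auto simp: conjugate_def)
  have "matrix_inv c ** M i = N i ** matrix_inv c" for i
  proof -
    have "matrix_inv c ** (M i ** c) ** matrix_inv c = matrix_inv c ** (c ** N i) ** matrix_inv c"
      by (simp add: c(2))
    then show ?thesis
      by (simp add: matrix_mul_assoc[symmetric] matrix_cancel c(1) matrix_inv_both)
  qed
  with invertible_matrix_inv[OF c(1)] show ?thesis
    unfolding conjugate_def by blast
qed

lemma conjugate_trans:
  assumes "conjugate N M" "conjugate M K"
  shows "conjugate N K"
proof -
  obtain c d where c: "invertible c" "\<And>i. c ** N i = M i ** c"
    and d: "invertible d" "\<And>i. d ** M i = K i ** d"
    using assms by (auto simp: conjugate_def)
  have "(d ** c) ** N i = K i ** (d ** c)" for i
    by (metis c(2) d(2) matrix_mul_assoc)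
  with invertible_mult[OF d(1) c(1)] show ?thesis
    unfolding conjugate_def by blast
qed

lemma range_conjugate:
  fixes c N M :: "complex ^ 2 ^ 2"
  assumes "invertible c" "c ** N = M ** c"
  shows "range ((*v) M) = (\<lambda>v. c *v v) ` range ((*v) N)"
proof (intro set_eqI iffI)
  have Mc: "M *v (c *v w) = c *v (N *v w)" for w
    using assms(2) by (simp add: matrix_vector_mul_assoc)
  fix v assume "v \<in> range ((*v) M)"
  then obtain u where "v = M *v u" by blast
  also have "\<dots> = M *v (c *v (matrix_inv c *v u))" by (simp add: matrix_cancel assms(1))
  also note Mc
  finally show "v \<in> (\<lambda>v. c *v v) ` range ((*v) N)" by blast
next
  fix v assume "v \<in> (\<lambda>v. c *v v) ` range ((*v) N)"
  then obtain u where "v = c *v (N *v u)" by blast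
  then have "v = M *v (c *v u)" using assms(2) by (simp add: matrix_vector_mul_assoc)
  then show "v \<in> range ((*v) M)" by blast
qed

text \<open>In global frames an isomorphism is an invertible holomorphic matrix on the whole sphere, so it is
  constant. Comparing residues shows that it conjugates one system of residues into the other.\<close>

lemma qp_isomorphic_imp_conjugate:
  assumes x: "inj x" and E: "hol_bundle (bun P)" and F: "hol_bundle (bun Q)"
    and P: "in_frame x P g N" and Q: "in_frame x Q h M"
    and N: "(\<Sum>i\<in>UNIV. N i) = 0" "(\<Sum>i\<in>UNIV. M i) = 0"
    and iso: "qp_isomorphic x P Q"
  shows "conjugate N M"
proof -
  obtain \<phi> where "\<forall>p. invertible (\<phi> p)"
      "\<forall>(V, f)\<in>bun P. hol_frame (bun Q) V (\<lambda>p. \<phi> p ** f p)"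
      "\<forall>p. p \<notin> range x \<longrightarrow> \<phi> p ** higgs P p = higgs Q p ** \<phi> p"
    using iso unfolding qp_isomorphic_def by blast
  then have \<phi>: "\<And>p. invertible (\<phi> p)"
      "\<And>V f. (V, f) \<in> bun P \<Longrightarrow> hol_frame (bun Q) V (\<lambda>p. \<phi> p ** f p)"
      "\<And>p. p \<notin> range x \<Longrightarrow> \<phi> p ** higgs P p = higgs Q p ** \<phi> p"
    by auto
  have g: "hol_frame (bun P) UNIV g" and h: "hol_frame (bun Q) UNIV h"
    using P Q by (auto simp: in_frame_def)
  have inv: "invertible (g p)" "invertible (h p)" for p
    using g h by (auto simp: hol_frame_def)
  define T where "T = (\<lambda>p. matrix_inv (h p) ** \<phi> p ** g p)"
  have "mat_hol T p" for p
  proof -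
    obtain V f where V: "(V, f) \<in> bun P" "p \<in> V" "open V" "hol_frame (bun P) V f"
      using bundle_chart[OF E] .
    have "mat_hol (\<lambda>q. matrix_inv (h q) ** (\<phi> q ** f q)) p"
      using frame_change[OF F h open_UNIV \<phi>(2)[OF V(1)]] V(2) by simp
    from mat_hol_mult[OF this hol_frame_coords[OF g V(1) UNIV_I V(2)]]
    have "mat_hol (\<lambda>q. matrix_inv (h q) ** (\<phi> q ** f q) ** (matrix_inv (f q) ** g q)) p" .
    then show ?thesis
    proof (rule mat_hol_cong[OF V(3,2), THEN iffD1, rotated])
      fix q assume "q \<in> V"
      then have "invertible (f q)" using V(4) by (simp add: hol_frame_def)
      then show "matrix_inv (h q) ** (\<phi> q ** f q) ** (matrix_inv (f q) ** g q) = T q"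
        by (simp add: T_def matrix_mul_assoc[symmetric] matrix_cancel)
    qed
  qed
  then have T: "T p = T Infty" for p by (rule mat_hol_UNIV_const)
  define c where "c = T Infty"
  have c: "invertible c"
    by (simp add: c_def T_def inv \<phi>(1) invertible_mult invertible_matrix_inv)
  have "c ** N i = M i ** c" for i
  proof (rule log_matrix_eqD[OF x])
    have mr: "(\<Sum>i\<in>UNIV. c ** N i) = c ** (\<Sum>i\<in>UNIV. N i)"
      by (simp add: mat2_eq_iff mult_entry2 sum.distrib sum_distrib_left)
    show "(\<Sum>i\<in>UNIV. c ** N i) = 0" unfolding mr N(1) by (simp add: mat2_eq_iff mult_entry2)
    have ml: "(\<Sum>i\<in>UNIV. M i ** c) = (\<Sum>i\<in>UNIV. M i) ** c"
      by (simp add: mat2_eq_iff mult_entry2 sum.distrib sum_distrib_right)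
    show "(\<Sum>i\<in>UNIV. M i ** c) = 0" unfolding ml N(2) by (simp add: mat2_eq_iff mult_entry2)
    fix p assume p: "p \<notin> range x"
    have hP: "higgs P p = g p ** log_matrix x N p ** matrix_inv (g p)"
      and hQ: "higgs Q p = h p ** log_matrix x M p ** matrix_inv (h p)"
      using P Q p by (auto simp: in_frame_def)
    have "matrix_inv (h p) ** (\<phi> p ** higgs P p) ** g p = matrix_inv (h p) ** (higgs Q p ** \<phi> p) ** g p"
      by (simp add: \<phi>(3)[OF p])
    then have "T p ** log_matrix x N p = log_matrix x M p ** T p"
      by (simp add: hP hQ T_def matrix_mul_assoc[symmetric] matrix_cancel inv matrix_inv_both)
    then show "log_matrix x (\<lambda>i. c ** N i) p = log_matrix x (\<lambda>i. M i ** c) p"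
      by (simp add: log_matrix_left log_matrix_right c_def flip: T[of p])
  qed
  with c show ?thesis unfolding conjugate_def by blast
qed

lemma conjugate_imp_qp_isomorphic:
  assumes E: "hol_bundle (bun P)" and P: "in_frame x P g N" and Q: "in_frame x Q h M"
    and con: "conjugate N M"
  shows "qp_isomorphic x P Q"
proof -
  obtain c where c: "invertible c" "\<And>i. c ** N i = M i ** c"
    using con by (auto simp: conjugate_def)
  have g: "hol_frame (bun P) UNIV g" and h: "hol_frame (bun Q) UNIV h"
    using P Q by (auto simp: in_frame_def)
  have inv: "invertible (g p)" "invertible (h p)" for p
    using g h by (auto simp: hol_frame_def)
  define \<phi> where "\<phi> = (\<lambda>p. h p ** c ** matrix_inv (g p))"
  have "invertible (\<phi> p)" for p
    by (simp add: \<phi>_def inv c invertible_mult invertible_matrix_inv)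
  moreover have "hol_frame (bun Q) V (\<lambda>p. \<phi> p ** f p)" if V: "(V, f) \<in> bun P" for V f
  proof -
    have f: "open V" "hol_frame (bun P) V f" using E V by (auto simp: hol_bundle_def)
    have "hol_frame (bun Q) V (\<lambda>p. h p ** (c ** (matrix_inv (g p) ** f p)))"
    proof (rule hol_frame_mult[OF h])
      fix p assume p: "p \<in> V"
      show "mat_hol (\<lambda>q. c ** (matrix_inv (g q) ** f q)) p"
        by (rule mat_hol_mult[OF mat_hol_const frame_change[OF E g open_UNIV f(2) UNIV_I p]])
      show "invertible (c ** (matrix_inv (g p) ** f p))"
        using f(2) p by (simp add: c inv invertible_mult invertible_matrix_inv hol_frame_def)
    qed simp
    then show ?thesis by (simp add: \<phi>_def matrix_mul_assoc)
  qed
  moreover have "(\<lambda>v. \<phi> (x i) *v v) ` flag P i = flag Q i" for i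
  proof -
    have "flag P i = (\<lambda>v. g (x i) *v v) ` range ((*v) (N i))"
      "flag Q i = (\<lambda>v. h (x i) *v v) ` range ((*v) (M i))"
      using P Q by (simp_all add: in_frame_def image_image)
    then show ?thesis
      unfolding range_conjugate[OF c(1) c(2)[of i]] image_image
      by (simp add: image_image \<phi>_def matrix_vector_mul_assoc[symmetric] matrix_cancel inv)
  qed
  moreover have "\<phi> p ** higgs P p = higgs Q p ** \<phi> p" if p: "p \<notin> range x" for p
  proof -
    have hP: "higgs P p = g p ** log_matrix x N p ** matrix_inv (g p)"
      and hQ: "higgs Q p = h p ** log_matrix x M p ** matrix_inv (h p)"
      using P Q p by (auto simp: in_frame_def)
    have "c ** log_matrix x N p = log_matrix x M p ** c"
      using c(2) by (simp flip: log_matrix_left log_matrix_right)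
    then have "c ** (log_matrix x N p ** matrix_inv (g p)) = log_matrix x M p ** (c ** matrix_inv (g p))"
      by (simp add: matrix_mul_assoc)
    then show ?thesis
      by (simp add: \<phi>_def hP hQ matrix_mul_assoc[symmetric] matrix_cancel inv)
  qed
  ultimately show ?thesis
    unfolding qp_isomorphic_def by (intro exI[of _ \<phi>]) auto
qed

lemma H0_iso_iff_conjugate:
  assumes x: "inj x" and PQ: "P \<in> H0_objects x" "Q \<in> H0_objects x"
    and P: "in_frame x P g N" "stable_residues N" and Q: "in_frame x Q h M" "stable_residues M"
  shows "(P, Q) \<in> H0_iso x \<longleftrightarrow> conjugate N M"
proof -
  have E: "hol_bundle (bun P)" "hol_bundle (bun Q)"
    using PQ by (auto simp: H0_objects_def sl2c_higgs_def quasi_parabolic_higgs_def)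
  have "(\<Sum>i\<in>UNIV. N i) = 0" "(\<Sum>i\<in>UNIV. M i) = 0"
    using P Q by (auto simp: stable_residues_def)
  then show ?thesis
    using qp_isomorphic_imp_conjugate[OF x E P(1) Q(1)] conjugate_imp_qp_isomorphic[OF E(1) P(1) Q(1)] PQ
    by (auto simp: H0_iso_def)
qed

definition model :: "('n::finite \<Rightarrow> cp1) \<Rightarrow> ('n \<Rightarrow> complex ^ 2 ^ 2) \<Rightarrow> 'n qp_higgs" where
  "model x N = \<lparr>bun = product_bundle, flag = (\<lambda>i. range ((*v) (N i))), higgs = log_matrix x N\<rparr>"

lemma matrix_inv_1 [simp]: "matrix_inv (mat 1 :: complex ^ 'r::finite ^ 'r) = mat 1"
  by (rule matrix_inv_eqI) simp

lemma hol_bundle_product: "hol_bundle product_bundle"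
  by (auto simp: hol_bundle_def product_bundle_def hol_frame_iff invertible_mat_scalar)

lemma in_frame_model: "in_frame x (model x N) (\<lambda>_. mat 1) N"
proof -
  have "hol_frame product_bundle UNIV (\<lambda>_. mat 1 :: complex ^ 2 ^ 2)"
    using hol_bundle_product by (simp add: hol_bundle_def product_bundle_def)
  then show ?thesis by (simp add: in_frame_def model_def)
qed

lemma model_in_H0_objects:
  assumes "inj x" "stable_residues N"
  shows "model x N \<in> H0_objects x"
  by (rule H0_objectI[OF assms(1) _ in_frame_model assms(2)]) (simp add: model_def hol_bundle_product)

text \<open>The point of the moduli space with residues \<open>N\<close>. It is the class of the model on the product
  bundle.\<close>

definition residue_class :: "('n::finite \<Rightarrow> cp1) \<Rightarrow> ('n \<Rightarrow> complex ^ 2 ^ 2) \<Rightarrow> 'n qp_higgs set" where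
  "residue_class x N = H0_iso x `` {model x N}"

lemma equiv_H0_iso:
  fixes x :: "'n::finite \<Rightarrow> cp1"
  assumes x: "inj x"
  shows "equiv (H0_objects x) (H0_iso x)"
proof (rule equivI)
  have fr: "\<exists>g N. in_frame x P g N \<and> stable_residues N" if "P \<in> H0_objects x" for P
    using H0_object_in_frame[OF x that] by blast
  note iff = H0_iso_iff_conjugate[OF x]
  show "H0_iso x \<subseteq> H0_objects x \<times> H0_objects x" by (auto simp: H0_iso_def)
  show "refl_on (H0_objects x) (H0_iso x)"
  proof (rule refl_onI)
    fix P assume P: "P \<in> H0_objects x"
    with fr obtain g N where "in_frame x P g N" "stable_residues N" by blast
    with iff[OF P P this this] conjugate_refl[of N] show "(P, P) \<in> H0_iso x" by simp
  qed
  show "sym (H0_iso x)"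
  proof (rule symI)
    fix P Q assume PQ: "(P, Q) \<in> H0_iso x"
    then have o: "P \<in> H0_objects x" "Q \<in> H0_objects x" by (auto simp: H0_iso_def)
    with fr obtain g N h M where f: "in_frame x P g N" "stable_residues N" "in_frame x Q h M" "stable_residues M"
      by meson
    from iff[OF o f] iff[OF o(2,1) f(3,4,1,2)] PQ conjugate_sym[of N M] show "(Q, P) \<in> H0_iso x" by blast
  qed
  show "trans (H0_iso x)"
  proof (rule transI)
    fix P Q R assume PQ: "(P, Q) \<in> H0_iso x" and QR: "(Q, R) \<in> H0_iso x"
    then have o: "P \<in> H0_objects x" "Q \<in> H0_objects x" "R \<in> H0_objects x" by (auto simp: H0_iso_def)
    obtain g N where f1: "in_frame x P g N" "stable_residues N" using fr[OF o(1)] by blast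
    obtain h M where f2: "in_frame x Q h M" "stable_residues M" using fr[OF o(2)] by blast
    obtain k K where f3: "in_frame x R k K" "stable_residues K" using fr[OF o(3)] by blast
    from iff[OF o(1,2) f1 f2] iff[OF o(2,3) f2 f3] iff[OF o(1,3) f1 f3] PQ QR conjugate_trans[of N M K]
    show "(P, R) \<in> H0_iso x" by simp
  qed
qed

lemma residue_class_in_H0: "inj x \<Longrightarrow> stable_residues N \<Longrightarrow> residue_class x N \<in> H0 x"
  unfolding H0_def residue_class_def by (rule quotientI) (rule model_in_H0_objects)

lemma in_frame_conjugate:
  assumes P: "in_frame x P g M" and c: "invertible c" "\<And>i. c ** N i = M i ** c"
  shows "in_frame x P (\<lambda>p. g p ** c) N"
proof -
  have g: "hol_frame (bun P) UNIV g" using P by (simp add: in_frame_def)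
  have inv: "invertible (g p)" for p using g by (auto simp: hol_frame_def)
  have "hol_frame (bun P) UNIV (\<lambda>p. g p ** c)"
    by (rule hol_frame_mult[OF g]) (auto simp: c)
  moreover have "flag P i = range (\<lambda>v. (g (x i) ** c) *v (N i *v v))" for i
  proof -
    have "flag P i = (\<lambda>v. g (x i) *v v) ` range ((*v) (M i))"
      using P by (simp add: in_frame_def image_image)
    then show ?thesis
      unfolding range_conjugate[OF c(1) c(2)[of i]] image_image
      by (simp add: matrix_vector_mul_assoc matrix_mul_assoc)
  qed
  moreover have "higgs P p = (g p ** c) ** log_matrix x N p ** matrix_inv (g p ** c)"
    if p: "p \<notin> range x" for p
  proof -
    have "c ** log_matrix x N p = log_matrix x M p ** c"
      using c(2) by (simp flip: log_matrix_left log_matrix_right)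
    then have "(g p ** c) ** log_matrix x N p ** matrix_inv (g p ** c) =
        g p ** (log_matrix x M p ** c) ** (matrix_inv c ** matrix_inv (g p))"
      by (simp add: matrix_inv_mult inv c flip: matrix_mul_assoc)
    also have "\<dots> = g p ** log_matrix x M p ** matrix_inv (g p)"
      by (simp add: matrix_mul_assoc[symmetric] matrix_cancel c)
    finally show ?thesis using P p by (simp add: in_frame_def)
  qed
  ultimately show ?thesis by (simp add: in_frame_def)
qed

lemma mem_residue_class:
  assumes x: "inj x" and N: "stable_residues N"
  shows "P \<in> residue_class x N \<longleftrightarrow> P \<in> H0_objects x \<and> (\<exists>g. in_frame x P g N)"
proof
  assume "P \<in> residue_class x N"
  then have iso: "(model x N, P) \<in> H0_iso x" by (simp add: residue_class_def)
  then have P: "P \<in> H0_objects x" by (simp add: H0_iso_def)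
  obtain g M where g: "in_frame x P g M" "stable_residues M"
    using H0_object_in_frame[OF x P] .
  have "conjugate N M"
    using H0_iso_iff_conjugate[OF x model_in_H0_objects[OF x N] P in_frame_model N g] iso by simp
  then obtain c where "invertible c" "\<And>i. c ** N i = M i ** c" by (auto simp: conjugate_def)
  from in_frame_conjugate[OF g(1) this] P show "P \<in> H0_objects x \<and> (\<exists>g. in_frame x P g N)" by blast
next
  assume "P \<in> H0_objects x \<and> (\<exists>g. in_frame x P g N)"
  then obtain g where P: "P \<in> H0_objects x" "in_frame x P g N" by blast
  from H0_iso_iff_conjugate[OF x model_in_H0_objects[OF x N] P(1) in_frame_model N P(2) N] conjugate_refl
  show "P \<in> residue_class x N" by (simp add: residue_class_def)
qed

lemma model_mem_residue_class: "inj x \<Longrightarrow> stable_residues N \<Longrightarrow> model x N \<in> residue_class x N"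
  using in_frame_model by (auto simp: mem_residue_class model_in_H0_objects)

lemma residue_class_eq_iff:
  assumes x: "inj x" and N: "stable_residues N" and M: "stable_residues M"
  shows "residue_class x N = residue_class x M \<longleftrightarrow> conjugate N M"
  unfolding residue_class_def
  by (subst eq_equiv_class_iff[OF equiv_H0_iso[OF x] model_in_H0_objects[OF x N] model_in_H0_objects[OF x M]])
     (rule H0_iso_iff_conjugate[OF x model_in_H0_objects[OF x N] model_in_H0_objects[OF x M]
        in_frame_model N in_frame_model M])

lemma H0_residue_class:
  assumes x: "inj x" and C: "C \<in> H0 x" "P \<in> C" and P: "in_frame x P g N" "stable_residues N"
  shows "C = residue_class x N"
proof -
  have PO: "P \<in> H0_objects x"
    using in_quotient_imp_subset[OF equiv_H0_iso[OF x]] C unfolding H0_def by blast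
  have "P \<in> residue_class x N"
    using PO P by (auto simp: mem_residue_class[OF x P(2)])
  moreover have "residue_class x N \<in> H0 x" using x P(2) by (rule residue_class_in_H0)
  ultimately show ?thesis
    using quotient_disj[OF equiv_H0_iso[OF x], of C "residue_class x N"] C unfolding H0_def by blast
qed

lemma H0_cases:
  assumes x: "inj x" and C: "C \<in> H0 x"
  obtains N where "stable_residues N" "C = residue_class x N"
proof -
  obtain P where P: "P \<in> C" "P \<in> H0_objects x"
    using in_quotient_imp_non_empty[OF equiv_H0_iso[OF x]] in_quotient_imp_subset[OF equiv_H0_iso[OF x]] C
    unfolding H0_def by blast
  obtain g N where g: "in_frame x P g N" "stable_residues N"
    using H0_object_in_frame[OF x P(2)] .
  show thesis
    by (rule that[OF g(2) H0_residue_class[OF x C P(1) g]])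
qed

section \<open>The involution\<close>

declare transpose_matrix_vector [simp del]

lemma dual_hol_frame:
  assumes E: "hol_bundle E" and g: "hol_frame E U g" "open U"
  shows "hol_frame (dual_bundle E) U (\<lambda>p. transpose (matrix_inv (g p)))"
  unfolding hol_frame_iff
proof (intro conjI ballI, goal_cases)
  case (1 p)
  with g show ?case by (simp add: hol_frame_def invertible_transpose invertible_matrix_inv)
next
  case (2 VF)
  then obtain V f where VF: "VF = (V, \<lambda>p. transpose (matrix_inv (f p)))" and V: "(V, f) \<in> E"
    by (auto simp: dual_bundle_def)
  have f: "open V" "hol_frame E V f" using E V by (auto simp: hol_bundle_def)
  have "mat_hol (\<lambda>q. matrix_inv (transpose (matrix_inv (f q))) ** transpose (matrix_inv (g q))) p"
    if p: "p \<in> U" "p \<in> V" for p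
  proof -
    have o: "open (U \<inter> V)" "p \<in> U \<inter> V" using f g p by auto
    have inv: "invertible (f q)" "invertible (g q)" if "q \<in> U \<inter> V" for q
      using that f(2) g(1) by (auto simp: hol_frame_def)
    have "mat_hol (\<lambda>q. transpose (matrix_inv (g q) ** f q)) p"
      using frame_change[OF E g f(2) p] by (rule mat_hol_transpose)
    then show ?thesis
    proof (rule mat_hol_cong[OF o, THEN iffD1, rotated])
      fix q assume "q \<in> U \<inter> V"
      note i = inv[OF this]
      show "transpose (matrix_inv (g q) ** f q) =
          matrix_inv (transpose (matrix_inv (f q))) ** transpose (matrix_inv (g q))"
        by (simp add: matrix_transpose_mul matrix_inv_transpose invertible_matrix_inv matrix_inv_inv i)
    qed
  qed
  with VF show ?case by simp
qed

lemma hol_bundle_dual: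
  assumes "hol_bundle E"
  shows "hol_bundle (dual_bundle E)"
proof -
  have "\<forall>(V, F)\<in>dual_bundle E. open V \<and> hol_frame (dual_bundle E) V F"
    using assms dual_hol_frame[OF assms] by (auto simp: hol_bundle_def dual_bundle_def)
  moreover have "(\<Union>(V, F)\<in>dual_bundle E. V) = UNIV"
    using assms by (auto simp: hol_bundle_def dual_bundle_def)
  ultimately show ?thesis by (simp add: hol_bundle_def)
qed

lemma transpose_nilpotent:
  fixes N :: "complex ^ 2 ^ 2"
  assumes "N \<noteq> 0" "N ** N = 0"
  shows "transpose N \<noteq> 0" "transpose N ** transpose N = 0"
proof -
  have 0: "transpose 0 = (0 :: complex ^ 2 ^ 2)" by (simp add: transpose_def vec_eq_iff)
  show "transpose N \<noteq> 0"
  proof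
    assume "transpose N = 0"
    from arg_cong[OF this, of transpose] 0 assms(1) show False by simp
  qed
  show "transpose N ** transpose N = 0"
    by (simp add: assms(2) 0 flip: matrix_transpose_mul)
qed

lemma range_nilpotent2:
  fixes N :: "complex ^ 2 ^ 2"
  assumes "N ** N = 0" "N \<noteq> 0"
  shows "range ((*v) N) = {v. N *v v = 0}"
  by (rule nilpotent2_kernel[OF assms]) blast

lemma pairing_transpose:
  "(\<Sum>a\<in>UNIV. u $ a * (A *v v) $ a) = (\<Sum>a\<in>UNIV. (transpose A *v u) $ a * v $ a)"
  for A :: "complex ^ 2 ^ 2"
  by (simp add: sum_2 vmult_entry2 transpose_def algebra_simps)

lemma pairing_nondegenerate: "(\<forall>v. (\<Sum>a\<in>UNIV. u $ a * v $ a) = 0) \<longleftrightarrow> u = 0" for u :: "complex ^ 2"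
proof
  assume *: "\<forall>v. (\<Sum>a\<in>UNIV. u $ a * v $ a) = 0"
  show "u = 0"
    using *[rule_format, of "axis 1 1"] *[rule_format, of "axis 2 1"]
    by (simp add: sum_2 axis_def vec2_eq_iff)
qed simp

text \<open>The image of \<open>K^T\<close> equals its kernel, which is the annihilator of the image of \<open>K\<close>.\<close>

lemma range_transpose_nilpotent:
  fixes N M :: "complex ^ 2 ^ 2"
  assumes "N ** N = 0" "N \<noteq> 0" "M ** M = 0" "M \<noteq> 0"
    and "range ((*v) (transpose N)) = range ((*v) (transpose M))"
  shows "range ((*v) N) = range ((*v) M)"
proof -
  have ann: "u \<in> range ((*v) (transpose K)) \<longleftrightarrow> (\<forall>v\<in>range ((*v) K). (\<Sum>a\<in>UNIV. u $ a * v $ a) = 0)"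
    if "K ** K = 0" "K \<noteq> 0" for K :: "complex ^ 2 ^ 2" and u
    using range_nilpotent2[of "transpose K"] transpose_nilpotent[OF that(2,1)]
      pairing_nondegenerate[of "transpose K *v u"] by (simp add: pairing_transpose)
  obtain v where v: "v \<noteq> 0" "range ((*v) N) = vec.span {v}"
    by (rule nilpotent2_kernel[OF assms(1,2)]) (rule that)
  obtain w where w: "w \<noteq> 0" "range ((*v) M) = vec.span {w}"
    by (rule nilpotent2_kernel[OF assms(3,4)]) (rule that)
  define u where "u = (vector [- v $ 2, v $ 1] :: complex ^ 2)"
  have u: "(\<Sum>a\<in>UNIV. u $ a * y $ a) = det2 v y" for y
    by (simp add: u_def sum_2 det2_def)
  have "u \<in> range ((*v) (transpose N))"
    unfolding ann[OF assms(1,2)] v(2) u by (auto simp: in_span1 det2_def)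
  then have "u \<in> range ((*v) (transpose M))" using assms(5) by simp
  then have "det2 v w = 0"
    unfolding ann[OF assms(3,4)] w(2) u by (simp add: vec.span_base)
  then have "v \<in> vec.span {w}" using det2_eq_0[OF w(1)] by simp
  from span1_eqI[OF this v(1)] v w show ?thesis by simp
qed

lemma stable_residues_transpose:
  assumes "stable_residues N"
  shows "stable_residues (\<lambda>i. transpose (N i))"
proof -
  have N: "N i \<noteq> 0" "N i ** N i = 0" for i using assms by (auto simp: stable_residues_def)
  have "(\<Sum>i\<in>UNIV. transpose (N i)) = transpose (\<Sum>i\<in>UNIV. N i)"
    by (simp add: vec_eq_iff transpose_def)
  also have "\<dots> = 0" using assms by (simp add: stable_residues_def vec_eq_iff transpose_def)
  finally have sum0: "(\<Sum>i\<in>UNIV. transpose (N i)) = 0" .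
  obtain i j where "range ((*v) (N i)) \<noteq> range ((*v) (N j))"
    using assms unfolding stable_residues_def by blast
  then have "range ((*v) (transpose (N i))) \<noteq> range ((*v) (transpose (N j)))"
    using range_transpose_nilpotent[OF N(2)[of i] N(1)[of i] N(2)[of j] N(1)[of j]] by blast
  then show ?thesis
    using transpose_nilpotent[OF N] sum0 unfolding stable_residues_def by blast
qed

text \<open>The annihilator of the flag \<open>g (im N)\<close> is the image of \<open>ker N^T\<close> under the inverse transpose of
  \<open>g\<close>, and \<open>ker N^T = im N^T\<close> because \<open>N^T\<close> is nilpotent.\<close>

lemma in_frame_dual:
  assumes E: "hol_bundle (bun P)" and P: "in_frame x P g N"
    and N: "\<And>i. N i \<noteq> 0" "\<And>i. N i ** N i = 0"
  shows "in_frame x (dual_higgs P) (\<lambda>p. transpose (matrix_inv (g p))) (\<lambda>i. transpose (N i))"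
proof -
  have g: "hol_frame (bun P) UNIV g" using P by (simp add: in_frame_def)
  have inv: "invertible (g p)" for p using g by (auto simp: hol_frame_def)
  have "{f. \<forall>v\<in>flag P i. (\<Sum>a\<in>UNIV. f $ a * v $ a) = 0} =
      range (\<lambda>v. transpose (matrix_inv (g (x i))) *v (transpose (N i) *v v))" for i
  proof -
    have 1: "(\<forall>v\<in>flag P i. (\<Sum>a\<in>UNIV. f $ a * v $ a) = 0) \<longleftrightarrow>
        transpose (N i) *v (transpose (g (x i)) *v f) = 0" for f
    proof -
      have "(\<forall>v\<in>flag P i. (\<Sum>a\<in>UNIV. f $ a * v $ a) = 0) \<longleftrightarrow>
          (\<forall>v. (\<Sum>a\<in>UNIV. f $ a * (g (x i) *v (N i *v v)) $ a) = 0)"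
        using P by (auto simp: in_frame_def)
      then show ?thesis
        unfolding pairing_transpose pairing_nondegenerate .
    qed
    have ker: "{v. transpose (N i) *v v = 0} = range ((*v) (transpose (N i)))"
      using range_nilpotent2[OF transpose_nilpotent(2,1)[OF N]] by simp
    have inv': "invertible (transpose (g (x i)))" by (simp add: inv invertible_transpose)
    show ?thesis
    proof (intro set_eqI iffI)
      fix f assume "f \<in> {f. \<forall>v\<in>flag P i. (\<Sum>a\<in>UNIV. f $ a * v $ a) = 0}"
      then have "transpose (g (x i)) *v f \<in> range ((*v) (transpose (N i)))"
        unfolding ker[symmetric] by (simp add: 1)
      then obtain v where "transpose (g (x i)) *v f = transpose (N i) *v v" by blast
      from arg_cong[OF this, of "(*v) (matrix_inv (transpose (g (x i))))"]
      have "f = transpose (matrix_inv (g (x i))) *v (transpose (N i) *v v)"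
        unfolding matrix_cancel(4)[OF inv'] by (simp add: matrix_inv_transpose inv)
      then show "f \<in> range (\<lambda>v. transpose (matrix_inv (g (x i))) *v (transpose (N i) *v v))" by blast
    next
      fix f assume "f \<in> range (\<lambda>v. transpose (matrix_inv (g (x i))) *v (transpose (N i) *v v))"
      then obtain v where f: "f = matrix_inv (transpose (g (x i))) *v (transpose (N i) *v v)"
        by (auto simp: matrix_inv_transpose inv)
      have "transpose (N i) *v (transpose (g (x i)) *v f) = (transpose (N i) ** transpose (N i)) *v v"
        unfolding f matrix_cancel(3)[OF inv'] by (simp add: matrix_vector_mul_assoc)
      also have "\<dots> = 0" by (simp add: transpose_nilpotent[OF N])
      finally show "f \<in> {f. \<forall>v\<in>flag P i. (\<Sum>a\<in>UNIV. f $ a * v $ a) = 0}"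
        unfolding mem_Collect_eq 1 .
    qed
  qed
  moreover have "transpose (higgs P p) = transpose (matrix_inv (g p)) ** log_matrix x (\<lambda>i. transpose (N i)) p
      ** matrix_inv (transpose (matrix_inv (g p)))" if "p \<notin> range x" for p
  proof -
    have "log_matrix x (\<lambda>i. transpose (N i)) p = transpose (log_matrix x N p)"
      by (simp add: log_matrix_def transpose_def)
    then show ?thesis
      using P that by (simp add: in_frame_def matrix_transpose_mul matrix_inv_transpose
          invertible_matrix_inv matrix_inv_inv inv matrix_mul_assoc)
  qed
  ultimately show ?thesis
    using dual_hol_frame[OF E g open_UNIV] by (simp add: in_frame_def dual_higgs_def)
qed

theorem Theta_residue_class:
  assumes x: "inj x" and N: "stable_residues N"
  shows "Theta x (residue_class x N) = residue_class x (\<lambda>i. transpose (N i))"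
proof -
  have nil: "N i \<noteq> 0" "N i ** N i = 0" for i using N by (auto simp: stable_residues_def)
  note N' = stable_residues_transpose[OF N]
  have dual: "dual_higgs P \<in> residue_class x (\<lambda>i. transpose (N i))" if P: "P \<in> residue_class x N" for P
  proof -
    obtain g where g: "in_frame x P g N" and "P \<in> H0_objects x"
      using P by (auto simp: mem_residue_class[OF x N])
    then have E: "hol_bundle (bun P)"
      by (auto simp: H0_objects_def sl2c_higgs_def quasi_parabolic_higgs_def)
    note fr = in_frame_dual[OF E g nil]
    have "hol_bundle (bun (dual_higgs P))" by (simp add: dual_higgs_def hol_bundle_dual[OF E])
    from H0_objectI[OF x this fr N'] fr show ?thesis by (auto simp: mem_residue_class[OF x N'])
  qed
  have cl: "H0_iso x `` {Q} = residue_class x (\<lambda>i. transpose (N i))"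
    if "Q \<in> residue_class x (\<lambda>i. transpose (N i))" for Q
    using that equiv_class_eq[OF equiv_H0_iso[OF x]] unfolding residue_class_def by blast
  have "Theta x (residue_class x N) = (\<Union>P\<in>residue_class x N. H0_iso x `` {dual_higgs P})"
    unfolding Theta_def by blast
  also have "\<dots> = residue_class x (\<lambda>i. transpose (N i))"
    using cl[OF dual] model_mem_residue_class[OF x N] by blast
  finally show ?thesis .
qed

section \<open>Residues exchanged between two complementary lines\<close>

lemma param_residue_entries:
  "param_residue A i u l $ 1 $ 1 = - l * u" "param_residue A i u l $ 2 $ 2 = l * u"
  "param_residue A i u l $ 1 $ 2 = (if i \<in> A then l else l * u ^ 2)"
  "param_residue A i u l $ 2 $ 1 = - (if i \<in> A then l * u ^ 2 else l)"
  by (auto simp: param_residue_def)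

lemma param_residue_nilpotent: "param_residue A i u l ** param_residue A i u l = 0"
  by (simp add: nilpotent2_entries param_residue_entries power2_eq_square)

lemma param_residue_nonzero: "l \<noteq> 0 \<Longrightarrow> param_residue A i u l \<noteq> 0"
  by (auto simp: mat2_eq_iff param_residue_entries)

lemma range_param_residue:
  assumes "l \<noteq> 0"
  shows "range ((*v) (param_residue A i u l)) = param_line A i u"
proof -
  let ?w = "if i \<in> A then vector [1, u] else vector [u, 1] :: complex ^ 2"
  have w0: "?w \<noteq> 0" by (auto simp: vec2_eq_iff)
  obtain w where w: "w \<noteq> 0" "range ((*v) (param_residue A i u l)) = vec.span {w}"
      "\<And>v. param_residue A i u l *v v = 0 \<longleftrightarrow> v \<in> vec.span {w}"
    by (rule nilpotent2_kernel[OF param_residue_nilpotent param_residue_nonzero[OF assms]]) (rule that)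
  have "param_residue A i u l *v ?w = 0"
    by (auto simp: vec2_eq_iff vmult_entry2 param_residue_entries power2_eq_square)
  then have "?w \<in> vec.span {w}" by (simp only: w(3))
  from span1_eqI[OF this w0] w(2) show ?thesis by (simp add: param_line_def)
qed

text \<open>The residues of a Higgs field that is off-diagonal for the splitting of \<open>\<complex>^2\<close> into its
  coordinate lines: upper triangular over \<open>S\<close> and lower triangular elsewhere. They are the residues of
  the chart parametrization at \<open>u = 0\<close>.\<close>

definition split_residues :: "'n set \<Rightarrow> ('n \<Rightarrow> complex) \<Rightarrow> 'n \<Rightarrow> complex ^ 2 ^ 2" where
  "split_residues S l i = param_residue S i 0 (l i)"

lemma split_residues_entries:
  "split_residues S l i $ 1 $ 1 = 0" "split_residues S l i $ 2 $ 2 = 0"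
  "split_residues S l i $ 1 $ 2 = (if i \<in> S then l i else 0)"
  "split_residues S l i $ 2 $ 1 = (if i \<in> S then 0 else - l i)"
  by (auto simp: split_residues_def param_residue_entries)

lemma range_split_residues:
  assumes "l i \<noteq> 0"
  shows "range ((*v) (split_residues S l i)) = vec.span {if i \<in> S then axis 1 1 else axis 2 1}"
proof -
  have "vector [1, 0] = (axis 1 1 :: complex ^ 2)" "vector [0, 1] = (axis 2 1 :: complex ^ 2)"
    by (auto simp: vec2_eq_iff axis_def)
  with range_param_residue[OF assms, of S i 0] show ?thesis
    by (auto simp: split_residues_def param_line_def)
qed

lemma span_axis_distinct: "vec.span {axis 1 1 :: complex ^ 2} \<noteq> vec.span {axis 2 1}"
proof
  assume "vec.span {axis 1 1 :: complex ^ 2} = vec.span {axis 2 1}"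
  then have "(axis 1 1 :: complex ^ 2) \<in> vec.span {axis 2 1}"
    by (metis insertI1 vec.span_base)
  then show False by (auto simp: in_span1 vec2_eq_iff axis_def)
qed

lemma sum_if_mem: "(\<Sum>i\<in>UNIV. if i \<in> S then f i else 0) = sum f S"
  "(\<Sum>i\<in>UNIV. if i \<in> S then 0 else f i) = sum f (- S)"
  for S :: "'n::finite set" and f :: "'n \<Rightarrow> complex"
proof -
  have "(\<Sum>i\<in>UNIV. if i \<in> S then 0 else f i) = (\<Sum>i\<in>UNIV. if i \<in> - S then f i else 0)"
    by (intro sum.cong) auto
  then show "(\<Sum>i\<in>UNIV. if i \<in> S then f i else 0) = sum f S"
    "(\<Sum>i\<in>UNIV. if i \<in> S then 0 else f i) = sum f (- S)"
    by (simp_all add: sum.If_cases)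
qed

lemma stable_split_residues:
  fixes S :: "'n::finite set"
  shows "stable_residues (split_residues S l) \<longleftrightarrow>
    (\<forall>i. l i \<noteq> 0) \<and> sum l S = 0 \<and> sum l (- S) = 0 \<and> S \<noteq> {} \<and> S \<noteq> UNIV"
proof -
  have nz: "split_residues S l i \<noteq> 0 \<longleftrightarrow> l i \<noteq> 0" for i
    by (simp add: mat2_eq_iff split_residues_entries)
  have nil: "split_residues S l i ** split_residues S l i = 0" for i
    by (simp add: split_residues_def param_residue_nilpotent)
  have sum: "(\<Sum>i\<in>UNIV. split_residues S l i) = 0 \<longleftrightarrow> sum l S = 0 \<and> sum l (- S) = 0"
  proof -
    have "(\<Sum>i\<in>UNIV. if i \<in> S then 0 else - l i) = - sum l (- S)"
      by (simp add: sum_if_mem sum_negf)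
    then show ?thesis
      by (simp add: mat2_eq_iff split_residues_entries sum_if_mem)
  qed
  have "(\<exists>i j. range ((*v) (split_residues S l i)) \<noteq> range ((*v) (split_residues S l j))) \<longleftrightarrow> S \<noteq> {} \<and> S \<noteq> UNIV"
    if "\<And>i. l i \<noteq> 0"
  proof -
    have "(range ((*v) (split_residues S l i)) \<noteq> range ((*v) (split_residues S l j))) \<longleftrightarrow> (i \<in> S \<longleftrightarrow> j \<notin> S)" for i j
      using span_axis_distinct by (auto simp: range_split_residues that)
    then show ?thesis by auto
  qed
  then show ?thesis
    unfolding stable_residues_def using nz nil sum by blast
qed

definition swap_matrix :: "complex ^ 2 ^ 2" where
  "swap_matrix = vector [vector [0, 1], vector [1, 0]]"

lemma swap_matrix_entries:
  "swap_matrix $ 1 $ 1 = 0" "swap_matrix $ 1 $ 2 = 1" "swap_matrix $ 2 $ 1 = 1" "swap_matrix $ 2 $ 2 = 0"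
  by (auto simp: swap_matrix_def)

lemma invertible_swap_matrix: "invertible swap_matrix"
  by (simp add: invertible_det_nz det_2 swap_matrix_entries)

text \<open>Exchanging the two basis vectors transposes every strictly triangular matrix.\<close>

lemma conjugate_split_transpose:
  "conjugate (split_residues S l) (\<lambda>i. transpose (split_residues S l i))"
  unfolding conjugate_def
  by (rule exI[of _ swap_matrix])
     (simp add: invertible_swap_matrix mat2_eq_iff mult_entry2 swap_matrix_entries split_residues_entries transpose_def)

text \<open>The same exchange of basis vectors exchanges the roles of \<open>S\<close> and its complement.\<close>

lemma conjugate_split_swap:
  "conjugate (split_residues S l) (split_residues (- S) (\<lambda>i. - l i))"
  unfolding conjugate_def
  by (rule exI[of _ swap_matrix])
     (simp add: invertible_swap_matrix mat2_eq_iff mult_entry2 swap_matrix_entries split_residues_entries)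

text \<open>Diagonal matrices rescale the entries over \<open>S\<close> and those over the complement inversely. This is
  what allows the entry at a chosen index of \<open>S\<close> to be normalized to 1.\<close>

lemma conjugate_split_scale:
  assumes a: "a \<noteq> 0"
  shows "conjugate (split_residues S l) (split_residues S (\<lambda>i. if i \<in> S then l i / a else l i * a))"
proof -
  define c where "c = (vector [vector [1, 0], vector [0, a]] :: complex ^ 2 ^ 2)"
  have c: "c $ 1 $ 1 = 1" "c $ 1 $ 2 = 0" "c $ 2 $ 1 = 0" "c $ 2 $ 2 = a"
    by (auto simp: c_def)
  then have "invertible c" using a by (simp add: invertible_det_nz det_2)
  then show ?thesis
    unfolding conjugate_def
    by (intro exI[of _ c]) (use a in \<open>simp add: mat2_eq_iff mult_entry2 c split_residues_entries\<close>)
qed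

lemma sum_matrix_conj: "(\<Sum>i\<in>I. A ** (N i ** B)) = A ** ((\<Sum>i\<in>I. N i) ** B)"
  for A B :: "complex ^ 2 ^ 2"
  by (induction I rule: infinite_finite_induct) (auto simp: mat2_eq_iff mult_entry2 algebra_simps)

lemma conjugate_stable:
  assumes N: "stable_residues N" and "conjugate N M"
  shows "stable_residues M"
proof -
  obtain c where c: "invertible c" "\<And>i. c ** N i = M i ** c"
    using assms(2) by (auto simp: conjugate_def)
  have M: "M i = c ** (N i ** matrix_inv c)" for i
  proof -
    have "M i = (M i ** c) ** matrix_inv c"
      by (simp add: matrix_mul_assoc[symmetric] matrix_inv_both c(1))
    then show ?thesis by (simp add: c(2)[symmetric] matrix_mul_assoc)
  qed
  have N': "N i \<noteq> 0" "N i ** N i = 0" for i using N by (auto simp: stable_residues_def)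
  have "M i \<noteq> 0" for i
  proof
    assume "M i = 0"
    then have "matrix_inv c ** (c ** N i) = 0" by (simp add: c(2))
    then show False using N'(1)[of i] by (simp add: matrix_cancel c(1))
  qed
  moreover have "M i ** M i = 0" for i
  proof -
    have "M i ** M i = c ** ((N i ** N i) ** matrix_inv c)"
      by (simp add: M matrix_mul_assoc[symmetric] matrix_cancel c(1))
    then show ?thesis by (simp add: N'(2))
  qed
  moreover have "(\<Sum>i\<in>UNIV. M i) = 0"
  proof -
    have "(\<Sum>i\<in>UNIV. M i) = c ** ((\<Sum>i\<in>UNIV. N i) ** matrix_inv c)"
      unfolding M by (rule sum_matrix_conj)
    then show ?thesis using N by (simp add: stable_residues_def)
  qed
  moreover obtain i j where ij: "range ((*v) (N i)) \<noteq> range ((*v) (N j))"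
    using N unfolding stable_residues_def by blast
  moreover have "range ((*v) (M i)) \<noteq> range ((*v) (M j))"
  proof
    have inj: "inj (\<lambda>v. c *v v)"
      by (rule inj_on_inverseI[of _ "\<lambda>v. matrix_inv c *v v"]) (simp add: matrix_cancel c(1))
    assume "range ((*v) (M i)) = range ((*v) (M j))"
    then show False
      using ij inj_image_eq_iff[OF inj] by (simp add: range_conjugate[OF c(1) c(2)])
  qed
  ultimately show ?thesis unfolding stable_residues_def by blast
qed

lemma normalize_lines:
  assumes "det2 a b \<noteq> 0"
  obtains c :: "complex ^ 2 ^ 2" where "invertible c" "c *v a = axis 1 1" "c *v b = axis 2 1"
proof -
  define B where "B = (\<chi> i j. if j = 1 then a $ i else b $ i :: complex ^ 2 ^ 2)"
  have "invertible B"
    using assms by (simp add: invertible_det_nz det_2 B_def det2_def mult.commute)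
  moreover have "B *v axis 1 1 = a" "B *v axis 2 1 = b"
    by (simp_all add: vec2_eq_iff vmult_entry2 B_def axis_def)
  ultimately have "matrix_inv B *v a = axis 1 1" "matrix_inv B *v b = axis 2 1"
    using matrix_cancel(4)[of B] by metis+
  with \<open>invertible B\<close> show thesis
    by (intro that[of "matrix_inv B"] invertible_matrix_inv)
qed

lemma conjugate_by:
  assumes "invertible c"
  shows "conjugate N (\<lambda>i. c ** (N i ** matrix_inv c))"
    "\<And>i. c ** N i = (c ** (N i ** matrix_inv c)) ** c"
  using assms unfolding conjugate_def
  by (auto intro!: exI[of _ c] simp: matrix_mul_assoc[symmetric] matrix_inv_both)

lemma in_span_axis:
  "v \<in> vec.span {axis 1 (1::complex)} \<longleftrightarrow> v $ 2 = 0" "v \<in> vec.span {axis 2 (1::complex)} \<longleftrightarrow> v $ 1 = 0"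
  for v :: "complex ^ 2"
  by (auto simp: in_span1 vec2_eq_iff axis_def)

lemma nilpotent2_range_axis:
  fixes M :: "complex ^ 2 ^ 2"
  assumes "M ** M = 0"
  shows "range ((*v) M) = vec.span {axis 1 1} \<Longrightarrow> M $ 1 $ 1 = 0 \<and> M $ 2 $ 1 = 0 \<and> M $ 2 $ 2 = 0"
    and "range ((*v) M) = vec.span {axis 2 1} \<Longrightarrow> M $ 1 $ 1 = 0 \<and> M $ 1 $ 2 = 0 \<and> M $ 2 $ 2 = 0"
proof -
  have col: "(M *v axis b 1) $ a = M $ a $ b" for a b
    using exhaust_2[of b] by (auto simp: vmult_entry2 axis_def)
  have nil: "M $ 2 $ 2 = - M $ 1 $ 1" using assms by (simp add: nilpotent2_entries)
  {
    assume "range ((*v) M) = vec.span {axis 1 1}"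
    then have "M *v axis b 1 \<in> vec.span {axis 1 1}" for b by blast
    then have "M $ 2 $ b = 0" for b
      unfolding in_span_axis col .
    with nil show "M $ 1 $ 1 = 0 \<and> M $ 2 $ 1 = 0 \<and> M $ 2 $ 2 = 0" by simp
  next
    assume "range ((*v) M) = vec.span {axis 2 1}"
    then have "M *v axis b 1 \<in> vec.span {axis 2 1}" for b by blast
    then have "M $ 1 $ b = 0" for b
      unfolding in_span_axis col .
    with nil show "M $ 1 $ 1 = 0 \<and> M $ 1 $ 2 = 0 \<and> M $ 2 $ 2 = 0" by simp
  }
qed

text \<open>From \<open>c N_i = N_i^T c\<close> one gets a matrix \<open>d\<close> that anticommutes with all residues. It maps the
  kernel of each residue to itself, so it is diagonal in a basis \<open>a, b\<close> that spans two distinct flags.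
  Anticommutation with the residue of image \<open>a\<close> makes the two eigenvalues opposite. A matrix that
  anticommutes with \<open>diag(\<alpha>, -\<alpha>)\<close> is off-diagonal, and if it is nilpotent, it is strictly triangular.\<close>

theorem self_transpose_imp_split:
  fixes N :: "'n::finite \<Rightarrow> complex ^ 2 ^ 2"
  assumes N: "stable_residues N" and con: "conjugate N (\<lambda>i. transpose (N i))"
  obtains S l where "conjugate N (split_residues S l)"
proof -
  have N': "N i \<noteq> 0" "N i ** N i = 0" for i using N by (auto simp: stable_residues_def)
  obtain c where c: "invertible c" "\<And>i. c ** N i = transpose (N i) ** c"
    using con by (auto simp: conjugate_def)
  \<comment> \<open>The adjugate of a \<open>2 \<times> 2\<close> matrix is its transpose conjugated by the rotation \<open>K\<close>; for trace-free
    \<open>N\<close> the adjugate is \<open>- N\<close>.\<close>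
  define K where "K = (vector [vector [0, -1], vector [1, 0]] :: complex ^ 2 ^ 2)"
  have K: "K $ 1 $ 1 = 0" "K $ 1 $ 2 = -1" "K $ 2 $ 1 = 1" "K $ 2 $ 2 = 0"
    by (auto simp: K_def)
  have Kinv: "invertible K" by (simp add: invertible_det_nz det_2 K)
  have KN: "K ** transpose (N i) = - (N i ** K)" for i
  proof -
    have "N i $ 2 $ 2 = - N i $ 1 $ 1" using N'(2)[of i] by (simp add: nilpotent2_entries)
    then show ?thesis by (simp add: mat2_eq_iff mult_entry2 K transpose_def)
  qed
  define d where "d = K ** c"
  have d: "invertible d" using Kinv c(1) by (simp add: d_def invertible_mult)
  have dN: "d ** N i = - (N i ** d)" for i
  proof -
    have "d ** N i = (K ** transpose (N i)) ** c"
      by (simp add: d_def c(2) matrix_mul_assoc[symmetric])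
    also have "\<dots> = - (N i ** d)"
      unfolding KN by (simp add: d_def mat2_eq_iff mult_entry2 algebra_simps)
    finally show ?thesis .
  qed
  obtain i j where ij: "range ((*v) (N i)) \<noteq> range ((*v) (N j))"
    using N unfolding stable_residues_def by blast
  obtain a where a: "a \<noteq> 0" "range ((*v) (N i)) = vec.span {a}" "\<And>v. N i *v v = 0 \<longleftrightarrow> v \<in> vec.span {a}"
    by (rule nilpotent2_kernel[OF N'(2)[of i] N'(1)[of i]]) (rule that)
  obtain b where b: "b \<noteq> 0" "range ((*v) (N j)) = vec.span {b}" "\<And>v. N j *v v = 0 \<longleftrightarrow> v \<in> vec.span {b}"
    by (rule nilpotent2_kernel[OF N'(2)[of j] N'(1)[of j]]) (rule that)
  have "det2 a b \<noteq> 0"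
    using det2_eq_0[OF b(1), of a] span1_eqI[OF _ a(1), of b] ij a(2) b(2) by auto
  then obtain e :: "complex ^ 2 ^ 2" where e: "invertible e" "e *v a = axis 1 1" "e *v b = axis 2 1"
    by (rule normalize_lines)
  define M where "M = (\<lambda>i. e ** (N i ** matrix_inv e))"
  define D where "D = e ** (d ** matrix_inv e)"
  have M2: "M m ** M m = 0" for m
  proof -
    have "M m ** M m = e ** ((N m ** N m) ** matrix_inv e)"
      by (simp add: M_def matrix_mul_assoc[symmetric] matrix_cancel e(1))
    then show ?thesis by (simp add: N'(2))
  qed
  have DM: "D ** M m = - (M m ** D)" for m
  proof -
    have "D ** M m = e ** ((d ** N m) ** matrix_inv e)"
      by (simp add: D_def M_def matrix_mul_assoc[symmetric] matrix_cancel e(1))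
    also have "\<dots> = - (e ** ((N m ** d) ** matrix_inv e))"
      unfolding dN by (simp add: mat2_eq_iff mult_entry2 algebra_simps)
    also have "(e ** ((N m ** d) ** matrix_inv e)) = M m ** D"
      by (simp add: D_def M_def matrix_mul_assoc[symmetric] matrix_cancel e(1))
    finally show ?thesis .
  qed
  have eig: "d *v v \<in> vec.span {v}" if "\<And>w. N m *v w = 0 \<longleftrightarrow> w \<in> vec.span {v}" for m v
  proof -
    have "N m *v (d *v v) = - (d *v (N m *v v))"
    proof -
      have "N m ** d = - (d ** N m)" by (simp add: dN)
      then show ?thesis by (simp add: matrix_vector_mul_assoc vec2_eq_iff vmult_entry2 algebra_simps)
    qed
    moreover have "N m *v v = 0" by (simp add: that vec.span_base)
    ultimately show ?thesis by (simp add: that[symmetric])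
  qed
  obtain \<alpha> where \<alpha>: "d *v a = \<alpha> *s a" using eig[OF a(3)] by (auto simp: in_span1)
  obtain \<beta> where \<beta>: "d *v b = \<beta> *s b" using eig[OF b(3)] by (auto simp: in_span1)
  have ea: "matrix_inv e *v axis 1 1 = a" "matrix_inv e *v axis 2 1 = b"
    using e matrix_cancel(4)[OF e(1)] by metis+
  have "D *v axis 1 1 = \<alpha> *s axis 1 1" "D *v axis 2 1 = \<beta> *s axis 2 1"
    by (simp_all add: D_def matrix_vector_mul_assoc[symmetric] ea \<alpha> \<beta> mult_smult e)
  then have D: "D $ 1 $ 1 = \<alpha>" "D $ 2 $ 1 = 0" "D $ 1 $ 2 = 0" "D $ 2 $ 2 = \<beta>"
    by (auto simp: vec2_eq_iff vmult_entry2 axis_def)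
  have "invertible D"
    unfolding D_def by (intro invertible_mult e d invertible_matrix_inv)
  then have \<alpha>0: "\<alpha> \<noteq> 0" by (auto simp: invertible_det_nz det_2 D)
  have Mi: "range ((*v) (M i)) = vec.span {axis 1 1}"
    using range_conjugate[OF e(1) conjugate_by(2)[OF e(1)], of N i]
    by (simp add: M_def a(2) image_span1 e)
  from nilpotent2_range_axis(1)[OF M2 this]
  have Mi0: "M i $ 1 $ 1 = 0" "M i $ 2 $ 1 = 0" "M i $ 2 $ 2 = 0" by auto
  have "M i $ 1 $ 2 \<noteq> 0"
  proof
    assume "M i $ 1 $ 2 = 0"
    with Mi0 have "M i = 0" by (simp add: mat2_eq_iff)
    then have "(axis 1 1 :: complex ^ 2) \<in> {0}"
      using Mi vec.span_base[of "axis 1 1" "{axis 1 1}"] by auto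
    then show False by (simp add: vec2_eq_iff axis_def)
  qed
  moreover have "\<alpha> * M i $ 1 $ 2 = - (M i $ 1 $ 2 * \<beta>)"
    using DM[of i] by (simp add: mat2_eq_iff mult_entry2 D)
  moreover from this have "M i $ 1 $ 2 * (\<alpha> + \<beta>) = 0"
    by (simp add: algebra_simps)
  ultimately have \<beta>\<alpha>: "\<beta> = - \<alpha>"
    by (simp add: eq_neg_iff_add_eq_0 add.commute)
  have diag: "M m $ 1 $ 1 = 0" "M m $ 2 $ 2 = 0" for m
  proof -
    have "\<alpha> * M m $ 1 $ 1 = - (M m $ 1 $ 1 * \<alpha>)"
      using DM[of m] by (simp add: mat2_eq_iff mult_entry2 D \<beta>\<alpha>)
    then have "2 * (\<alpha> * M m $ 1 $ 1) = 0" by (simp add: algebra_simps)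
    with \<alpha>0 show "M m $ 1 $ 1 = 0" by simp
    with M2[of m] show "M m $ 2 $ 2 = 0" by (simp add: nilpotent2_entries)
  qed
  define S where "S = {m. M m $ 1 $ 2 \<noteq> 0}"
  define l where "l = (\<lambda>m. if m \<in> S then M m $ 1 $ 2 else - M m $ 2 $ 1)"
  have "M = split_residues S l"
  proof
    fix m
    have "M m $ 1 $ 2 * M m $ 2 $ 1 = 0"
      using M2[of m] diag[of m] by (simp add: nilpotent2_entries)
    then show "M m = split_residues S l m"
      using diag[of m] by (auto simp: mat2_eq_iff split_residues_entries S_def l_def)
  qed
  with conjugate_by(1)[OF e(1), of N] show thesis
    using that[of S l] by (simp add: M_def)
qed

section \<open>The components \<open>Z\<close>\<close>

lemma hol_section_product:
  "hol_section product_bundle U s \<longleftrightarrow> (\<forall>p\<in>U. vec_hol s p)"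
  by (auto simp: hol_section_iff product_bundle_def)

lemma generates_axis: "generates product_bundle V (\<lambda>_. axis b 1) (\<lambda>_. vec.span {axis b (1::complex)})"
  by (simp add: generates_def hol_section_product axis_eq_0_iff)

text \<open>The coordinate lines \<open>e_1\<close> and \<open>e_2\<close> of the product bundle give the splitting, and the product of
  the coordinates is a perfect pairing between them.\<close>

lemma split_residues_in_Z:
  fixes x :: "'n::finite \<Rightarrow> cp1"
  assumes x: "inj x" and st: "stable_residues (split_residues S l)"
  shows "residue_class x (split_residues S l) \<in> Z x S"
proof -
  define P where "P = model x (split_residues S l)"
  define L0 where "L0 = (\<lambda>_ :: cp1. vec.span {axis 1 1 :: complex ^ 2})"
  define L1 where "L1 = (\<lambda>_ :: cp1. vec.span {axis 2 1 :: complex ^ 2})"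
  have l0: "l i \<noteq> 0" for i using st by (simp add: stable_split_residues)
  have sum0: "(\<Sum>i\<in>UNIV. split_residues S l i) = 0"
    using st by (simp add: stable_residues_def)
  have PO: "P \<in> H0_objects x"
    unfolding P_def by (rule model_in_H0_objects[OF x st])
  have bunP: "bun P = product_bundle" by (simp add: P_def model_def)
  have res: "res x P i = split_residues S l i" for i
    using in_frame_res[OF x in_frame_model sum0] bunP
    by (simp add: P_def hol_bundle_product)
  have g0: "generates (bun P) V (\<lambda>_. axis 1 1) L0" and g1: "generates (bun P) V (\<lambda>_. axis 2 1) L1" for V
    unfolding bunP L0_def L1_def by (rule generates_axis)+
  have higgs: "higgs P p $ 1 $ 1 = 0" "higgs P p $ 2 $ 2 = 0" for p
    by (simp_all add: P_def model_def log_matrix_def split_residues_entries)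
  have off: "off_diagonal_splitting x S L0 L1 P"
    unfolding off_diagonal_splitting_def
  proof (intro conjI allI ballI impI)
    show "line_subbundle (bun P) L0" "line_subbundle (bun P) L1"
      using generates_UNIV(1)[OF g0] generates_UNIV(1)[OF g1] by auto
    fix p
    show "L0 p \<inter> L1 p = {0}"
      by (auto simp: L0_def L1_def in_span_axis vec2_eq_iff)
    fix v :: "complex ^ 2"
    have "v = vector [v $ 1, 0] + vector [0, v $ 2]" by (simp add: vec2_eq_iff)
    moreover have "vector [v $ 1, 0] \<in> L0 p" "vector [0, v $ 2] \<in> L1 p"
      by (auto simp: L0_def L1_def in_span_axis)
    ultimately show "\<exists>u\<in>L0 p. \<exists>w\<in>L1 p. v = u + w" by blast
  next
    fix i
    show "flag P i = (if i \<in> S then L0 (x i) else L1 (x i))"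
      by (simp add: P_def model_def range_split_residues[of l i S] l0[of i] L0_def L1_def)
  next
    fix p v
    assume "v \<in> L0 p" then show "higgs P p *v v \<in> L1 p"
      by (simp add: L0_def L1_def in_span_axis vmult_entry2 higgs)
  next
    fix p v
    assume "v \<in> L1 p" then show "higgs P p *v v \<in> L0 p"
      by (simp add: L0_def L1_def in_span_axis vmult_entry2 higgs)
  next
    fix i v assume "i \<in> S" "v \<in> L0 (x i)"
    then show "res x P i *v v = 0"
      by (simp add: L0_def in_span_axis res vec2_eq_iff vmult_entry2 split_residues_entries)
  next
    fix i v assume "i \<in> - S" "v \<in> L1 (x i)"
    then show "res x P i *v v = 0"
      by (simp add: L1_def in_span_axis res vec2_eq_iff vmult_entry2 split_residues_entries)
  qed
  have inv: "inverse_line_subbundle (bun P) L0 L1"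
    unfolding inverse_line_subbundle_def
  proof (intro exI[of _ "\<lambda>p u v. u $ 1 * v $ 2"] conjI allI ballI impI, goal_cases)
    case (1 p a b u v)
    show ?case by simp
  next
    case (2 V s t)
    then have "vec_hol s p" "vec_hol t p" if "p \<in> V" for p
      using that by (auto simp: generates_def bunP hol_section_product)
    then show ?case
      by (auto simp: hol_on_iff vec_hol_def intro!: hol_at_mult)
  next
    case (3 V s t p)
    then have s: "s p \<noteq> 0" "L0 p = vec.span {s p}" and t: "t p \<noteq> 0" "L1 p = vec.span {t p}"
      by (auto simp: generates_def)
    have "s p \<in> L0 p" "t p \<in> L1 p" unfolding s(2) t(2) by (auto intro: vec.span_base)
    with s(1) t(1) show ?case
      by (auto simp: L0_def L1_def in_span_axis vec2_eq_iff)
  qed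
  have "P \<in> residue_class x (split_residues S l)"
    unfolding P_def by (rule model_mem_residue_class[OF x st])
  moreover have "sl2r_higgs x P"
    using PO inv off by (auto simp: sl2r_higgs_def H0_objects_def sl2c_higgs_def)
  moreover have "trivial_line_subbundle (bun P) L0" "trivial_line_subbundle (bun P) L1"
    using g0 g1 by (auto simp: trivial_line_subbundle_def)
  ultimately show ?thesis
    unfolding Z_def using off residue_class_in_H0[OF x st] by blast
qed

lemma trivial_line_in_frame:
  assumes E: "hol_bundle E" and g: "hol_frame E UNIV g" and L: "trivial_line_subbundle E L"
  obtains a where "a \<noteq> 0" "\<And>p. L p = vec.span {g p *v a}"
proof -
  obtain s where s: "hol_section E UNIV s" "\<And>p. s p \<noteq> 0" "\<And>p. L p = vec.span {s p}"
    using L by (auto simp: trivial_line_subbundle_def generates_def)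
  have inv: "invertible (g p)" for p using g by (simp add: hol_frame_def)
  have eq: "matrix_inv (g p) *v s p = matrix_inv (g Infty) *v s Infty" for p
    by (rule vec_hol_UNIV_const[where v = "\<lambda>p. matrix_inv (g p) *v s p"])
       (rule section_coords[OF E g open_UNIV s(1) UNIV_I UNIV_I])
  have sg: "s p = g p *v (matrix_inv (g Infty) *v s Infty)" for p
    by (simp only: eq[of p, symmetric] matrix_cancel(3)[OF inv])
  show thesis
  proof (rule that[of "matrix_inv (g Infty) *v s Infty"])
    show "matrix_inv (g Infty) *v s Infty \<noteq> 0"
      using sg[of Infty] s(2)[of Infty] by auto
    show "L p = vec.span {g p *v (matrix_inv (g Infty) *v s Infty)}" for p
      unfolding sg[of p, symmetric] by (rule s(3))
  qed
qed

text \<open>Trivial line subbundles of a trivial bundle are constant lines, because a global section has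
  constant coordinates. In a basis adapted to \<open>L_0\<close> and \<open>L_1\<close> every residue is nilpotent with image a
  coordinate line, so it is strictly triangular.\<close>

lemma Z_imp_split:
  fixes x :: "'n::finite \<Rightarrow> cp1"
  assumes x: "inj x" and C: "C \<in> Z x S"
  obtains l where "stable_residues (split_residues S l)" "C = residue_class x (split_residues S l)"
proof -
  obtain P L0 L1 where CH: "C \<in> H0 x" and P: "P \<in> C"
    and L: "trivial_line_subbundle (bun P) L0" "trivial_line_subbundle (bun P) L1"
    and off: "off_diagonal_splitting x S L0 L1 P"
    using C unfolding Z_def by blast
  have PO: "P \<in> H0_objects x"
    using in_quotient_imp_subset[OF equiv_H0_iso[OF x]] CH P unfolding H0_def by blast
  then have E: "hol_bundle (bun P)"
    by (auto simp: H0_objects_def sl2c_higgs_def quasi_parabolic_higgs_def)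
  obtain g N where fr: "in_frame x P g N" and N: "stable_residues N"
    using H0_object_in_frame[OF x PO] .
  have CN: "C = residue_class x N" by (rule H0_residue_class[OF x CH P fr N])
  have g: "hol_frame (bun P) UNIV g" using fr by (simp add: in_frame_def)
  have inv: "invertible (g p)" for p using g by (simp add: hol_frame_def)
  obtain a where a: "a \<noteq> 0" "\<And>p. L0 p = vec.span {g p *v a}"
    using trivial_line_in_frame[OF E g L(1)] by blast
  obtain b where b: "b \<noteq> 0" "\<And>p. L1 p = vec.span {g p *v b}"
    using trivial_line_in_frame[OF E g L(2)] by blast
  have "det2 a b \<noteq> 0"
  proof
    assume "det2 a b = 0"
    then obtain k where "a = k *s b" using det2_eq_0[OF b(1)] by (auto simp: in_span1)
    then have "g Infty *v a \<in> L1 Infty" by (auto simp: b(2) in_span1 mult_smult)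
    moreover have "g Infty *v a \<in> L0 Infty" by (simp add: a(2) vec.span_base)
    ultimately have "g Infty *v a = 0"
      using off unfolding off_diagonal_splitting_def by blast
    then show False using a(1) matrix_cancel(4)[OF inv, of Infty a] by simp
  qed
  then obtain c :: "complex ^ 2 ^ 2" where c: "invertible c" "c *v a = axis 1 1" "c *v b = axis 2 1"
    by (rule normalize_lines)
  define M where "M = (\<lambda>i. c ** (N i ** matrix_inv c))"
  have con: "conjugate N M" unfolding M_def by (rule conjugate_by(1)[OF c(1)])
  have M: "stable_residues M" by (rule conjugate_stable[OF N con])
  have ranN: "range ((*v) (N i)) = vec.span {if i \<in> S then a else b}" for i
  proof -
    have "(\<lambda>v. g (x i) *v v) ` range ((*v) (N i)) = flag P i"
      using fr by (simp add: in_frame_def image_image)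
    also have "\<dots> = (\<lambda>v. g (x i) *v v) ` vec.span {if i \<in> S then a else b}"
      using off unfolding off_diagonal_splitting_def by (simp add: a(2) b(2) image_span1)
    finally have eq: "(\<lambda>v. g (x i) *v v) ` range ((*v) (N i)) = (\<lambda>v. g (x i) *v v) ` vec.span {if i \<in> S then a else b}" .
    have "inj (\<lambda>v. g (x i) *v v)"
      by (rule inj_on_inverseI[of _ "\<lambda>v. matrix_inv (g (x i)) *v v"]) (simp add: matrix_cancel inv)
    with eq show ?thesis by (simp only: inj_image_eq_iff)
  qed
  have ranM: "range ((*v) (M i)) = vec.span {if i \<in> S then axis 1 1 else axis 2 1}" for i
    using range_conjugate[OF c(1) conjugate_by(2)[OF c(1)], of N i]
    by (simp add: M_def ranN image_span1 c)
  define l where "l = (\<lambda>i. if i \<in> S then M i $ 1 $ 2 else - M i $ 2 $ 1)"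
  have "M = split_residues S l"
  proof
    fix i
    have "M i ** M i = 0" using M by (simp add: stable_residues_def)
    from nilpotent2_range_axis[OF this] ranM[of i]
    show "M i = split_residues S l i"
      by (auto simp: mat2_eq_iff split_residues_entries l_def split: if_splits)
  qed
  with M con CN show thesis
    using that[of l] residue_class_eq_iff[OF x N M] by simp
qed

text \<open>The nonzero entries over \<open>S\<close> and those over its complement both sum to zero, and a single
  nonzero number does not.\<close>

lemma split_residues_admissible:
  fixes S :: "'n::finite set"
  assumes "stable_residues (split_residues S l)"
  shows "2 \<le> card S" "2 \<le> card (- S)" "card S \<le> CARD('n) - 2"
proof -
  have l: "\<And>i. l i \<noteq> 0" "sum l S = 0" "sum l (- S) = 0" "S \<noteq> {}" "- S \<noteq> {}"
    using assms by (auto simp: stable_split_residues)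
  have two: "2 \<le> card T" if "sum l T = 0" "T \<noteq> {}" for T :: "'n set"
  proof -
    have "card T \<noteq> 0" using that(2) by (simp add: card_eq_0_iff)
    moreover have "card T \<noteq> 1"
    proof
      assume "card T = 1"
      then obtain i where "T = {i}" by (rule card_1_singletonE)
      with that(1) l(1)[of i] show False by simp
    qed
    ultimately show ?thesis by linarith
  qed
  show S2: "2 \<le> card S" and Sc: "2 \<le> card (- S)"
    using two l by auto
  have "card S + card (- S) = CARD('n)"
    by (metis Compl_eq_Diff_UNIV card_Diff_subset card_mono finite le_add_diff_inverse subset_UNIV)
  with Sc show "card S \<le> CARD('n) - 2" by linarith
qed

theorem fixed_points_eq_H0_real:
  fixes x :: "'n::finite \<Rightarrow> cp1"
  assumes x: "inj x"
  shows "{C \<in> H0 x. Theta x C = C} = H0_real x i1"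
proof (intro set_eqI iffI)
  fix C assume "C \<in> {C \<in> H0 x. Theta x C = C}"
  then have C: "C \<in> H0 x" "Theta x C = C" by auto
  obtain N where N: "stable_residues N" "C = residue_class x N" by (rule H0_cases[OF x C(1)])
  have "residue_class x (\<lambda>i. transpose (N i)) = residue_class x N"
    using C(2) Theta_residue_class[OF x N(1)] N(2) by simp
  then have "conjugate (\<lambda>i. transpose (N i)) N"
    using residue_class_eq_iff[OF x stable_residues_transpose[OF N(1)] N(1)] by simp
  then obtain S l where Sl: "conjugate N (split_residues S l)"
    using self_transpose_imp_split[OF N(1)] conjugate_sym by blast
  have "\<exists>S l. i1 \<in> S \<and> conjugate N (split_residues S l)"
  proof (cases "i1 \<in> S")
    case False
    then show ?thesis
      using conjugate_trans[OF Sl conjugate_split_swap] by (intro exI[of _ "- S"]) auto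
  qed (use Sl in blast)
  then obtain S l where i1: "i1 \<in> S" and Sl: "conjugate N (split_residues S l)" by blast
  have st: "stable_residues (split_residues S l)" by (rule conjugate_stable[OF N(1) Sl])
  have "C = residue_class x (split_residues S l)"
    using Sl N residue_class_eq_iff[OF x N(1) st] by simp
  then have "C \<in> Z x S" using split_residues_in_Z[OF x st] by simp
  moreover have "S \<in> admissible i1"
    using i1 split_residues_admissible[OF st] by (simp add: admissible_def)
  ultimately show "C \<in> H0_real x i1" by (auto simp: H0_real_def)
next
  fix C assume "C \<in> H0_real x i1"
  then obtain S where C: "C \<in> Z x S" by (auto simp: H0_real_def)
  obtain l where l: "stable_residues (split_residues S l)" "C = residue_class x (split_residues S l)"
    by (rule Z_imp_split[OF x C])
  have "Theta x C = C"
    unfolding l(2) Theta_residue_class[OF x l(1)]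
    using residue_class_eq_iff[OF x stable_residues_transpose[OF l(1)] l(1)]
      conjugate_sym[OF conjugate_split_transpose] by simp
  then show "C \<in> {C \<in> H0 x. Theta x C = C}"
    using residue_class_in_H0[OF x l(1)] l(2) by simp
qed

section \<open>Chart parameters\<close>

definition chart_residues ::
    "'n set \<Rightarrow> (complex ^ 'n::finite) \<times> (complex ^ 'n) \<Rightarrow> 'n \<Rightarrow> complex ^ 2 ^ 2" where
  "chart_residues A q i = param_residue A i (fst q $ i) (snd q $ i)"

definition chart_params :: "'n set \<Rightarrow> 'n \<Rightarrow> 'n \<Rightarrow> ((complex ^ 'n::finite) \<times> (complex ^ 'n)) set" where
  "chart_params A j k = {q. fst q $ j = 0 \<and> fst q $ k = 0 \<and> snd q $ j = 1 \<and> (\<forall>i. snd q $ i \<noteq> 0) \<and>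
     (\<Sum>i\<in>UNIV. chart_residues A q i) = 0}"

lemma stable_chart_residues:
  assumes q: "q \<in> chart_params A j k" and jk: "j \<in> A" "k \<notin> A"
  shows "stable_residues (chart_residues A q)"
proof -
  have l: "snd q $ i \<noteq> 0" for i using q by (simp add: chart_params_def)
  have "range ((*v) (chart_residues A q j)) \<noteq> range ((*v) (chart_residues A q k))"
  proof -
    have e: "vector [1, 0] = (axis 1 1 :: complex ^ 2)" "vector [0, 1] = (axis 2 1 :: complex ^ 2)"
      by (auto simp: vec2_eq_iff axis_def)
    have "fst q $ j = 0" "fst q $ k = 0" using q by (auto simp: chart_params_def)
    then show ?thesis
      using jk span_axis_distinct
      by (simp add: chart_residues_def range_param_residue[OF l] param_line_def e)
  qed
  moreover have "(\<Sum>i\<in>UNIV. chart_residues A q i) = 0"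
    using q by (simp add: chart_params_def)
  moreover have "chart_residues A q i \<noteq> 0 \<and> chart_residues A q i ** chart_residues A q i = 0" for i
    using l[of i] by (simp add: chart_residues_def param_residue_nonzero param_residue_nilpotent)
  ultimately show ?thesis
    unfolding stable_residues_def by blast
qed

text \<open>The residue at \<open>j\<close> is the elementary matrix \<open>E_12\<close> for both parameters, so the conjugating matrix
  commutes with it and is upper triangular with equal diagonal entries. Compatibility with the residues
  at \<open>k\<close>, multiples of \<open>E_21\<close>, then makes it scalar.\<close>

lemma chart_params_unique:
  assumes q: "q \<in> chart_params A j k" and q': "q' \<in> chart_params A j k" and jk: "j \<in> A" "k \<notin> A"
    and con: "conjugate (chart_residues A q) (chart_residues A q')"
  shows "q = q'"
proof -
  obtain c where c: "invertible c" "\<And>i. c ** chart_residues A q i = chart_residues A q' i ** c"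
    using con by (auto simp: conjugate_def)
  have u: "fst q $ j = 0" "fst q $ k = 0" "snd q $ j = 1" "fst q' $ j = 0" "fst q' $ k = 0" "snd q' $ j = 1"
    and l: "snd q $ i \<noteq> 0" for i
    using q q' by (auto simp: chart_params_def)
  have c1: "c $ 2 $ 1 = 0" "c $ 2 $ 2 = c $ 1 $ 1"
    using c(2)[of j] jk u by (auto simp: mat2_eq_iff mult_entry2 chart_residues_def param_residue_entries)
  have "c $ 1 $ 2 * snd q $ k = 0"
    using c(2)[of k] jk u by (auto simp: mat2_eq_iff mult_entry2 chart_residues_def param_residue_entries)
  then have c2: "c $ 1 $ 2 = 0" using l by simp
  have c0: "c $ 1 $ 1 \<noteq> 0"
    using c(1) c1 c2 by (auto simp: invertible_det_nz det_2)
  have eq: "chart_residues A q i = chart_residues A q' i" for i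
    using c(2)[of i] c0 c1 c2 by (simp add: mat2_eq_iff mult_entry2)
  have "snd q $ i = snd q' $ i \<and> fst q $ i = fst q' $ i" for i
  proof -
    have "snd q $ i = snd q' $ i \<and> snd q $ i * fst q $ i = snd q' $ i * fst q' $ i"
      using eq[of i] by (cases "i \<in> A") (auto simp: mat2_eq_iff chart_residues_def param_residue_entries)
    then show ?thesis using l[of i] by auto
  qed
  then show ?thesis by (auto simp: prod_eq_iff vec_eq_iff)
qed

lemma product_frame_constant:
  assumes "hol_frame product_bundle UNIV (g :: cp1 \<Rightarrow> complex ^ 2 ^ 2)"
  shows "g p = g Infty"
proof (rule mat_hol_UNIV_const)
  fix p
  have "mat_hol (\<lambda>q. matrix_inv (mat 1) ** g q) p"
    by (rule hol_frame_coords[OF assms, of UNIV]) (auto simp: product_bundle_def)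
  then show "mat_hol g p" by simp
qed

text \<open>A global frame of the product bundle is constant, so the residues of a representative on the
  product bundle are conjugate to those in any frame.\<close>

lemma has_params_iff:
  fixes x :: "'n::finite \<Rightarrow> cp1"
  assumes x: "inj x" and jk: "j \<in> A" "k \<notin> A" and C: "C \<in> H0 x"
  shows "has_params x A j k C q \<longleftrightarrow> q \<in> chart_params A j k \<and> C = residue_class x (chart_residues A q)"
proof
  assume hp: "has_params x A j k C q"
  obtain P where P: "P \<in> C" "bun P = product_bundle"
    and res: "\<And>i. res x P i = chart_residues A q i"
    using hp by (auto simp: has_params_def chart_residues_def split_def)
  have ul: "fst q $ j = 0" "fst q $ k = 0" "snd q $ j = 1" "\<forall>i. snd q $ i \<noteq> 0"
    using hp by (auto simp: has_params_def split_def)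
  have PO: "P \<in> H0_objects x"
    using in_quotient_imp_subset[OF equiv_H0_iso[OF x]] C P unfolding H0_def by blast
  obtain g N where fr: "in_frame x P g N" and N: "stable_residues N"
    using H0_object_in_frame[OF x PO] .
  have sumN: "(\<Sum>i\<in>UNIV. N i) = 0" using N by (simp add: stable_residues_def)
  have g: "hol_frame product_bundle UNIV g" using fr P(2) by (simp add: in_frame_def)
  define c where "c = g Infty"
  have gc: "g p = c" for p unfolding c_def by (rule product_frame_constant[OF g])
  have c: "invertible c" using g by (simp add: c_def hol_frame_def)
  have "res x P i = c ** (N i ** matrix_inv c)" for i
    using in_frame_res[OF x fr sumN] P(2) by (simp add: hol_bundle_product gc matrix_mul_assoc)
  then have eq: "chart_residues A q = (\<lambda>i. c ** (N i ** matrix_inv c))"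
    using res by auto
  have con: "conjugate N (chart_residues A q)" unfolding eq by (rule conjugate_by(1)[OF c])
  have st: "stable_residues (chart_residues A q)" by (rule conjugate_stable[OF N con])
  have "C = residue_class x N" by (rule H0_residue_class[OF x C P(1) fr N])
  then have "C = residue_class x (chart_residues A q)"
    using residue_class_eq_iff[OF x N st] con by simp
  moreover have "q \<in> chart_params A j k"
    using st ul by (simp add: chart_params_def stable_residues_def)
  ultimately show "q \<in> chart_params A j k \<and> C = residue_class x (chart_residues A q)" by blast
next
  assume "q \<in> chart_params A j k \<and> C = residue_class x (chart_residues A q)"
  then have q: "q \<in> chart_params A j k" and Cq: "C = residue_class x (chart_residues A q)" by auto
  have ul: "fst q $ j = 0" "fst q $ k = 0" "snd q $ j = 1" "\<And>i. snd q $ i \<noteq> 0"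
    using q by (auto simp: chart_params_def)
  have st: "stable_residues (chart_residues A q)" by (rule stable_chart_residues[OF q jk])
  define P where "P = model x (chart_residues A q)"
  have "P \<in> C" unfolding Cq P_def by (rule model_mem_residue_class[OF x st])
  moreover have bun: "bun P = product_bundle" by (simp add: P_def model_def)
  moreover have "flag P i = param_line A i (fst q $ i)" for i
    using range_param_residue[OF ul(4)[of i], of A i "fst q $ i"]
    by (simp add: P_def model_def chart_residues_def)
  moreover have "res x P i = param_residue A i (fst q $ i) (snd q $ i)" for i
    using in_frame_res[OF x in_frame_model, of "chart_residues A q" i] st bun
    by (simp add: P_def hol_bundle_product stable_residues_def chart_residues_def)
  ultimately show "has_params x A j k C q"
    using ul by (auto simp: has_params_def split_def)
qed

definition chart_valid :: "'n set \<Rightarrow> 'n \<Rightarrow> 'n \<Rightarrow> 'n \<Rightarrow> ((complex ^ 'n::finite) \<times> (complex ^ 'n)) set" where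
  "chart_valid A j k i0 = {q \<in> chart_params A j k. i0 \<in> A \<or> fst q $ i0 \<noteq> 0}"

lemma chart_dom_eq:
  assumes x: "inj x" and jk: "j \<in> A" "k \<notin> A"
  shows "chart_dom x (A, j, k, i0) = (\<lambda>q. residue_class x (chart_residues A q)) ` chart_valid A j k i0"
proof (intro set_eqI iffI)
  fix C assume "C \<in> chart_dom x (A, j, k, i0)"
  then obtain u l where C: "C \<in> H0 x" "has_params x A j k C (u, l)" "i0 \<in> A \<or> u $ i0 \<noteq> 0" by auto
  then have "C = residue_class x (chart_residues A (u, l))" "(u, l) \<in> chart_valid A j k i0"
    using has_params_iff[OF x jk C(1), of "(u, l)"] by (simp_all add: chart_valid_def)
  then show "C \<in> (\<lambda>q. residue_class x (chart_residues A q)) ` chart_valid A j k i0"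
    by (rule image_eqI)
next
  fix C assume "C \<in> (\<lambda>q. residue_class x (chart_residues A q)) ` chart_valid A j k i0"
  then obtain q where q: "q \<in> chart_params A j k" "i0 \<in> A \<or> fst q $ i0 \<noteq> 0"
    and C: "C = residue_class x (chart_residues A q)" by (auto simp: chart_valid_def)
  have CH: "C \<in> H0 x" unfolding C by (rule residue_class_in_H0[OF x stable_chart_residues[OF q(1) jk]])
  have "has_params x A j k C (fst q, snd q)"
    using has_params_iff[OF x jk CH] q(1) C by simp
  with q(2) show "C \<in> chart_dom x (A, j, k, i0)"
    unfolding chart_dom.simps by (intro CollectI conjI CH exI[of _ "fst q"] exI[of _ "snd q"])
qed

definition forget :: "'n \<Rightarrow> 'n \<Rightarrow> 'n \<Rightarrow> (complex ^ 'n::finite) \<times> (complex ^ 'n) \<Rightarrow>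
    (complex ^ 'n) \<times> (complex ^ 'n)" where
  "forget j k i0 q = (\<chi> i. if i \<in> {j, k, i0} then 0 else fst q $ i, \<chi> i. if i \<in> {j, k, i0} then 0 else snd q $ i)"

lemma chart_map_class:
  assumes x: "inj x" and jk: "j \<in> A" "k \<notin> A" and q: "q \<in> chart_params A j k"
  shows "chart_map x (A, j, k, i0) (residue_class x (chart_residues A q)) = forget j k i0 q"
proof -
  note st = stable_chart_residues[OF _ jk]
  have CH: "residue_class x (chart_residues A q) \<in> H0 x" by (rule residue_class_in_H0[OF x st[OF q]])
  have "(THE q'. has_params x A j k (residue_class x (chart_residues A q)) q') = q"
  proof (rule the_equality)
    show "has_params x A j k (residue_class x (chart_residues A q)) q"
      using has_params_iff[OF x jk CH] q by simp
    fix q' assume "has_params x A j k (residue_class x (chart_residues A q)) q'"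
    then have q': "q' \<in> chart_params A j k"
      and "residue_class x (chart_residues A q) = residue_class x (chart_residues A q')"
      using has_params_iff[OF x jk CH] by auto
    then have "conjugate (chart_residues A q) (chart_residues A q')"
      using residue_class_eq_iff[OF x st[OF q] st[OF q']] by simp
    from chart_params_unique[OF q q' jk this] show "q' = q" by simp
  qed
  then show ?thesis by (simp add: forget_def split_def)
qed

lemma chart_image:
  assumes x: "inj x" and jk: "j \<in> A" "k \<notin> A"
  shows "chart_map x (A, j, k, i0) ` (U \<inter> chart_dom x (A, j, k, i0)) =
    forget j k i0 ` {q \<in> chart_valid A j k i0. residue_class x (chart_residues A q) \<in> U}"
proof -
  have "U \<inter> chart_dom x (A, j, k, i0) = (\<lambda>q. residue_class x (chart_residues A q)) `
      {q \<in> chart_valid A j k i0. residue_class x (chart_residues A q) \<in> U}"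
    unfolding chart_dom_eq[OF x jk] by blast
  then have "chart_map x (A, j, k, i0) ` (U \<inter> chart_dom x (A, j, k, i0)) =
      (\<lambda>q. chart_map x (A, j, k, i0) (residue_class x (chart_residues A q))) `
      {q \<in> chart_valid A j k i0. residue_class x (chart_residues A q) \<in> U}"
    by (simp only: image_image)
  also have "\<dots> = forget j k i0 ` {q \<in> chart_valid A j k i0. residue_class x (chart_residues A q) \<in> U}"
    by (intro image_cong refl chart_map_class[OF x jk]) (simp add: chart_valid_def)
  finally show ?thesis .
qed

section \<open>Recovering the eliminated parameters\<close>

definition sum11 :: "(complex ^ 'n::finite) \<times> (complex ^ 'n) \<Rightarrow> complex" where
  "sum11 q = (\<Sum>i\<in>UNIV. snd q $ i * fst q $ i)"

definition sum12 :: "'n set \<Rightarrow> (complex ^ 'n::finite) \<times> (complex ^ 'n) \<Rightarrow> complex" where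
  "sum12 A q = (\<Sum>i\<in>UNIV. if i \<in> A then snd q $ i else snd q $ i * fst q $ i ^ 2)"

definition sum21 :: "'n set \<Rightarrow> (complex ^ 'n::finite) \<times> (complex ^ 'n) \<Rightarrow> complex" where
  "sum21 A q = (\<Sum>i\<in>UNIV. if i \<in> A then snd q $ i * fst q $ i ^ 2 else snd q $ i)"

lemma sum_chart_residues_eq_0:
  "(\<Sum>i\<in>UNIV. chart_residues A q i) = 0 \<longleftrightarrow> sum11 q = 0 \<and> sum12 A q = 0 \<and> sum21 A q = 0"
  by (auto simp: mat2_eq_iff chart_residues_def param_residue_entries sum11_def sum12_def sum21_def sum_negf)

definition with_j :: "'n \<Rightarrow> (complex ^ 'n::finite) \<times> (complex ^ 'n) \<Rightarrow> (complex ^ 'n) \<times> (complex ^ 'n)" where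
  "with_j j y = (fst y, \<chi> i. if i = j then 1 else snd y $ i)"

text \<open>Solves the entries (1,1) and (1,2) of the condition that the residues sum to zero for the
  parameters \<open>u, l\<close> at \<open>i0\<close>. With \<open>a\<close> and \<open>b\<close> the contributions of the other indices, the equations
  are \<open>l u = - a\<close>, together with \<open>l = - b\<close> if \<open>i0\<close> is in \<open>A\<close> and \<open>l u^2 = - b\<close> otherwise. The entry of \<open>l\<close>
  at \<open>k\<close> still has the value 0 that it has in the coordinate space.\<close>

definition with_i0 :: "'n set \<Rightarrow> 'n \<Rightarrow> 'n \<Rightarrow> (complex ^ 'n::finite) \<times> (complex ^ 'n) \<Rightarrow>
    (complex ^ 'n) \<times> (complex ^ 'n)" where
  "with_i0 A j i0 y = (let a = sum11 (with_j j y); b = sum12 A (with_j j y) in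
     (\<chi> i. if i = i0 then if i0 \<in> A then a / b else b / a else fst y $ i,
      \<chi> i. if i = j then 1 else if i = i0 then if i0 \<in> A then - b else - (a ^ 2 / b) else snd y $ i))"

text \<open>Entry (2,1) of the residue condition then gives \<open>l\<close> at \<open>k\<close>.\<close>

definition recover :: "'n set \<Rightarrow> 'n \<Rightarrow> 'n \<Rightarrow> 'n \<Rightarrow> (complex ^ 'n::finite) \<times> (complex ^ 'n) \<Rightarrow>
    (complex ^ 'n) \<times> (complex ^ 'n)" where
  "recover A j k i0 y = (fst (with_i0 A j i0 y),
     \<chi> i. if i = k then - sum21 A (with_i0 A j i0 y) else snd (with_i0 A j i0 y) $ i)"

text \<open>The points where the formulas of \<open>with_i0\<close> have nonzero denominators and a nonzero \<open>l\<close> at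
  \<open>i0\<close>.\<close>

definition regular :: "'n set \<Rightarrow> 'n \<Rightarrow> 'n \<Rightarrow> ((complex ^ 'n::finite) \<times> (complex ^ 'n)) set" where
  "regular A j i0 = {y. sum12 A (with_j j y) \<noteq> 0 \<and> (i0 \<in> A \<or> sum11 (with_j j y) \<noteq> 0)}"

text \<open>Compares the sum over the full set of parameters with the one from which the parameters at one
  index have been removed.\<close>

lemma sum_change_one:
  fixes f g :: "'n::finite \<Rightarrow> complex"
  assumes "\<And>i. i \<noteq> i0 \<Longrightarrow> f i = g i" "f i0 = 0"
  shows "sum f UNIV = sum g UNIV - g i0"
proof -
  have "sum f UNIV = f i0 + sum f (UNIV - {i0})" by (simp add: sum.remove)
  also have "sum f (UNIV - {i0}) = sum g (UNIV - {i0})" using assms(1) by (intro sum.cong) auto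
  also have "\<dots> = sum g UNIV - g i0" by (simp add: sum.remove[of UNIV i0 g])
  finally show ?thesis using assms(2) by simp
qed

lemma continuous_on_if_const:
  "continuous_on S f \<Longrightarrow> continuous_on S g \<Longrightarrow> continuous_on S (\<lambda>y. if c then f y else g y)"
  by (cases c) auto

lemma continuous_on_sum11: "continuous_on S f \<Longrightarrow> continuous_on S (\<lambda>y. sum11 (f y))"
  and continuous_on_sum12: "continuous_on S f \<Longrightarrow> continuous_on S (\<lambda>y. sum12 A (f y))"
  and continuous_on_sum21: "continuous_on S f \<Longrightarrow> continuous_on S (\<lambda>y. sum21 A (f y))"
  unfolding sum11_def sum12_def sum21_def
  by (intro continuous_on_sum continuous_on_if_const continuous_on_mult continuous_on_power
      continuous_on_component continuous_on_fst continuous_on_snd; assumption)+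

lemma continuous_on_with_j: "continuous_on S (with_j j)"
  unfolding with_j_def[abs_def]
  by (intro continuous_on_Pair continuous_on_fst continuous_on_id continuous_on_vec_lambda
      continuous_on_if_const continuous_on_const continuous_on_component continuous_on_snd)

lemma open_regular: "open (regular A j i0)"
proof -
  have "regular A j i0 = {y. sum12 A (with_j j y) \<noteq> 0} \<inter> (if i0 \<in> A then UNIV else {y. sum11 (with_j j y) \<noteq> 0})"
    by (auto simp: regular_def)
  also have "open \<dots>"
    by (auto intro!: open_Int open_Collect_neq continuous_on_const
        continuous_on_sum11 continuous_on_sum12 continuous_on_with_j)
  finally show ?thesis .
qed

lemma continuous_on_recover: "continuous_on (regular A j i0) (recover A j k i0)"
proof -
  let ?R = "regular A j i0"
  have a: "continuous_on T (\<lambda>y. sum11 (with_j j y))" and b: "continuous_on T (\<lambda>y. sum12 A (with_j j y))" for T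
    by (intro continuous_on_sum11 continuous_on_sum12 continuous_on_with_j)+
  have "continuous_on ?R (\<lambda>y. if i0 \<in> A then sum11 (with_j j y) / sum12 A (with_j j y)
      else sum12 A (with_j j y) / sum11 (with_j j y))"
    by (cases "i0 \<in> A") (auto intro!: continuous_on_divide a b simp: regular_def)
  moreover have "continuous_on ?R (\<lambda>y. if i0 \<in> A then - sum12 A (with_j j y)
      else - (sum11 (with_j j y) ^ 2 / sum12 A (with_j j y)))"
    by (cases "i0 \<in> A") (auto intro!: continuous_on_divide continuous_on_minus continuous_on_power a b simp: regular_def)
  ultimately have w: "continuous_on ?R (with_i0 A j i0)"
    unfolding with_i0_def[abs_def] Let_def
    by (intro continuous_on_Pair continuous_on_fst continuous_on_id continuous_on_vec_lambda
      continuous_on_if_const[of _ _ _ "_ = _"] continuous_on_const continuous_on_component continuous_on_snd)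
  show ?thesis
    unfolding recover_def[abs_def]
    by (intro continuous_on_Pair continuous_on_fst continuous_on_vec_lambda
      continuous_on_if_const continuous_on_minus continuous_on_sum21 continuous_on_component continuous_on_snd w)
qed

context
  fixes A :: "'n::finite set" and j k i0 :: 'n
  assumes jk: "j \<in> A" "k \<notin> A" "i0 \<noteq> j" "i0 \<noteq> k"
begin

lemma recover_forget:
  assumes q: "q \<in> chart_valid A j k i0"
  shows "forget j k i0 q \<in> regular A j i0" "recover A j k i0 (forget j k i0 q) = q"
proof -
  define y where "y = forget j k i0 q"
  have q': "fst q $ j = 0" "fst q $ k = 0" "snd q $ j = 1" "\<And>i. snd q $ i \<noteq> 0"
    and s: "sum11 q = 0" "sum12 A q = 0" "sum21 A q = 0" and dom: "i0 \<in> A \<or> fst q $ i0 \<noteq> 0"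
    using q by (auto simp: chart_valid_def chart_params_def sum_chart_residues_eq_0)
  have y: "fst y $ i = (if i \<in> {j, k, i0} then 0 else fst q $ i)"
    "snd y $ i = (if i \<in> {j, k, i0} then 0 else snd q $ i)" for i
    by (auto simp: y_def forget_def)
  have "j \<noteq> k" using jk by auto
  have a: "sum11 (with_j j y) = - (snd q $ i0 * fst q $ i0)"
  proof -
    have "sum11 (with_j j y) = sum11 q - snd q $ i0 * fst q $ i0"
      unfolding sum11_def by (rule sum_change_one) (auto simp: with_j_def y q')
    with s show ?thesis by simp
  qed
  have b: "sum12 A (with_j j y) = - (if i0 \<in> A then snd q $ i0 else snd q $ i0 * fst q $ i0 ^ 2)"
  proof -
    have "sum12 A (with_j j y) = sum12 A q - (if i0 \<in> A then snd q $ i0 else snd q $ i0 * fst q $ i0 ^ 2)"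
      unfolding sum12_def by (rule sum_change_one) (use jk in \<open>auto simp: with_j_def y q'\<close>)
    with s show ?thesis by simp
  qed
  show "y \<in> regular A j i0"
    using q'(4)[of i0] dom by (auto simp: regular_def a b)
  have u: "fst (with_i0 A j i0 y) = fst q"
    using jk q' q'(4)[of i0] dom by (auto simp: vec_eq_iff with_i0_def Let_def a b y power2_eq_square)
  have l: "snd (with_i0 A j i0 y) $ i = (if i = k then 0 else snd q $ i)" for i
    using jk q' q'(4)[of i0] dom by (auto simp: with_i0_def Let_def a b y power2_eq_square)
  have "sum21 A (with_i0 A j i0 y) = sum21 A q - snd q $ k"
  proof -
    have "sum21 A (with_i0 A j i0 y) = sum21 A q - (if k \<in> A then snd q $ k * fst q $ k ^ 2 else snd q $ k)"
      unfolding sum21_def by (rule sum_change_one) (use jk in \<open>auto simp: u l\<close>)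
    with jk show ?thesis by simp
  qed
  with s u l show "recover A j k i0 y = q"
    by (auto simp: recover_def prod_eq_iff vec_eq_iff)
qed

lemma forget_recover:
  assumes y: "y \<in> coord_space (A, j, k, i0)" "y \<in> regular A j i0"
    and nz: "\<And>i. snd (recover A j k i0 y) $ i \<noteq> 0"
  shows "recover A j k i0 y \<in> chart_valid A j k i0" "forget j k i0 (recover A j k i0 y) = y"
proof -
  define q where "q = recover A j k i0 y"
  define a where "a = sum11 (with_j j y)"
  define b where "b = sum12 A (with_j j y)"
  have y0: "fst y $ i = 0" "snd y $ i = 0" if "i \<in> {j, k, i0}" for i
    using y(1) that by (auto simp: split_def)
  have ab: "b \<noteq> 0" "i0 \<in> A \<or> a \<noteq> 0" using y(2) by (auto simp: regular_def a_def b_def)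
  have jk': "j \<noteq> k" using jk by auto
  have u: "fst q $ i = (if i = i0 then if i0 \<in> A then a / b else b / a else fst y $ i)" for i
    by (simp add: q_def recover_def with_i0_def Let_def a_def b_def)
  have l: "snd q $ i = (if i = k then - sum21 A (with_i0 A j i0 y) else if i = j then 1
      else if i = i0 then if i0 \<in> A then - b else - (a ^ 2 / b) else snd y $ i)" for i
    by (simp add: q_def recover_def with_i0_def Let_def a_def b_def)
  have a_eq: "a = sum11 q - snd q $ i0 * fst q $ i0"
    unfolding a_def sum11_def by (rule sum_change_one) (use jk jk' y0 in \<open>auto simp: u l with_j_def\<close>)
  have "snd q $ i0 * fst q $ i0 = - a"
    using ab jk by (cases "i0 \<in> A") (simp_all add: u l power2_eq_square field_simps)
  with a_eq have s11: "sum11 q = 0" by simp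
  have b_eq: "b = sum12 A q - (if i0 \<in> A then snd q $ i0 else snd q $ i0 * fst q $ i0 ^ 2)"
    unfolding b_def sum12_def by (rule sum_change_one) (use jk jk' y0 in \<open>auto simp: u l with_j_def\<close>)
  have "(if i0 \<in> A then snd q $ i0 else snd q $ i0 * fst q $ i0 ^ 2) = - b"
    using ab jk by (cases "i0 \<in> A") (simp_all add: u l power2_eq_square field_simps)
  with b_eq have s12: "sum12 A q = 0" by simp
  have "sum21 A (with_i0 A j i0 y) = sum21 A q - (if k \<in> A then snd q $ k * fst q $ k ^ 2 else snd q $ k)"
    unfolding sum21_def
    by (rule sum_change_one) (use jk jk' y0 in \<open>auto simp: q_def recover_def with_i0_def Let_def\<close>)
  then have s21: "sum21 A q = 0" using jk l[of k] by simp
  have "i0 \<in> A \<or> fst q $ i0 \<noteq> 0" using ab by (auto simp: u)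
  moreover have "fst q $ j = 0" "fst q $ k = 0" "snd q $ j = 1"
    using jk jk' y0 by (auto simp: u l)
  ultimately show "q \<in> chart_valid A j k i0"
    using nz s11 s12 s21 by (simp add: chart_valid_def chart_params_def sum_chart_residues_eq_0 q_def)
  show "forget j k i0 q = y"
    using y0 by (auto simp: prod_eq_iff vec_eq_iff forget_def u l)
qed

lemma forget_in_coord_space: "forget j k i0 q \<in> coord_space (A, j, k, i0)"
  by (auto simp: forget_def)

lemma forget_image:
  "forget j k i0 ` (chart_valid A j k i0 \<inter> O') = coord_space (A, j, k, i0) \<inter>
    (regular A j i0 \<inter> recover A j k i0 -` {q \<in> O'. \<forall>i. snd q $ i \<noteq> 0})"
proof (intro set_eqI iffI)
  fix y assume "y \<in> forget j k i0 ` (chart_valid A j k i0 \<inter> O')"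
  then obtain q where q: "q \<in> chart_valid A j k i0" "q \<in> O'" and y: "y = forget j k i0 q" by auto
  then show "y \<in> coord_space (A, j, k, i0) \<inter>
    (regular A j i0 \<inter> recover A j k i0 -` {q \<in> O'. \<forall>i. snd q $ i \<noteq> 0})"
    using forget_in_coord_space[of q] recover_forget[OF q(1)]
    by (auto simp: chart_valid_def chart_params_def)
next
  fix y assume y: "y \<in> coord_space (A, j, k, i0) \<inter>
    (regular A j i0 \<inter> recover A j k i0 -` {q \<in> O'. \<forall>i. snd q $ i \<noteq> 0})"
  then have "recover A j k i0 y \<in> chart_valid A j k i0" "forget j k i0 (recover A j k i0 y) = y"
    using forget_recover[of y] by auto
  with y show "y \<in> forget j k i0 ` (chart_valid A j k i0 \<inter> O')"
    by (intro image_eqI[of _ _ "recover A j k i0 y"]) auto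
qed

lemma openin_forget_image:
  assumes "open O'"
  shows "openin (top_of_set (coord_space (A, j, k, i0))) (forget j k i0 ` (chart_valid A j k i0 \<inter> O'))"
proof -
  have "{q \<in> O'. \<forall>i. snd q $ i \<noteq> (0::complex)} = O' \<inter> (\<Inter>i. {q. snd q $ i \<noteq> 0})"
    by auto
  also have "open \<dots>"
    using assms by (intro open_Int open_INT finite ballI open_Collect_neq continuous_on_component continuous_on_snd
        continuous_on_id continuous_on_const)
  finally have "open (regular A j i0 \<inter> recover A j k i0 -` {q \<in> O'. \<forall>i. snd q $ i \<noteq> 0})"
    by (rule continuous_open_preimage[OF continuous_on_recover open_regular])
  then show ?thesis
    unfolding forget_image by (auto simp: openin_open)
qed

end

section \<open>The topology of the moduli space\<close>

lemma inj_on_chart_map: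
  assumes x: "inj x" and c: "c \<in> chart_index"
  shows "inj_on (chart_map x c) (chart_dom x c)"
proof -
  obtain A j k i0 where ch: "c = (A, j, k, i0)" "j \<in> A" "k \<notin> A" "i0 \<noteq> j" "i0 \<noteq> k"
    using c by (auto simp: chart_index_def)
  show ?thesis
    unfolding ch(1) chart_dom_eq[OF x ch(2,3)]
  proof (rule inj_onI)
    fix C C' assume "C \<in> (\<lambda>q. residue_class x (chart_residues A q)) ` chart_valid A j k i0"
      and "C' \<in> (\<lambda>q. residue_class x (chart_residues A q)) ` chart_valid A j k i0"
      and eq: "chart_map x (A, j, k, i0) C = chart_map x (A, j, k, i0) C'"
    then obtain q q' where q: "q \<in> chart_valid A j k i0" and q': "q' \<in> chart_valid A j k i0"
      and C: "C = residue_class x (chart_residues A q)" "C' = residue_class x (chart_residues A q')"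
      by blast
    have "q \<in> chart_params A j k" "q' \<in> chart_params A j k"
      using q q' by (auto simp: chart_valid_def)
    then have "forget j k i0 q = forget j k i0 q'"
      using eq unfolding C by (simp only: chart_map_class[OF x ch(2,3)])
    from arg_cong[OF this, of "recover A j k i0"] have "q = q'"
      unfolding recover_forget(2)[OF ch(2-5) q] recover_forget(2)[OF ch(2-5) q'] .
    then show "C = C'" by (simp add: C)
  qed
qed

text \<open>The sets that define the topology are closed under intersection because the charts are
  injective.\<close>

lemma openin_H0_topology:
  assumes x: "inj x"
  shows "openin (H0_topology x) U \<longleftrightarrow> U \<subseteq> H0 x \<and>
    (\<forall>c\<in>chart_index. openin (top_of_set (coord_space c)) (chart_map x c ` (U \<inter> chart_dom x c)))"
proof -
  define L where "L = (\<lambda>U. U \<subseteq> H0 x \<and>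
    (\<forall>c\<in>chart_index. openin (top_of_set (coord_space c)) (chart_map x c ` (U \<inter> chart_dom x c))))"
  have "istopology L"
    unfolding istopology_def
  proof (intro conjI allI impI)
    fix S T assume S: "L S" and T: "L T"
    have "openin (top_of_set (coord_space c)) (chart_map x c ` (S \<inter> T \<inter> chart_dom x c))"
      if c: "c \<in> chart_index" for c
    proof -
      have "S \<inter> T \<inter> chart_dom x c = (S \<inter> chart_dom x c) \<inter> (T \<inter> chart_dom x c)" by blast
      then have "chart_map x c ` (S \<inter> T \<inter> chart_dom x c) =
          chart_map x c ` (S \<inter> chart_dom x c) \<inter> chart_map x c ` (T \<inter> chart_dom x c)"
        by (simp only: inj_on_image_Int[OF inj_on_chart_map[OF x c] Int_lower2 Int_lower2])
      then show ?thesis using S T c by (simp add: L_def openin_Int)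
    qed
    with S show "L (S \<inter> T)" unfolding L_def by blast
  next
    fix K assume K: "\<forall>S\<in>K. L S"
    have "openin (top_of_set (coord_space c)) (chart_map x c ` (\<Union>K \<inter> chart_dom x c))"
      if c: "c \<in> chart_index" for c
    proof -
      have "chart_map x c ` (\<Union>K \<inter> chart_dom x c) = \<Union>((\<lambda>S. chart_map x c ` (S \<inter> chart_dom x c)) ` K)"
        by blast
      also have "openin (top_of_set (coord_space c)) \<dots>"
        using K c by (intro openin_Union) (auto simp: L_def)
      finally show ?thesis .
    qed
    with K show "L (\<Union>K)" unfolding L_def by blast
  qed
  from topology_inverse'[OF this] have "openin (H0_topology x) U = L U"
    unfolding H0_topology_def L_def[symmetric] by (rule fun_cong)
  then show ?thesis unfolding L_def .
qed

text \<open>Invariants of simultaneous conjugation. They are polynomials in the parameters of every chart, so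
  they give continuous functions on the moduli space without any comparison of charts.\<close>

definition trace_matrix :: "('n::finite \<Rightarrow> complex ^ 2 ^ 2) \<Rightarrow> complex ^ 'n ^ 'n" where
  "trace_matrix N = (\<chi> i j. trace (N i ** N j))"

lemma trace_matrix_conjugate:
  assumes "conjugate N M"
  shows "trace_matrix N = trace_matrix M"
proof -
  obtain c where c: "invertible c" "\<And>i. c ** N i = M i ** c"
    using assms by (auto simp: conjugate_def)
  have "trace (M i ** M j) = trace (N i ** N j)" for i j
  proof -
    have "M i ** M j = c ** ((N i ** N j) ** matrix_inv c)"
    proof -
      have "c ** (N i ** N j) = (M i ** M j) ** c"
        by (simp add: matrix_mul_assoc c(2)) (simp add: c(2) flip: matrix_mul_assoc)
      then have "(M i ** M j) ** (c ** matrix_inv c) = c ** ((N i ** N j) ** matrix_inv c)"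
        by (simp add: matrix_mul_assoc)
      then show ?thesis by (simp add: matrix_inv_both c(1))
    qed
    then have "trace (M i ** M j) = trace (c ** ((N i ** N j) ** matrix_inv c))"
      by simp
    also have "\<dots> = trace (((N i ** N j) ** matrix_inv c) ** c)"
      by (rule trace_mul_sym)
    finally show ?thesis by (simp add: matrix_mul_assoc[symmetric] matrix_inv_both c(1))
  qed
  then show ?thesis by (simp add: trace_matrix_def)
qed

definition class_traces :: "('n::finite \<Rightarrow> cp1) \<Rightarrow> 'n qp_higgs set \<Rightarrow> complex ^ 'n ^ 'n" where
  "class_traces x C = trace_matrix (SOME N. stable_residues N \<and> C = residue_class x N)"

lemma class_traces_eq:
  assumes x: "inj x" and N: "stable_residues N"
  shows "class_traces x (residue_class x N) = trace_matrix N"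
proof -
  define M where "M = (SOME M. stable_residues M \<and> residue_class x N = residue_class x M)"
  have "stable_residues M \<and> residue_class x N = residue_class x M"
    unfolding M_def by (rule someI[of _ N]) (simp add: N)
  then have "conjugate N M" using residue_class_eq_iff[OF x N] by blast
  from trace_matrix_conjugate[OF this] show ?thesis
    by (simp add: class_traces_def M_def)
qed

lemma continuous_trace_matrix:
  fixes A :: "'n::finite set"
  shows "continuous_on UNIV (\<lambda>q. trace_matrix (chart_residues A q))"
proof -
  have "continuous_on UNIV (\<lambda>q. chart_residues A q i $ a $ b)" for i a b
  proof -
    have "continuous_on UNIV (\<lambda>q. chart_residues A q i $ 1 $ 1)"
      "continuous_on UNIV (\<lambda>q. chart_residues A q i $ 1 $ 2)"
      "continuous_on UNIV (\<lambda>q. chart_residues A q i $ 2 $ 1)"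
      "continuous_on UNIV (\<lambda>q. chart_residues A q i $ 2 $ 2)"
      unfolding chart_residues_def param_residue_entries
      by (intro continuous_on_if_const continuous_on_mult continuous_on_minus continuous_on_power
          continuous_on_component continuous_on_fst continuous_on_snd continuous_on_id)+
    then show ?thesis
      using exhaust_2[of a] exhaust_2[of b] by auto
  qed
  then show ?thesis
    unfolding trace_matrix_def trace_def mult_entry2
    by (intro continuous_on_vec_lambda continuous_on_sum continuous_on_add continuous_on_mult)
qed

lemma openin_class_traces:
  fixes x :: "'n::finite \<Rightarrow> cp1"
  assumes x: "inj x" and V: "open V"
  shows "openin (H0_topology x) {C \<in> H0 x. class_traces x C \<in> V}"
  unfolding openin_H0_topology[OF x]
proof (intro conjI ballI)
  show "{C \<in> H0 x. class_traces x C \<in> V} \<subseteq> H0 x" by (rule Collect_restrict)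
  fix c :: "'n set \<times> 'n \<times> 'n \<times> 'n" assume "c \<in> chart_index"
  then obtain A j k i0 where c: "c = (A, j, k, i0)" and ch: "j \<in> A" "k \<notin> A" "i0 \<noteq> j" "i0 \<noteq> k"
    by (auto simp: chart_index_def)
  have "residue_class x (chart_residues A q) \<in> {C \<in> H0 x. class_traces x C \<in> V} \<longleftrightarrow>
      trace_matrix (chart_residues A q) \<in> V" if "q \<in> chart_valid A j k i0" for q
  proof -
    have "stable_residues (chart_residues A q)"
      using that by (intro stable_chart_residues[OF _ ch(1,2)]) (simp add: chart_valid_def)
    then show ?thesis
      by (simp add: class_traces_eq[OF x] residue_class_in_H0[OF x])
  qed
  then have "chart_map x c ` ({C \<in> H0 x. class_traces x C \<in> V} \<inter> chart_dom x c) =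
      forget j k i0 ` (chart_valid A j k i0 \<inter> ((\<lambda>q. trace_matrix (chart_residues A q)) -` V))"
    unfolding c chart_image[OF x ch(1,2)]
    by (intro arg_cong[of _ _ "(`) (forget j k i0)"]) auto
  moreover have "open ((\<lambda>q. trace_matrix (chart_residues A q)) -` V)"
    by (rule open_vimage[OF V continuous_trace_matrix])
  ultimately show "openin (top_of_set (coord_space c))
      (chart_map x c ` ({C \<in> H0 x. class_traces x C \<in> V} \<inter> chart_dom x c))"
    using openin_forget_image[OF ch] c by simp
qed

lemma topspace_H0_topology:
  assumes x: "inj x"
  shows "topspace (H0_topology x) = H0 x"
proof
  show "topspace (H0_topology x) \<subseteq> H0 x"
  proof -
    have "openin (H0_topology x) (topspace (H0_topology x))" by (rule openin_topspace)
    then show ?thesis unfolding openin_H0_topology[OF x] by (rule conjunct1)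
  qed
  have "openin (H0_topology x) (H0 x)"
    using openin_class_traces[OF x open_UNIV] by simp
  then show "H0 x \<subseteq> topspace (H0_topology x)" by (rule openin_subset)
qed

lemma continuous_map_class_traces:
  fixes x :: "'n::finite \<Rightarrow> cp1"
  assumes x: "inj x"
  shows "continuous_map (H0_topology x) euclidean (class_traces x)"
  unfolding continuous_map
proof (intro conjI allI impI)
  show "class_traces x ` topspace (H0_topology x) \<subseteq> topspace euclidean"
    by (simp only: topspace_euclidean subset_UNIV)
  fix V :: "(complex ^ 'n ^ 'n) set" assume "openin euclidean V"
  then have "open V" by (simp only: open_openin)
  then show "openin (H0_topology x) {C \<in> topspace (H0_topology x). class_traces x C \<in> V}"
    unfolding topspace_H0_topology[OF x] by (rule openin_class_traces[OF x])
qed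

section \<open>The components in the charts\<close>

text \<open>The parameter space of a component: the residues with parameters \<open>u = 0\<close> and \<open>l\<close> in the charts
  with \<open>A = S\<close>.\<close>

definition normalized_split :: "'n set \<Rightarrow> 'n \<Rightarrow> (complex ^ 'n::finite) set" where
  "normalized_split S j = {l. l $ j = 1 \<and> (\<forall>i. l $ i \<noteq> 0) \<and> (\<Sum>i\<in>S. l $ i) = 0 \<and> (\<Sum>i\<in>- S. l $ i) = 0}"

lemma chart_residues_split: "chart_residues A (0, l) = split_residues A (($) l)"
  by (rule ext) (simp add: chart_residues_def split_residues_def)

lemma chart_params_split:
  assumes "k \<notin> A"
  shows "(0, l) \<in> chart_params A j k \<longleftrightarrow> l \<in> normalized_split A j"
proof -
  have "sum12 A (0, l) = (\<Sum>i\<in>A. l $ i)" "sum21 A (0, l) = (\<Sum>i\<in>- A. l $ i)" "sum11 (0, l) = 0"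
    by (simp_all add: sum11_def sum12_def sum21_def sum_if_mem cong: if_cong)
  then show ?thesis
    by (auto simp: chart_params_def normalized_split_def sum_chart_residues_eq_0)
qed

lemma stable_normalized_split:
  assumes "l \<in> normalized_split S j" "j \<in> S" "k \<notin> S"
  shows "stable_residues (split_residues S (($) l))"
proof -
  have "S \<noteq> {}" "S \<noteq> UNIV" using assms(2,3) by blast+
  with assms(1) show ?thesis by (simp add: normalized_split_def stable_split_residues)
qed

lemma normalized_split_in_Z:
  fixes x :: "'n::finite \<Rightarrow> cp1"
  assumes x: "inj x" and l: "l \<in> normalized_split A j" and jk: "j \<in> A" "k \<notin> A" and A: "A = S \<or> A = - S"
  shows "residue_class x (split_residues A (($) l)) \<in> Z x S"
  using A
proof
  note st = stable_normalized_split[OF l jk]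
  {
    assume "A = S"
    with split_residues_in_Z[OF x st] show ?thesis by simp
  next
    assume "A = - S"
    then have S: "- A = S" by simp
    note con = conjugate_split_swap[of A "($) l"]
    note st' = conjugate_stable[OF st con]
    have "residue_class x (split_residues A (($) l)) = residue_class x (split_residues S (\<lambda>i. - l $ i))"
      using residue_class_eq_iff[OF x st st'] con S by simp
    then show ?thesis
      using split_residues_in_Z[OF x st'] S by simp
  }
qed

text \<open>Whether two flags coincide is invariant under conjugation, so on \<open>Z x S\<close> each flag agrees with
  the one at \<open>j\<close>, spanned by \<open>e_1\<close>, or with the one at \<open>k\<close>, spanned by \<open>e_2\<close>, according to membership in \<open>S\<close>. A flag
  \<open>[1 : u]\<close> can only agree with \<open>e_1\<close>, and \<open>[u : 1]\<close> only with \<open>e_2\<close>; in both cases \<open>u = 0\<close>.\<close>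

lemma Z_chart_params:
  fixes x :: "'n::finite \<Rightarrow> cp1"
  assumes x: "inj x" and jk: "j \<in> A" "k \<notin> A" and q: "q \<in> chart_params A j k"
    and Z: "residue_class x (chart_residues A q) \<in> Z x S"
  shows "fst q = 0" "A = S \<or> A = - S"
proof -
  have q': "fst q $ j = 0" "fst q $ k = 0" and l: "snd q $ i \<noteq> 0" for i
    using q by (auto simp: chart_params_def)
  obtain l' where st: "stable_residues (split_residues S l')"
    and eq: "residue_class x (chart_residues A q) = residue_class x (split_residues S l')"
    by (rule Z_imp_split[OF x Z])
  have "conjugate (chart_residues A q) (split_residues S l')"
    using residue_class_eq_iff[OF x stable_chart_residues[OF q jk] st] eq by simp
  then obtain c where c: "invertible c" "\<And>i. c ** chart_residues A q i = split_residues S l' i ** c"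
    by (auto simp: conjugate_def)
  have inj: "inj (\<lambda>v. c *v v)"
    by (rule inj_on_inverseI[of _ "\<lambda>v. matrix_inv c *v v"]) (simp add: matrix_cancel c(1))
  have l'0: "l' i \<noteq> 0" for i using st by (simp add: stable_split_residues)
  define r where "r = (\<lambda>i. range ((*v) (chart_residues A q i)))"
  have r_eq: "r i = r m \<longleftrightarrow> (i \<in> S \<longleftrightarrow> m \<in> S)" for i m
  proof -
    have "r i = r m \<longleftrightarrow> (\<lambda>v. c *v v) ` r i = (\<lambda>v. c *v v) ` r m"
      by (rule inj_image_eq_iff[OF inj, symmetric])
    also have "\<dots> \<longleftrightarrow> range ((*v) (split_residues S l' i)) = range ((*v) (split_residues S l' m))"
      by (simp only: r_def range_conjugate[OF c(1) c(2)[of i]] range_conjugate[OF c(1) c(2)[of m]])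
    also have "\<dots> \<longleftrightarrow> (i \<in> S \<longleftrightarrow> m \<in> S)"
      using span_axis_distinct by (auto simp: range_split_residues[of l' i S] range_split_residues[of l' m S] l'0)
    finally show ?thesis .
  qed
  have r: "r i = vec.span {if i \<in> A then vector [1, fst q $ i] else vector [fst q $ i, 1]}" for i
    using range_param_residue[OF l[of i], of A i "fst q $ i"]
    by (simp add: r_def chart_residues_def param_line_def)
  have e: "vector [1, 0] = (axis 1 1 :: complex ^ 2)" "vector [0, 1] = (axis 2 1 :: complex ^ 2)"
    by (auto simp: vec2_eq_iff axis_def)
  have rj: "r j = vec.span {axis 1 1}" and rk: "r k = vec.span {axis 2 1}"
    using jk by (simp_all add: r q' e)
  then have jkS: "j \<in> S \<longleftrightarrow> k \<notin> S"
    using r_eq[of j k] span_axis_distinct by auto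
  have key: "fst q $ i = 0 \<and> (i \<in> A \<longleftrightarrow> (i \<in> S \<longleftrightarrow> j \<in> S))" for i
  proof -
    have mem: "(if i \<in> A then vector [1, fst q $ i] else vector [fst q $ i, 1]) \<in> r i"
      unfolding r by (simp add: vec.span_base)
    show ?thesis
    proof (cases "i \<in> S \<longleftrightarrow> j \<in> S")
      case True
      then have "r i = vec.span {axis 1 1}" using r_eq[of i j] rj by simp
      with mem True show ?thesis by (simp add: in_span_axis split: if_splits)
    next
      case False
      then have "r i = vec.span {axis 2 1}" using r_eq[of i k] rk jkS by simp
      with mem False show ?thesis by (simp add: in_span_axis split: if_splits)
    qed
  qed
  show "fst q = 0" using key by (simp add: vec_eq_iff)
  show "A = S \<or> A = - S" using key by (cases "j \<in> S") auto
qed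

lemma chart_image_Z:
  fixes x :: "'n::finite \<Rightarrow> cp1"
  assumes x: "inj x" and jk: "j \<in> A" "k \<notin> A"
  shows "chart_map x (A, j, k, i0) ` (Z x S \<inter> chart_dom x (A, j, k, i0)) =
    (if (A = S \<or> A = - S) \<and> i0 \<in> A then (\<lambda>l. forget j k i0 (0, l)) ` normalized_split A j else {})"
proof -
  have "{q \<in> chart_valid A j k i0. residue_class x (chart_residues A q) \<in> Z x S} =
      (if (A = S \<or> A = - S) \<and> i0 \<in> A then Pair 0 ` normalized_split A j else {})" (is "?L = ?R")
  proof (intro set_eqI iffI)
    fix q assume "q \<in> ?L"
    then have q: "q \<in> chart_params A j k" "i0 \<in> A \<or> fst q $ i0 \<noteq> 0"
      and Z: "residue_class x (chart_residues A q) \<in> Z x S" by (auto simp: chart_valid_def)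
    note qZ = Z_chart_params[OF x jk q(1) Z]
    then have "q = (0, snd q)" by (simp add: prod_eq_iff)
    moreover from this have "snd q \<in> normalized_split A j"
      using q(1) chart_params_split[OF jk(2), of "snd q" j] by simp
    ultimately have "q \<in> Pair 0 ` normalized_split A j" by (rule image_eqI)
    moreover have "i0 \<in> A" using q(2) qZ(1) by simp
    ultimately show "q \<in> ?R" using qZ(2) by simp
  next
    fix q assume "q \<in> ?R"
    then obtain l where A: "A = S \<or> A = - S" "i0 \<in> A" and l: "l \<in> normalized_split A j" and q: "q = (0, l)"
      by (auto split: if_splits)
    have "residue_class x (chart_residues A q) \<in> Z x S"
      unfolding q chart_residues_split by (rule normalized_split_in_Z[OF x l jk A(1)])
    then show "q \<in> ?L"
      using A(2) l by (simp add: q chart_valid_def chart_params_split[OF jk(2)])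
  qed
  then show ?thesis
    unfolding chart_image[OF x jk] by (simp add: image_image)
qed

definition split_coords :: "'n \<Rightarrow> 'n \<Rightarrow> 'n \<Rightarrow> ((complex ^ 'n::finite) \<times> (complex ^ 'n)) set" where
  "split_coords j k i0 = {y. fst y = 0 \<and> (\<forall>i\<in>{j, k, i0}. snd y $ i = 0)}"

text \<open>The two sums are, up to sign, the eliminated parameters \<open>l\<close> at \<open>i0\<close> and at \<open>k\<close>.\<close>

definition split_open :: "'n set \<Rightarrow> 'n \<Rightarrow> 'n \<Rightarrow> 'n \<Rightarrow> ((complex ^ 'n::finite) \<times> (complex ^ 'n)) set" where
  "split_open A j k i0 = {y. (\<forall>i\<in>- {j, k, i0}. snd y $ i \<noteq> 0) \<and>
     1 + (\<Sum>i\<in>A. snd y $ i) \<noteq> 0 \<and> (\<Sum>i\<in>- A. snd y $ i) \<noteq> 0}"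

lemma forget_normalized_split:
  fixes A :: "'n::finite set"
  assumes jk: "j \<in> A" "k \<notin> A" "i0 \<in> A" "i0 \<noteq> j"
  shows "(\<lambda>l. forget j k i0 (0, l)) ` normalized_split A j = split_coords j k i0 \<inter> split_open A j k i0"
proof (intro set_eqI iffI)
  have ne: "k \<noteq> j" "k \<noteq> i0" using jk by auto
  {
    fix y assume "y \<in> (\<lambda>l. forget j k i0 (0, l)) ` normalized_split A j"
    then obtain l where l: "l \<in> normalized_split A j" and y: "y = forget j k i0 (0, l)" by auto
    have l': "l $ j = 1" "\<And>i. l $ i \<noteq> 0" "(\<Sum>i\<in>A. l $ i) = 0" "(\<Sum>i\<in>- A. l $ i) = 0"
      using l by (auto simp: normalized_split_def)
    have yi: "snd y $ i = (if i \<in> {j, k, i0} then 0 else l $ i)" for i by (simp add: y forget_def)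
    have "(\<Sum>i\<in>A. snd y $ i) = (\<Sum>i\<in>A. l $ i - (if i = j then 1 else 0) - (if i = i0 then l $ i0 else 0))"
      using jk ne l' by (intro sum.cong) (auto simp: yi)
    also have "\<dots> = - 1 - l $ i0"
      using jk l' by (simp add: sum_subtractf)
    finally have "1 + (\<Sum>i\<in>A. snd y $ i) \<noteq> 0" using l'(2)[of i0] by simp
    moreover have "(\<Sum>i\<in>- A. snd y $ i) = (\<Sum>i\<in>- A. l $ i - (if i = k then l $ k else 0))"
      using jk ne by (intro sum.cong) (auto simp: yi)
    then have "(\<Sum>i\<in>- A. snd y $ i) \<noteq> 0"
      using jk l' by (simp add: sum_subtractf)
    ultimately show "y \<in> split_coords j k i0 \<inter> split_open A j k i0"
      using l'(2) by (auto simp: split_coords_def split_open_def yi) (auto simp: y forget_def vec_eq_iff)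
  next
    fix y assume y: "y \<in> split_coords j k i0 \<inter> split_open A j k i0"
    then have y0: "fst y = 0" "snd y $ j = 0" "snd y $ k = 0" "snd y $ i0 = 0"
      and nz: "\<And>i. i \<notin> {j, k, i0} \<Longrightarrow> snd y $ i \<noteq> 0"
      and s: "1 + (\<Sum>i\<in>A. snd y $ i) \<noteq> 0" "(\<Sum>i\<in>- A. snd y $ i) \<noteq> 0"
      by (auto simp: split_coords_def split_open_def)
    define a where "a = - (1 + (\<Sum>i\<in>A. snd y $ i))"
    define b where "b = - (\<Sum>i\<in>- A. snd y $ i)"
    define l where "l = (\<chi> i. if i = j then 1 else if i = i0 then a else if i = k then b else snd y $ i)"
    have "(\<Sum>i\<in>A. l $ i) = (\<Sum>i\<in>A. snd y $ i + (if i = j then 1 else 0) + (if i = i0 then a else 0))"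
      using jk ne y0 by (intro sum.cong) (auto simp: l_def)
    also have "\<dots> = 0" using jk by (simp add: sum.distrib a_def)
    finally have 1: "(\<Sum>i\<in>A. l $ i) = 0" .
    have "(\<Sum>i\<in>- A. l $ i) = (\<Sum>i\<in>- A. snd y $ i + (if i = k then b else 0))"
      using jk ne y0 by (intro sum.cong) (auto simp: l_def)
    also have "\<dots> = 0" using jk by (simp add: sum.distrib b_def)
    finally have 2: "(\<Sum>i\<in>- A. l $ i) = 0" .
    have "a \<noteq> 0" using s(1) unfolding a_def by (metis neg_equal_0_iff_equal)
    moreover have "b \<noteq> 0" using s(2) by (simp add: b_def)
    ultimately have "l \<in> normalized_split A j"
      using 1 2 nz by (auto simp: normalized_split_def l_def)
    moreover have "y = forget j k i0 (0, l)"
      using y0 by (auto simp: forget_def prod_eq_iff vec_eq_iff l_def)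
    ultimately show "y \<in> (\<lambda>l. forget j k i0 (0, l)) ` normalized_split A j" by blast
  }
qed

lemma open_split_open: "open (split_open A j k i0)"
proof -
  have "split_open A j k i0 = (\<Inter>i\<in>- {j, k, i0}. {y. snd y $ i \<noteq> 0}) \<inter>
      ({y. 1 + (\<Sum>i\<in>A. snd y $ i) \<noteq> 0} \<inter> {y. (\<Sum>i\<in>- A. snd y $ i) \<noteq> 0})"
    by (auto simp: split_open_def)
  also have "open \<dots>"
    by (intro open_Int open_INT finite ballI open_Collect_neq continuous_on_add continuous_on_sum
        continuous_on_component continuous_on_snd continuous_on_id continuous_on_const)
  finally show ?thesis .
qed

lemma subspace_split_coords: "subspace (split_coords j k i0)"
  by (simp add: subspace_def split_coords_def)

lemma dim_split_coords:
  fixes j k i0 :: "'n::finite"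
  assumes "j \<noteq> k" "i0 \<noteq> j" "i0 \<noteq> k"
  shows "dim (split_coords j k i0) = 2 * (CARD('n) - 3)"
proof -
  define d where "d = (\<lambda>(i, b). (0 :: complex ^ 'n, axis i b)) ` ((- {j, k, i0}) \<times> (Basis :: complex set))"
  have dB: "d \<subseteq> Basis"
    by (auto simp: d_def Basis_prod_def Basis_vec_def)
  have in_d: "(0, axis i b) \<in> d \<longleftrightarrow> i \<notin> {j, k, i0}" if "b \<in> Basis" for i and b :: complex
  proof -
    have "b \<noteq> 0" using that by auto
    then show ?thesis using that by (auto simp: d_def axis_eq_axis)
  qed
  have "split_coords j k i0 = {y. \<forall>i\<in>Basis. i \<notin> d \<longrightarrow> y \<bullet> i = 0}"
  proof (intro set_eqI iffI)
    fix y assume y: "y \<in> split_coords j k i0"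
    have "y \<bullet> e = 0" if e: "e \<in> Basis" "e \<notin> d" for e
    proof -
      consider b where "e = (b, 0)" | i b where "e = (0, axis i b)" "b \<in> Basis"
        using e(1) by (auto simp: Basis_prod_def Basis_vec_def)
      then show ?thesis
      proof cases
        case 1
        with y show ?thesis by (simp add: split_coords_def inner_prod_def)
      next
        case 2
        with e(2) in_d have "i \<in> {j, k, i0}" by blast
        with y 2 show ?thesis by (auto simp: split_coords_def inner_prod_def inner_axis)
      qed
    qed
    then show "y \<in> {y. \<forall>i\<in>Basis. i \<notin> d \<longrightarrow> y \<bullet> i = 0}" by blast
  next
    fix y :: "(complex ^ 'n) \<times> (complex ^ 'n)"
    assume "y \<in> {y. \<forall>i\<in>Basis. i \<notin> d \<longrightarrow> y \<bullet> i = 0}"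
    then have y: "\<And>e. e \<in> Basis \<Longrightarrow> e \<notin> d \<Longrightarrow> y \<bullet> e = 0" by blast
    have "fst y \<bullet> b = 0" if b: "b \<in> Basis" for b
    proof -
      have "b \<noteq> 0" using b by auto
      then have "(b, 0) \<notin> d" by (auto simp: d_def)
      moreover have "(b, 0) \<in> Basis" using b by (auto simp: Basis_prod_def)
      ultimately show ?thesis using y[of "(b, 0)"] by (simp add: inner_prod_def)
    qed
    then have "\<forall>b\<in>Basis. fst y \<bullet> b = 0" by blast
    then have "fst y = 0" by (simp only: euclidean_all_zero_iff)
    moreover have "snd y $ i = 0" if i: "i \<in> {j, k, i0}" for i
    proof -
      have "snd y $ i \<bullet> b = 0" if b: "b \<in> Basis" for b
      proof -
        have "(0, axis i b) \<notin> d" using in_d[OF b] i by blast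
        moreover have "(0, axis i b) \<in> (Basis :: ((complex ^ 'n) \<times> (complex ^ 'n)) set)"
          using b by (auto simp: Basis_prod_def Basis_vec_def)
        ultimately show ?thesis using y[of "(0, axis i b)"] by (simp add: inner_prod_def inner_axis)
      qed
      then have "\<forall>b\<in>Basis. snd y $ i \<bullet> b = 0" by blast
      then show ?thesis by (simp only: euclidean_all_zero_iff)
    qed
    ultimately show "y \<in> split_coords j k i0" by (auto simp: split_coords_def)
  qed
  then have "dim (split_coords j k i0) = card d"
    using dim_substandard[OF dB] by simp
  also have "card d = card ((- {j, k, i0}) \<times> (Basis :: complex set))"
    unfolding d_def by (rule card_image) (auto simp: inj_on_def axis_eq_axis)
  also have "\<dots> = 2 * (CARD('n) - 3)"
  proof -
    have "card {j, k, i0} = 3" using assms by simp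
    then have "card (- {j, k, i0}) = CARD('n) - 3"
      by (simp add: Compl_eq_Diff_UNIV card_Diff_subset)
    then show ?thesis by (simp add: card_cartesian_product DIM_complex)
  qed
  finally show ?thesis .
qed

lemma Ck_on_const: "Ck_on n (\<lambda>y. c) U"
proof (induction n arbitrary: c)
  case (Suc n)
  have "\<forall>y\<in>U. ((\<lambda>y. c) has_derivative (\<lambda>v. 0)) (at y)" by simp
  with Suc show ?case by (auto intro!: exI[of _ "\<lambda>_ _. 0"])
qed simp

lemma Ck_on_ident: "Ck_on n (\<lambda>y. y) U"
proof (cases n)
  case 0
  then show ?thesis by simp
next
  case (Suc m)
  have "\<forall>y\<in>U. ((\<lambda>y. y) has_derivative (\<lambda>v. v)) (at y)" by simp
  then show ?thesis unfolding Suc Ck_on.simps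
    by (intro exI[of _ "\<lambda>_ v. v"] conjI allI Ck_on_const)
qed

text \<open>The identity is a straightening diffeomorphism.\<close>

lemma euclidean_submanifold_open_in_subspace:
  fixes U W :: "'a::euclidean_space set"
  assumes "open U" "subspace W"
  shows "euclidean_submanifold (dim W) (W \<inter> U)"
  unfolding euclidean_submanifold_def
proof
  fix y assume y: "y \<in> W \<inter> U"
  have hom: "homeomorphism U U (\<lambda>y. y) (\<lambda>y. y)"
    by (simp add: homeomorphism_def)
  show "\<exists>U' V (h :: 'a \<Rightarrow> 'a) g W'. open U' \<and> y \<in> U' \<and> open V \<and> homeomorphism U' V h g \<and>
        (\<forall>k. Ck_on k h U' \<and> Ck_on k g V) \<and> subspace W' \<and> dim W' = dim W \<and> h ` (U' \<inter> (W \<inter> U)) = V \<inter> W'"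
    by (rule exI[of _ U], rule exI[of _ U], rule exI[of _ "\<lambda>y. y"], rule exI[of _ "\<lambda>y. y"],
        rule exI[of _ W]) (use y assms Ck_on_ident hom in auto)
qed

lemma Z_submanifold_in_charts:
  fixes x :: "'n::finite \<Rightarrow> cp1"
  assumes x: "inj x" and c: "c \<in> chart_index"
  shows "euclidean_submanifold (2 * (CARD('n) - 3)) (chart_map x c ` (Z x S \<inter> chart_dom x c))"
proof -
  obtain A j k i0 where ch: "c = (A, j, k, i0)" "j \<in> A" "k \<notin> A" "i0 \<noteq> j" "i0 \<noteq> k"
    using c by (auto simp: chart_index_def)
  have "j \<noteq> k" using ch by auto
  show ?thesis
  proof (cases "(A = S \<or> A = - S) \<and> i0 \<in> A")
    case True
    then have "chart_map x c ` (Z x S \<inter> chart_dom x c) = split_coords j k i0 \<inter> split_open A j k i0"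
      unfolding ch(1) chart_image_Z[OF x ch(2,3)]
      using forget_normalized_split[OF ch(2,3) _ ch(4)] by simp
    with euclidean_submanifold_open_in_subspace[OF open_split_open subspace_split_coords]
      dim_split_coords[OF \<open>j \<noteq> k\<close> ch(4,5)] show ?thesis by metis
  next
    case False
    then show ?thesis
      unfolding ch(1) chart_image_Z[OF x ch(2,3)] by (auto simp: euclidean_submanifold_def)
  qed
qed

section \<open>The topology of the components\<close>

lemma traces_split:
  "trace_matrix (split_residues S l) $ i $ m = (if i \<in> S \<longleftrightarrow> m \<in> S then 0 else - (l i * l m))"
  by (cases "i \<in> S"; cases "m \<in> S")
     (simp_all add: trace_matrix_def trace_def sum_2 mult_entry2 split_residues_entries)

text \<open>The inverse of the parametrization in terms of traces. If \<open>i\<close> and \<open>m\<close> lie on different sides of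
  the splitting, then \<open>tr (N_i N_m) = - l_i l_m\<close>, and \<open>l_j = 1\<close>.\<close>

definition split_parameters :: "'n set \<Rightarrow> 'n \<Rightarrow> 'n \<Rightarrow> complex ^ 'n ^ 'n \<Rightarrow> complex ^ 'n::finite" where
  "split_parameters S j k M = (\<chi> i. if i \<in> S then M $ i $ k / M $ j $ k else - M $ j $ i)"

text \<open>All of \<open>Z x S\<close> lies in the domain of the chart \<open>(S, j, k, i0)\<close>, and open sets of the moduli space
  are open in this chart, so the parametrization is continuous. Its inverse is continuous because it is
  expressed by the traces.\<close>

lemma Z_homeomorphic:
  fixes x :: "'n::finite \<Rightarrow> cp1"
  assumes x: "inj x" and ch: "j \<in> S" "k \<notin> S" "i0 \<in> S" "i0 \<noteq> j"
  shows "homeomorphic_maps (top_of_set (normalized_split S j)) (subtopology (H0_topology x) (Z x S))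
    (\<lambda>l. residue_class x (split_residues S (($) l))) (\<lambda>C. split_parameters S j k (class_traces x C))"
proof -
  let ?Y = "normalized_split S j" and ?X = "subtopology (H0_topology x) (Z x S)"
  define \<eta> where "\<eta> = (\<lambda>l :: complex ^ 'n. residue_class x (split_residues S (($) l)))"
  define \<kappa> where "\<kappa> = (\<lambda>C. split_parameters S j k (class_traces x C))"
  have kk: "i0 \<noteq> k" using ch by auto
  have st: "stable_residues (split_residues S (($) l))" if "l \<in> ?Y" for l
    by (rule stable_normalized_split[OF that ch(1,2)])
  have \<eta>Z: "\<eta> l \<in> Z x S" if "l \<in> ?Y" for l
    unfolding \<eta>_def by (rule split_residues_in_Z[OF x st[OF that]])
  have ZH: "Z x S \<subseteq> H0 x" by (auto simp: Z_def)
  have topX: "topspace ?X = Z x S"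
    using ZH by (auto simp: topspace_subtopology topspace_H0_topology[OF x])
  have traces: "class_traces x (\<eta> l) = trace_matrix (split_residues S (($) l))" if "l \<in> ?Y" for l
    unfolding \<eta>_def by (rule class_traces_eq[OF x st[OF that]])
  have \<kappa>\<eta>: "\<kappa> (\<eta> l) = l" if l: "l \<in> ?Y" for l
  proof -
    have "l $ j = 1" "l $ k \<noteq> 0" using l by (auto simp: normalized_split_def)
    with ch show ?thesis
      by (auto simp: \<kappa>_def traces[OF l] split_parameters_def traces_split vec_eq_iff)
  qed
  have surj: "\<exists>l\<in>?Y. C = \<eta> l" if C: "C \<in> Z x S" for C
  proof -
    obtain l where l: "stable_residues (split_residues S l)" "C = residue_class x (split_residues S l)"
      by (rule Z_imp_split[OF x C])
    have lj: "l j \<noteq> 0" using l(1) by (simp add: stable_split_residues)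
    define m where "m = (\<chi> i. if i \<in> S then l i / l j else l i * l j)"
    have con: "conjugate (split_residues S l) (split_residues S (($) m))"
      using conjugate_split_scale[OF lj, of S l] by (simp add: m_def vec_lambda_inverse)
    note st_m = conjugate_stable[OF l(1) con]
    have "m $ j = 1" using lj ch by (simp add: m_def)
    then have "m \<in> ?Y"
      using st_m by (simp add: normalized_split_def stable_split_residues)
    moreover have "C = \<eta> m"
      using residue_class_eq_iff[OF x l(1) st_m] con l(2) by (simp add: \<eta>_def)
    ultimately show ?thesis by blast
  qed
  have "continuous_map (top_of_set ?Y) (H0_topology x) \<eta>"
    unfolding continuous_map
  proof (intro conjI allI impI)
    show "\<eta> ` topspace (top_of_set ?Y) \<subseteq> topspace (H0_topology x)"
      using \<eta>Z ZH by (auto simp: topspace_H0_topology[OF x])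
    fix U assume U: "openin (H0_topology x) U"
    let ?T = "forget j k i0 ` {q \<in> chart_valid S j k i0. residue_class x (chart_residues S q) \<in> U}"
    have "(S, j, k, i0) \<in> chart_index" using ch kk by (simp add: chart_index_def)
    then have T: "openin (top_of_set (coord_space (S, j, k, i0))) ?T"
      using U unfolding openin_H0_topology[OF x] chart_image[OF x ch(1,2), symmetric] by blast
    have valid: "(0, l) \<in> chart_valid S j k i0" if "l \<in> ?Y" for l
      using that ch by (simp add: chart_valid_def chart_params_split)
    have "\<eta> l \<in> U \<longleftrightarrow> forget j k i0 (0, l) \<in> ?T" if l: "l \<in> ?Y" for l
    proof
      assume "\<eta> l \<in> U"
      then show "forget j k i0 (0, l) \<in> ?T"
        using valid[OF l] by (intro imageI) (simp add: \<eta>_def chart_residues_split)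
    next
      assume "forget j k i0 (0, l) \<in> ?T"
      then obtain q where q: "q \<in> chart_valid S j k i0" "residue_class x (chart_residues S q) \<in> U"
        and eq: "forget j k i0 (0, l) = forget j k i0 q" by blast
      from arg_cong[OF eq, of "recover S j k i0"] have "(0, l) = q"
        unfolding recover_forget(2)[OF ch(1,2,4) kk q(1)] recover_forget(2)[OF ch(1,2,4) kk valid[OF l]] .
      with q(2) show "\<eta> l \<in> U" by (simp add: \<eta>_def flip: chart_residues_split)
    qed
    then have "{l \<in> topspace (top_of_set ?Y). \<eta> l \<in> U} = ?Y \<inter> (\<lambda>l. forget j k i0 (0, l)) -` ?T"
      by auto
    also have "openin (top_of_set ?Y) \<dots>"
    proof (rule continuous_openin_preimage[OF _ _ T])
      show "continuous_on ?Y (\<lambda>l. forget j k i0 (0, l))"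
        unfolding forget_def fst_conv snd_conv
        by (intro continuous_on_Pair continuous_on_vec_lambda continuous_on_if_const continuous_on_const
            continuous_on_component continuous_on_id)
      show "(\<lambda>l. forget j k i0 (0, l)) \<in> ?Y \<rightarrow> coord_space (S, j, k, i0)"
        using forget_in_coord_space[OF ch(1,2,4) kk] by blast
    qed
    finally show "openin (top_of_set ?Y) {l \<in> topspace (top_of_set ?Y). \<eta> l \<in> U}" .
  qed
  then have \<eta>: "continuous_map (top_of_set ?Y) ?X \<eta>"
    using \<eta>Z by (simp add: continuous_map_in_subtopology)
  have "continuous_map ?X euclidean (class_traces x)"
    by (rule continuous_map_from_subtopology[OF continuous_map_class_traces[OF x]])
  moreover have "class_traces x C $ j $ k \<noteq> 0" if C: "C \<in> Z x S" for C
  proof -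
    obtain l where l: "l \<in> ?Y" "C = \<eta> l" using surj[OF C] by blast
    then have "l $ j \<noteq> 0" "l $ k \<noteq> 0" by (auto simp: normalized_split_def)
    with ch show ?thesis by (simp add: l(2) traces[OF l(1)] traces_split)
  qed
  ultimately have 1: "continuous_map ?X (top_of_set {M. M $ j $ k \<noteq> 0}) (class_traces x)"
    using topX by (simp add: continuous_map_in_subtopology Pi_def)
  have "continuous_on {M :: complex ^ 'n ^ 'n. M $ j $ k \<noteq> 0} (\<lambda>M. if i \<in> S then M $ i $ k / M $ j $ k else - M $ j $ i)" for i
    by (cases "i \<in> S") (auto intro!: continuous_on_divide continuous_on_minus continuous_on_component continuous_on_id)
  then have "continuous_on {M. M $ j $ k \<noteq> 0} (split_parameters S j k)"
    unfolding split_parameters_def[abs_def] by (rule continuous_on_vec_lambda)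
  then have "continuous_map (top_of_set {M. M $ j $ k \<noteq> 0}) euclidean (split_parameters S j k)"
    by simp
  from continuous_map_compose[OF 1 this] have "continuous_map ?X euclidean \<kappa>"
    by (simp add: \<kappa>_def o_def)
  moreover have "\<kappa> C \<in> ?Y" if "C \<in> Z x S" for C
    using surj[OF that] \<kappa>\<eta> by auto
  ultimately have "continuous_map ?X (top_of_set ?Y) \<kappa>"
    using topX by (simp add: continuous_map_in_subtopology Pi_def)
  moreover have "\<eta> (\<kappa> C) = C" if "C \<in> Z x S" for C
    using surj[OF that] \<kappa>\<eta> by auto
  ultimately have "homeomorphic_maps (top_of_set ?Y) ?X \<eta> \<kappa>"
    using \<eta> \<kappa>\<eta> topX by (simp add: homeomorphic_maps_def)
  then show ?thesis by (simp add: \<eta>_def \<kappa>_def)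
qed

text \<open>The complex line through two points satisfies the linear conditions. It leaves the parameter
  space at finitely many points only, and the complement of a finite set in the complex plane is
  connected.\<close>

lemma connected_normalized_split: "connected (normalized_split S j)"
proof (rule connected_iff_connected_component[THEN iffD2], intro ballI)
  fix a b assume a: "a \<in> normalized_split S j" and b: "b \<in> normalized_split S j"
  define h where "h = (\<lambda>t. \<chi> i. a $ i + t * (b $ i - a $ i))"
  define bad where "bad = {t. \<exists>i. a $ i + t * (b $ i - a $ i) = 0}"
  have a': "a $ i \<noteq> 0" and b': "b $ i \<noteq> 0" for i
    using a b by (auto simp: normalized_split_def)
  \<comment> \<open>Each coordinate vanishes for at most one parameter, because it does not vanish for \<open>t = 0\<close>.\<close>
  have "bad \<subseteq> (\<lambda>i. - a $ i / (b $ i - a $ i)) ` UNIV"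
  proof
    fix t assume "t \<in> bad"
    then obtain i where *: "a $ i + t * (b $ i - a $ i) = 0" by (auto simp: bad_def)
    with a'[of i] have "b $ i - a $ i \<noteq> 0" by auto
    then have "t = t * (b $ i - a $ i) / (b $ i - a $ i)" by simp
    also from * have "t * (b $ i - a $ i) = - a $ i" by (simp add: eq_neg_iff_add_eq_0 add.commute)
    finally have "t = - a $ i / (b $ i - a $ i)" .
    then show "t \<in> (\<lambda>i. - a $ i / (b $ i - a $ i)) ` UNIV" by (rule image_eqI) simp
  qed
  then have "finite bad" by (rule finite_subset) simp
  have "connected (- bad)"
    by (intro path_connected_imp_connected path_connected_complement_countable)
       (auto simp: countable_finite \<open>finite bad\<close>)
  moreover have "continuous_on (- bad) h"
    unfolding h_def by (intro continuous_on_vec_lambda continuous_intros)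
  ultimately have "connected (h ` (- bad))"
    by (intro connected_continuous_image)
  moreover have "h ` (- bad) \<subseteq> normalized_split S j"
  proof clarify
    fix t assume t: "t \<notin> bad"
    have "(\<Sum>i\<in>T. h t $ i) = 0" if "(\<Sum>i\<in>T. a $ i) = 0" "(\<Sum>i\<in>T. b $ i) = 0" for T
      using that by (simp add: h_def sum.distrib sum_subtractf flip: sum_distrib_left)
    then show "h t \<in> normalized_split S j"
      using a b t by (simp add: normalized_split_def h_def bad_def)
  qed
  moreover have "a = h 0" "b = h 1" by (simp_all add: h_def vec_eq_iff)
  moreover have "0 \<notin> bad" "1 \<notin> bad" by (auto simp: bad_def a' b')
  ultimately show "connected_component (normalized_split S j) a b"
    unfolding connected_component_def by (intro exI[of _ "h ` (- bad)"]) auto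
qed

lemma normalized_split_nonempty:
  fixes S :: "'n::finite set"
  assumes S: "2 \<le> card S" "2 \<le> card (- S)" and j: "j \<in> S"
  shows "normalized_split S j \<noteq> {}"
proof -
  have "\<not> S \<subseteq> {j}"
    using S(1) card_mono[of "{j}" S] by auto
  then obtain p where p: "p \<in> S" "p \<noteq> j" by blast
  have "- S \<noteq> {}" using S(2) by auto
  then obtain q where q: "q \<notin> S" by blast
  define l where "l = (\<chi> i. if i = p then - of_nat (card S - 1) else if i = q then - of_nat (card (- S) - 1) else (1::complex))"
  have "(\<Sum>i\<in>S. l $ i) = (\<Sum>i\<in>S - {p}. l $ i) + l $ p"
    using p by (simp add: sum.remove)
  also have "(\<Sum>i\<in>S - {p}. l $ i) = (\<Sum>i\<in>S - {p}. 1)"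
    using q by (intro sum.cong) (auto simp: l_def)
  finally have 1: "(\<Sum>i\<in>S. l $ i) = 0"
    using p by (simp add: l_def card_Diff_singleton)
  have "(\<Sum>i\<in>- S. l $ i) = (\<Sum>i\<in>- S - {q}. l $ i) + l $ q"
    using q by (simp add: sum.remove)
  also have "(\<Sum>i\<in>- S - {q}. l $ i) = (\<Sum>i\<in>- S - {q}. 1)"
    using p by (intro sum.cong) (auto simp: l_def)
  also have "l $ q = - of_nat (card (- S) - 1)" using p q by (auto simp: l_def)
  finally have 2: "(\<Sum>i\<in>- S. l $ i) = 0"
    using q by (simp add: card_Diff_singleton)
  have "l $ j = 1" using p q j by (auto simp: l_def)
  moreover have "l $ i \<noteq> 0" for i
  proof -
    have "card S - 1 \<noteq> 0" "card (- S) - 1 \<noteq> 0" using S by auto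
    then show ?thesis by (simp add: l_def del: of_nat_diff)
  qed
  ultimately show ?thesis
    using 1 2 by (auto simp: normalized_split_def)
qed

text \<open>Multiplying all entries outside \<open>S\<close> by a common nonzero factor preserves the conditions.\<close>

lemma normalized_split_unbounded:
  assumes l: "l \<in> normalized_split S j" and jk: "j \<in> S" "k \<notin> S"
  shows "\<not> bounded (normalized_split S j)"
proof
  assume "bounded (normalized_split S j)"
  then obtain B where B: "\<And>m. m \<in> normalized_split S j \<Longrightarrow> norm m \<le> B"
    by (auto simp: bounded_iff)
  have l': "l $ j = 1" "\<And>i. l $ i \<noteq> 0" "(\<Sum>i\<in>S. l $ i) = 0" "(\<Sum>i\<in>- S. l $ i) = 0"
    using l by (auto simp: normalized_split_def)
  define r where "r = complex_of_real ((\<bar>B\<bar> + 1) / norm (l $ k))"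
  have "(\<bar>B\<bar> + 1) / norm (l $ k) \<noteq> 0" using l'(2)[of k] by auto
  then have r: "r \<noteq> 0" unfolding r_def by (simp only: of_real_eq_0_iff not_False_eq_True)
  define m where "m = (\<chi> i. if i \<in> S then l $ i else r * l $ i)"
  have "(\<Sum>i\<in>S. m $ i) = (\<Sum>i\<in>S. l $ i)" by (intro sum.cong) (auto simp: m_def)
  moreover have "(\<Sum>i\<in>- S. m $ i) = (\<Sum>i\<in>- S. r * l $ i)" by (intro sum.cong) (auto simp: m_def)
  then have "(\<Sum>i\<in>- S. m $ i) = 0" using l'(4) by (simp flip: sum_distrib_left)
  ultimately have "m \<in> normalized_split S j"
    using l' r jk by (simp add: normalized_split_def m_def)
  moreover have "norm (m $ k) \<le> norm m" by (rule Finite_Cartesian_Product.norm_nth_le)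
  ultimately have "norm (m $ k) \<le> B"
    using B by fastforce
  moreover have "norm (m $ k) = \<bar>B\<bar> + 1"
    using l'(2)[of k] jk by (simp add: m_def r_def norm_mult norm_divide)
  ultimately show False by linarith
qed

lemma second_countable_euclidean:
  "second_countable (euclidean :: 'a::second_countable_topology topology)"
proof -
  obtain B :: "'a set set" where B: "countable B" "topological_basis B"
    using ex_countable_basis by blast
  show ?thesis
    unfolding second_countable_def
  proof (intro exI[of _ B] conjI ballI allI impI)
    show "countable B" by (rule B(1))
    fix V assume "V \<in> B"
    then show "openin euclidean V" using topological_basis_open[OF B(2)] by simp
  next
    fix U and y :: 'a assume "openin euclidean U \<and> y \<in> U"
    then show "\<exists>V\<in>B. y \<in> V \<and> V \<subseteq> U"
      using topological_basisE[OF B(2), of U y] by (simp only: open_openin) blast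
  qed
qed

lemma admissible_cards:
  fixes S :: "'n::finite set"
  assumes "S \<in> admissible i1" "CARD('n) \<ge> 3"
  shows "i1 \<in> S" "2 \<le> card S" "2 \<le> card (- S)"
proof -
  show "i1 \<in> S" "2 \<le> card S" using assms by (auto simp: admissible_def)
  have "card S \<le> CARD('n) - 2" using assms by (simp add: admissible_def)
  moreover have "card (- S) = CARD('n) - card S"
    by (simp add: Compl_eq_Diff_UNIV card_Diff_subset)
  ultimately show "2 \<le> card (- S)" using assms(2) by linarith
qed

lemma Z_topology:
  fixes x :: "'n::finite \<Rightarrow> cp1"
  assumes n: "CARD('n) \<ge> 3" and x: "inj x" and S: "S \<in> admissible i1"
  shows "Hausdorff_space (subtopology (H0_topology x) (Z x S))"
    and "second_countable (subtopology (H0_topology x) (Z x S))"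
    and "\<not> compact_space (subtopology (H0_topology x) (Z x S))"
    and "connectedin (H0_topology x) (Z x S)"
    and "Z x S \<noteq> {}"
proof -
  note c = admissible_cards[OF S n]
  have "\<not> S \<subseteq> {i1}"
    using c(2) card_mono[of "{i1}" S] by auto
  then obtain i0 where i0: "i0 \<in> S" "i0 \<noteq> i1" by blast
  have "- S \<noteq> {}" using c(3) by auto
  then obtain k where k: "k \<notin> S" by blast
  let ?Y = "normalized_split S i1" and ?X = "subtopology (H0_topology x) (Z x S)"
  obtain l where l: "l \<in> ?Y" using normalized_split_nonempty[OF c(2,3,1)] by blast
  have hom: "top_of_set ?Y homeomorphic_space ?X"
    using Z_homeomorphic[OF x c(1) k i0] unfolding homeomorphic_space_def by blast
  have "Hausdorff_space (top_of_set ?Y)"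
    by (rule Hausdorff_space_subtopology) (rule Hausdorff_space_euclidean)
  with homeomorphic_Hausdorff_space[OF hom] show "Hausdorff_space ?X" by blast
  have "second_countable (top_of_set ?Y)"
    by (rule second_countable_subtopology) (rule second_countable_euclidean)
  with homeomorphic_space_second_countability[OF hom] show "second_countable ?X" by blast
  have "\<not> compact ?Y"
    using normalized_split_unbounded[OF l c(1) k] compact_imp_bounded by blast
  then have "\<not> compact_space (top_of_set ?Y)"
    using compactin_subspace[of euclidean ?Y] by simp
  with homeomorphic_compact_space[OF hom] show "\<not> compact_space ?X" by blast
  have "connected_space (top_of_set ?Y)"
  proof -
    have "connectedin euclidean ?Y"
      unfolding connectedin_iff_connected by (rule connected_normalized_split)
    then show ?thesis unfolding connectedin_def by (rule conjunct2)
  qed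
  with homeomorphic_connected_space[OF hom] have "connected_space ?X" by blast
  moreover have "Z x S \<subseteq> topspace (H0_topology x)"
    by (auto simp: topspace_H0_topology[OF x] Z_def)
  ultimately show "connectedin (H0_topology x) (Z x S)" by (simp add: connectedin_def)
  show "Z x S \<noteq> {}"
    using split_residues_in_Z[OF x stable_normalized_split[OF l c(1) k]] by blast
qed

section \<open>Connected components\<close>

lemma Z_traces:
  assumes x: "inj x" and C: "C \<in> Z x S"
  shows "class_traces x C $ i $ m = 0 \<longleftrightarrow> (i \<in> S \<longleftrightarrow> m \<in> S)"
proof -
  obtain l where l: "stable_residues (split_residues S l)" "C = residue_class x (split_residues S l)"
    by (rule Z_imp_split[OF x C])
  have "l i \<noteq> 0" "l m \<noteq> 0" using l(1) by (auto simp: stable_split_residues)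
  then show ?thesis
    by (simp add: l(2) class_traces_eq[OF x l(1)] traces_split)
qed

lemma Z_disjoint:
  assumes x: "inj x" and i1: "i1 \<in> S" "i1 \<in> T" and C: "C \<in> Z x S" "C \<in> Z x T"
  shows "S = T"
proof -
  have "i \<in> S \<longleftrightarrow> i \<in> T" for i
    using Z_traces[OF x C(1), of i1 i] Z_traces[OF x C(2), of i1 i] i1 by simp
  then show ?thesis by blast
qed

text \<open>By \<open>Z_traces\<close> the sets \<open>Z x T\<close> are distinguished by which traces vanish. For \<open>k\<close> outside \<open>S\<close>,
  nonvanishing of the traces of index \<open>(i1, i)\<close> with \<open>i \<notin> S\<close> gives \<open>T \<subseteq> S\<close>, and nonvanishing of those
  of index \<open>(i, k)\<close> with \<open>i \<in> S\<close> gives \<open>S \<subseteq> T\<close>.\<close>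

lemma Z_openin:
  fixes x :: "'n::finite \<Rightarrow> cp1"
  assumes n: "CARD('n) \<ge> 3" and x: "inj x" and S: "S \<in> admissible i1"
  shows "openin (subtopology (H0_topology x) (H0_real x i1)) (Z x S)"
proof -
  note c = admissible_cards[OF _ n]
  have "- S \<noteq> {}" using c(3)[OF S] by auto
  then obtain k where k: "k \<notin> S" by blast
  define V where "V = {M :: complex ^ 'n ^ 'n. (\<forall>i\<in>- S. M $ i1 $ i \<noteq> 0) \<and> (\<forall>i\<in>S. M $ i $ k \<noteq> 0)}"
  have "V = (\<Inter>i\<in>- S. {M. M $ i1 $ i \<noteq> 0}) \<inter> (\<Inter>i\<in>S. {M. M $ i $ k \<noteq> 0})"
    by (auto simp: V_def)
  also have "open \<dots>"
    by (intro open_Int open_INT finite ballI open_Collect_neq continuous_on_component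
        continuous_on_id continuous_on_const)
  finally have V: "open V" .
  have "class_traces x C \<in> V \<longleftrightarrow> T = S" if T: "T \<in> admissible i1" and C: "C \<in> Z x T" for T C
  proof -
    have i1: "i1 \<in> S" "i1 \<in> T" using c(1)[OF S] c(1)[OF T] by auto
    have "class_traces x C \<in> V \<longleftrightarrow> (\<forall>i\<in>- S. i \<notin> T) \<and> (\<forall>i\<in>S. \<not> (i \<in> T \<longleftrightarrow> k \<in> T))"
      unfolding V_def mem_Collect_eq Z_traces[OF x C] using i1(2) by simp
    also have "\<dots> \<longleftrightarrow> T = S" using k by auto
    finally show ?thesis .
  qed
  moreover have "Z x T \<subseteq> H0 x" for T by (auto simp: Z_def)
  ultimately have "Z x S = {C \<in> H0 x. class_traces x C \<in> V} \<inter> H0_real x i1"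
    using S unfolding H0_real_def by blast
  with openin_class_traces[OF x V] show ?thesis
    unfolding openin_subtopology by blast
qed

lemma components_H0_real:
  fixes x :: "'n::finite \<Rightarrow> cp1"
  assumes n: "CARD('n) \<ge> 3" and x: "inj x"
  shows "connected_components_of (subtopology (H0_topology x) (H0_real x i1)) = Z x ` admissible i1"
proof -
  let ?X = "subtopology (H0_topology x) (H0_real x i1)"
  note c = admissible_cards[OF _ n]
  have ZR: "Z x S \<subseteq> H0_real x i1" if "S \<in> admissible i1" for S
    using that by (auto simp: H0_real_def)
  have "H0_real x i1 \<subseteq> H0 x" by (auto simp: H0_real_def Z_def)
  then have top: "topspace ?X = (\<Union>S\<in>admissible i1. Z x S)"
    by (auto simp: topspace_subtopology topspace_H0_topology[OF x] H0_real_def)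
  have con: "connectedin ?X (Z x S)" if "S \<in> admissible i1" for S
    using Z_topology(4)[OF n x that] ZR[OF that] by (simp add: connectedin_subtopology)
  have open_Z: "openin ?X (Z x S)" if "S \<in> admissible i1" for S
    by (rule Z_openin[OF n x that])
  have closed_Z: "closedin ?X (Z x S)" if S: "S \<in> admissible i1" for S
  proof -
    have "topspace ?X - Z x S = (\<Union>T\<in>admissible i1 - {S}. Z x T)"
      unfolding top using Z_disjoint[OF x c(1)[OF S] c(1)] by blast
    also have "openin ?X \<dots>" by (intro openin_Union) (auto intro: open_Z)
    finally show ?thesis
      unfolding closedin_def top using S by blast
  qed
  have eq: "K = Z x S" if K: "K \<in> connected_components_of ?X" and S: "S \<in> admissible i1" and m: "\<not> disjnt K (Z x S)" for K S
  proof
    show "K \<subseteq> Z x S"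
      using connectedin_clopen_cases[OF connectedin_connected_components_of[OF K] closed_Z[OF S] open_Z[OF S]] m by blast
    show "Z x S \<subseteq> K" by (rule connected_components_of_maximal[OF K con[OF S] m])
  qed
  show ?thesis
  proof (intro set_eqI iffI)
    fix K assume K: "K \<in> connected_components_of ?X"
    then obtain C where C: "C \<in> K" using nonempty_connected_components_of by blast
    then have "C \<in> topspace ?X" using connected_components_of_subset[OF K] by blast
    then obtain S where S: "S \<in> admissible i1" "C \<in> Z x S" unfolding top by blast
    have "\<not> disjnt K (Z x S)" using C S(2) by (auto simp: disjnt_def)
    from eq[OF K S(1) this] S(1) show "K \<in> Z x ` admissible i1" by blast
  next
    fix K assume "K \<in> Z x ` admissible i1"
    then obtain S where S: "S \<in> admissible i1" "K = Z x S" by blast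
    obtain C where C: "C \<in> Z x S" using Z_topology(5)[OF n x S(1)] by blast
    then have Ct: "C \<in> topspace ?X" unfolding top using S(1) by blast
    let ?K = "connected_component_of_set ?X C"
    have K: "?K \<in> connected_components_of ?X"
      using Ct by (simp only: connected_component_in_connected_components_of)
    have "C \<in> ?K" using Ct by (simp add: connected_component_of_refl)
    then have "\<not> disjnt ?K (Z x S)" using C by (auto simp: disjnt_def)
    from eq[OF K S(1) this] K S(2) show "K \<in> connected_components_of ?X" by simp
  qed
qed

text \<open>Of the \<open>2^(n-1)\<close> subsets containing \<open>i1\<close>, those excluded are \<open>{i1}\<close>, the whole set, and the
  \<open>n - 1\<close> complements of another single index; these are distinct because \<open>n \<ge> 3\<close>.\<close>

lemma card_admissible:
  fixes i1 :: "'n::finite"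
  assumes n: "CARD('n) \<ge> 3"
  shows "card (admissible i1) = 2 ^ (CARD('n) - 1) - (CARD('n) + 1)"
proof -
  let ?P = "{S :: 'n set. i1 \<in> S}"
  have card_P: "card ?P = 2 ^ (CARD('n) - 1)"
  proof -
    have "?P = insert i1 ` Pow (UNIV - {i1})"
    proof (intro set_eqI iffI)
      fix S :: "'n set" assume "S \<in> ?P"
      then have "S = insert i1 (S - {i1})" by blast
      then show "S \<in> insert i1 ` Pow (UNIV - {i1})" by blast
    qed auto
    moreover have "inj_on (insert i1) (Pow (UNIV - {i1}))"
      by (rule inj_onI) (metis Diff_insert_absorb Pow_iff insert_Diff_single subset_Diff_insert)
    ultimately show ?thesis
      by (simp add: card_image card_Pow card_Diff_singleton)
  qed
  have P: "?P = admissible i1 \<union> ({{i1}, UNIV} \<union> (\<lambda>i. UNIV - {i}) ` (UNIV - {i1}))" (is "_ = _ \<union> ?E")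
  proof (intro set_eqI iffI)
    fix S :: "'n set" assume S: "S \<in> ?P"
    show "S \<in> admissible i1 \<union> ?E"
    proof (rule ccontr)
      assume no: "S \<notin> admissible i1 \<union> ?E"
      have le: "card S \<le> CARD('n)" by (rule card_mono) auto
      have "card S \<noteq> 0" using S by auto
      moreover have "card S \<noteq> 1"
      proof
        assume "card S = 1"
        then obtain a where "S = {a}" by (rule card_1_singletonE)
        with S have "S = {i1}" by blast
        with no show False by blast
      qed
      moreover have "card S \<noteq> CARD('n)" using no card_subset_eq[of UNIV S] by auto
      moreover have "card S \<noteq> CARD('n) - 1"
      proof
        assume "card S = CARD('n) - 1"
        moreover have "card (- S) = CARD('n) - card S"
          by (simp add: Compl_eq_Diff_UNIV card_Diff_subset)
        ultimately have "card (- S) = 1" using n by simp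
        then obtain i where "- S = {i}" by (rule card_1_singletonE)
        then have "S = UNIV - {i}" "i \<noteq> i1" using S by auto
        with no show False by blast
      qed
      moreover have "\<not> (2 \<le> card S \<and> card S \<le> CARD('n) - 2)"
        using no S by (simp add: admissible_def)
      ultimately show False using le n by linarith
    qed
  next
    fix S assume "S \<in> admissible i1 \<union> ?E"
    then show "S \<in> ?P" by (auto simp: admissible_def)
  qed
  have disj: "admissible i1 \<inter> ?E = {}"
    using n by (auto simp: admissible_def card_Diff_singleton)
  have "card ((\<lambda>i. UNIV - {i}) ` (UNIV - {i1 :: 'n})) = CARD('n) - 1"
    by (subst card_image) (auto simp: inj_on_def card_Diff_singleton)
  moreover have "card {{i1}, UNIV :: 'n set} = 2"
  proof -
    have "{i1} \<noteq> UNIV"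
    proof
      assume "{i1} = UNIV"
      then have "CARD('n) = card {i1}" by simp
      with n show False by simp
    qed
    then show ?thesis by simp
  qed
  moreover have "{{i1}, UNIV} \<inter> (\<lambda>i. UNIV - {i}) ` (UNIV - {i1}) = {}"
  proof -
    have "S \<noteq> UNIV - {i}" if "S \<in> {{i1}, UNIV}" for S and i :: 'n
    proof
      assume "S = UNIV - {i}"
      then have "card S = CARD('n) - 1" by (simp add: card_Diff_singleton)
      moreover have "card S = 1 \<or> card S = CARD('n)" using that by auto
      ultimately show False using n by linarith
    qed
    then show ?thesis by blast
  qed
  ultimately have "card ?E = CARD('n) + 1"
    using n by (subst card_Un_disjoint) auto
  moreover have "card ?P = card (admissible i1) + card ?E"
    unfolding P by (rule card_Un_disjoint[OF _ _ disj]) auto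
  ultimately show ?thesis using card_P by simp
qed

theorem theorem4p4:
  fixes x :: "'n::finite \<Rightarrow> cp1" and i1 :: 'n
  assumes "CARD('n) \<ge> 3" and "inj x"
  shows "{C \<in> H0 x. Theta x C = C} = H0_real x i1 \<and>
    (\<forall>S\<in>admissible i1.
       is_submanifold x (2 * (CARD('n) - 3)) (Z x S) \<and>
       \<not> compact_space (subtopology (H0_topology x) (Z x S))) \<and>
    finite (connected_components_of (subtopology (H0_topology x) (H0_real x i1))) \<and>
    card (connected_components_of (subtopology (H0_topology x) (H0_real x i1))) =
      2 ^ (CARD('n) - 1) - (CARD('n) + 1)"
proof (intro conjI ballI)
  note n = assms(1) and x = assms(2)
  show "{C \<in> H0 x. Theta x C = C} = H0_real x i1"
    by (rule fixed_points_eq_H0_real[OF x])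
  fix S assume S: "S \<in> admissible i1"
  show "is_submanifold x (2 * (CARD('n) - 3)) (Z x S)"
    unfolding is_submanifold_def
    using Z_topology(1,2)[OF n x S] Z_submanifold_in_charts[OF x] by (auto simp: Z_def)
  show "\<not> compact_space (subtopology (H0_topology x) (Z x S))"
    by (rule Z_topology(3)[OF n x S])
next
  note n = assms(1) and x = assms(2)
  show "finite (connected_components_of (subtopology (H0_topology x) (H0_real x i1)))"
    unfolding components_H0_real[OF n x] by simp
  have "inj_on (Z x) (admissible i1)"
  proof (rule inj_onI)
    fix S T assume S: "S \<in> admissible i1" and T: "T \<in> admissible i1" and eq: "Z x S = Z x T"
    obtain C where "C \<in> Z x S" using Z_topology(5)[OF n x S] by blast
    with eq show "S = T"
      using Z_disjoint[OF x admissible_cards(1)[OF S n] admissible_cards(1)[OF T n]] by blast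
  qed
  then show "card (connected_components_of (subtopology (H0_topology x) (H0_real x i1))) =
      2 ^ (CARD('n) - 1) - (CARD('n) + 1)"
    unfolding components_H0_real[OF n x] by (simp add: card_image card_admissible[OF n])
qed

end
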